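(* Let $\bar A=(A_0,A_1)$ be a compatible couple of (quasi-)Banach spaces with $A_0\cap A_1\neq\{0\}$. Let $0<q_1,r_1\le\infty$ and $a_1,b_1\in SV$ be such that $\|s^{-1/r_1}b_1(s)\|_{r_1,(1,\infty)}<\infty$ and $\left\|s^{-1/r_1}b_1(s)\|u^{-1/q_1}a_1(u)\|_{q_1,(0,s)}\right\|_{r_1,(0,1)}<\infty$, and put $$\chi_1(t)=\left\|s^{-1/r_1}b_1(s)\|u^{-1/q_1}a_1(u)\|_{q_1,(0,s)}\right\|_{r_1,(0,t)}+\|s^{-1/r_1}b_1(s)\|_{r_1,(t,\infty)}\|u^{-1/q_1}a_1(u)\|_{q_1,(0,t)}.$$ Let $0<r\le\infty$ and $a\in SV$. Put $\rho(t)=\frac{t}{\chi_1(t)}$. For given $0\le\theta\le1$ denote $a^{\#}=\chi_1^{\theta}\,(a\circ\rho)$. (i) If $0<\theta<1$, then $\left(A_0,\bar A^{\mathcal L}_{1,r_1,b_1,q_1,a_1}\right)_{\theta,r,a}=\bar A_{\theta,r,a^{\#}}$. (ii) If $\|s^{-1/r}a(s)\|_{r,(1,\infty)}<\infty$, then $\left(A_0,\bar A^{\mathcal L}_{1,r_1,b_1,q_1,a_1}\right)_{0,r,a}=\bar A_{0,r,a\circ\rho}$. (iii) If $\|s^{-1/r}a(s)\|_{r,(0,1)}<\infty$, then, with $\theta=1$ (i.e. $a^{\#}=\chi_1\,(a\circ\rho)$), $\left(A_0,\bar A^{\mathcal L}_{1,r_1,b_1,q_1,a_1}\right)_{1,r,a}=\bar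 A_{1,r,a^{\#}}\cap\bar A^{\mathcal L,\mathcal R}_{1,r,a\circ\rho,r_1,b_1,q_1,a_1}$.
   Context: Conventions: $1/\infty=0$; $\|\cdot\|_{q,(a,b)}$ is the usual (quasi-)norm of $L_q$ on the interval $(a,b)$, $0<q\le\infty$. Two positive functions satisfy $f\approx g$ (are equivalent) if $C^{-1}g\le f\le Cg$ for some constant $C>0$ independent of all significant quantities. $b\in SV$ (slowly varying) means that $b$ is a positive Lebesgue measurable function on $(0,\infty)$ such that for each $\varepsilon>0$ the function $t^{\varepsilon}b(t)$ is equivalent to an increasing function and $t^{-\varepsilon}b(t)$ is equivalent to a decreasing function. For a compatible couple $(X_0,X_1)$ of (quasi-)normed spaces, $K(t,f;X_0,X_1)=\inf\{\|f_0\|_{X_0}+t\|f_1\|_{X_1}: f=f_0+f_1,\ f_i\in X_i\}$ for $f\in X_0+X_1$, $t>0$; $K(t,f):=K(t,f;A_0,A_1)$. For $0\le\theta\le1$, $0<q\le\infty$, $b\in SV$, $(X_0,X_1)_{\theta,q,b}$ is the space of all $f\in X_0+X_1$ with finite (quasi-)norm $\|u^{-\theta-1/q}b(u)K(u,f;X_0,X_1)\|_{q,(0,\infty)}$, and $\bar A_{\theta,q,b}:=(A_0,A_1)_{\theta,q,b}$. For $0<p,r,q\le\infty$ and $a,b,c\in SV$, the following are the spaces of all $f\in A_0+A_1$ with finite (quasi-)norm: - $\bar A^{\mathcal L}_{\theta,r,b,q,a}$: $\left\|t^{-1/r}b(t)\|u^{-\theta-1/q}a(u)K(u,f)\|_{q,(0,t)}\right\|_{r,(0,\infty)}$;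 - $\bar A^{\mathcal L,\mathcal R}_{\theta,p,c,r,b,q,a}$: $\left\|t^{-1/p}c(t)\left\|u^{-1/r}b(u)\|v^{-\theta-1/q}a(v)K(v,f)\|_{q,(t,u)}\right\|_{r,(t,\infty)}\right\|_{p,(0,\infty)}$. Equality of (quasi-)normed spaces means that each is continuously embedded in the other; intersections carry the maximum (equivalently, the sum) of the (quasi-)norms. Standing assumption: none of the spaces under consideration is $\{0\}$. *)

theory Defs
  imports "HOL-Analysis.Analysis" "HOL-Probability.Essential_Supremum"
begin

section \<open>Quasi-norms and compatible couples\<close>

text \<open>
  A quasi-normed space inside an ambient real vector space is encoded by one extended quasi-norm
  \<open>N :: 'v \<Rightarrow> ennreal\<close>: the space consists of the vectors of finite norm.
  Complex spaces are covered by restriction of scalars, which changes none of the notions below.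
\<close>

definition carrier_of :: "('v \<Rightarrow> ennreal) \<Rightarrow> 'v set" where
  "carrier_of N = {x. N x < \<infinity>}"

definition quasi_norm :: "('v::real_vector \<Rightarrow> ennreal) \<Rightarrow> bool" where
  "quasi_norm N \<longleftrightarrow>
     (\<forall>x. N x = 0 \<longleftrightarrow> x = 0) \<and>
     (\<forall>c x. N (c *\<^sub>R x) = ennreal \<bar>c\<bar> * N x) \<and>
     (\<exists>C>0. \<forall>x y. N (x + y) \<le> ennreal C * (N x + N y))"

definition quasi_Banach :: "('v::real_vector \<Rightarrow> ennreal) \<Rightarrow> bool" where
  "quasi_Banach N \<longleftrightarrow> quasi_norm N \<and>
     (\<forall>x::nat \<Rightarrow> 'v.
        (\<forall>n. x n \<in> carrier_of N) \<and>
        (\<forall>e>0. \<exists>n0. \<forall>m\<ge>n0. \<forall>n\<ge>n0. N (x m - x n) < ennreal e) \<longrightarrow>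
        (\<exists>l\<in>carrier_of N. (\<lambda>n. N (x n - l)) \<longlonglongrightarrow> 0))"

definition Hausdorff_tvs :: "'v::real_vector topology \<Rightarrow> bool" where
  "Hausdorff_tvs T \<longleftrightarrow> topspace T = UNIV \<and> Hausdorff_space T \<and>
     continuous_map (prod_topology T T) T (\<lambda>(x, y). x + y) \<and>
     continuous_map (prod_topology euclideanreal T) T (\<lambda>(c, x). c *\<^sub>R x)"

text \<open>Continuity of the (linear) inclusion map is expressed at the origin.\<close>

definition embeds_in_tvs :: "('v::real_vector \<Rightarrow> ennreal) \<Rightarrow> 'v topology \<Rightarrow> bool" where
  "embeds_in_tvs N T \<longleftrightarrow>
     (\<forall>U. openin T U \<and> 0 \<in> U \<longrightarrow> (\<exists>e>0. \<forall>x. N x < ennreal e \<longrightarrow> x \<in> U))"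

definition compatible_couple ::
  "('v::real_vector \<Rightarrow> ennreal) \<Rightarrow> ('v \<Rightarrow> ennreal) \<Rightarrow> bool" where
  "compatible_couple N0 N1 \<longleftrightarrow>
     (\<exists>T. Hausdorff_tvs T \<and> embeds_in_tvs N0 T \<and> embeds_in_tvs N1 T)"

definition sum_space :: "('v::real_vector \<Rightarrow> ennreal) \<Rightarrow> ('v \<Rightarrow> ennreal) \<Rightarrow> 'v set" where
  "sum_space N0 N1 = {x + y | x y. x \<in> carrier_of N0 \<and> y \<in> carrier_of N1}"

definition inter_norm :: "('v \<Rightarrow> ennreal) \<Rightarrow> ('v \<Rightarrow> ennreal) \<Rightarrow> 'v \<Rightarrow> ennreal" where
  "inter_norm M N f = max (M f) (N f)"

definition cont_embedded :: "('v \<Rightarrow> ennreal) \<Rightarrow> ('v \<Rightarrow> ennreal) \<Rightarrow> bool" where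
  "cont_embedded M N \<longleftrightarrow> carrier_of M \<subseteq> carrier_of N \<and>
     (\<exists>C>0. \<forall>f\<in>carrier_of M. N f \<le> ennreal C * M f)"

definition same_space :: "('v \<Rightarrow> ennreal) \<Rightarrow> ('v \<Rightarrow> ennreal) \<Rightarrow> bool" where
  "same_space M N \<longleftrightarrow> cont_embedded M N \<and> cont_embedded N M"

section \<open>Quasi-norms of Lebesgue spaces\<close>

text \<open>The convention \<open>1 / \<infinity> = 0\<close> is that of division on \<^typ>\<open>ennreal\<close>.\<close>

definition recip :: "ennreal \<Rightarrow> real" where
  "recip q = enn2real (1 / q)"

text \<open>Powers with a positive exponent.\<close>

definition epow :: "ennreal \<Rightarrow> real \<Rightarrow> ennreal" where
  "epow x p = (if x = \<infinity> then \<infinity> else ennreal (enn2real x powr p))"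

text \<open>
  The essential supremum is spelled out because \<^const>\<open>esssup\<close> is \<open>\<infinity>\<close> on non-measurable functions.
  A composition \<open>a \<circ> \<rho>\<close> of a Lebesgue measurable \<open>a\<close> with a continuous \<open>\<rho>\<close> can fail to be
  Lebesgue measurable, but if \<open>a\<close> is slowly varying it still lies between constant multiples of
  a measurable function, so that the monotone functional below remains meaningful.
\<close>

definition Lnorm :: "ennreal \<Rightarrow> real set \<Rightarrow> (real \<Rightarrow> ennreal) \<Rightarrow> ennreal" where
  "Lnorm q S f =
     (if q = \<infinity> then Inf {z. AE x in lebesgue_on S. f x \<le> z}
      else epow (\<integral>\<^sup>+x. epow (f x) (enn2real q) \<partial>lebesgue_on S) (1 / enn2real q))"

lemma Lnorm_infinity_eq_esssup:
  "f \<in> borel_measurable (lebesgue_on S) \<Longrightarrow> Lnorm \<infinity> S f = esssup (lebesgue_on S) f"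
  by (simp add: Lnorm_def esssup_eq_AE)

text \<open>The quasi-norm of \<open>u \<mapsto> u powr (-\<theta> - 1/q) * w u * F u\<close> in \<open>L\<^sub>q\<close> on \<open>S\<close>.\<close>

definition wnorm ::
  "real \<Rightarrow> ennreal \<Rightarrow> real set \<Rightarrow> (real \<Rightarrow> real) \<Rightarrow> (real \<Rightarrow> ennreal) \<Rightarrow> ennreal" where
  "wnorm \<theta> q S w F = Lnorm q S (\<lambda>u. ennreal (u powr (- \<theta> - recip q) * w u) * F u)"

section \<open>Slowly varying functions\<close>

definition equiv_pos :: "(real \<Rightarrow> real) \<Rightarrow> (real \<Rightarrow> real) \<Rightarrow> bool" where
  "equiv_pos f g \<longleftrightarrow> (\<exists>C>0. \<forall>t>0. g t / C \<le> f t \<and> f t \<le> C * g t)"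

definition SV :: "(real \<Rightarrow> real) set" where
  "SV = {b. (\<forall>t>0. b t > 0) \<and> b \<in> borel_measurable (lebesgue_on {0<..}) \<and>
     (\<forall>\<epsilon>>0. (\<exists>g. mono_on {0<..} g \<and> equiv_pos (\<lambda>t. t powr \<epsilon> * b t) g) \<and>
             (\<exists>h. antimono_on {0<..} h \<and> equiv_pos (\<lambda>t. t powr (- \<epsilon>) * b t) h))}"

section \<open>Interpolation spaces\<close>

definition Kfun ::
  "('v::real_vector \<Rightarrow> ennreal) \<Rightarrow> ('v \<Rightarrow> ennreal) \<Rightarrow> real \<Rightarrow> 'v \<Rightarrow> ennreal" where
  "Kfun N0 N1 t f =
     Inf {N0 f0 + ennreal t * N1 f1 | f0 f1.
            f = f0 + f1 \<and> f0 \<in> carrier_of N0 \<and> f1 \<in> carrier_of N1}"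

definition interp ::
  "('v::real_vector \<Rightarrow> ennreal) \<Rightarrow> ('v \<Rightarrow> ennreal) \<Rightarrow> real \<Rightarrow> ennreal \<Rightarrow> (real \<Rightarrow> real) \<Rightarrow>
   'v \<Rightarrow> ennreal" where
  "interp N0 N1 \<theta> q b f =
     (if f \<in> sum_space N0 N1
      then wnorm \<theta> q {0<..} b (\<lambda>u. Kfun N0 N1 u f)
      else \<infinity>)"

definition interp_L ::
  "('v::real_vector \<Rightarrow> ennreal) \<Rightarrow> ('v \<Rightarrow> ennreal) \<Rightarrow> real \<Rightarrow> ennreal \<Rightarrow> (real \<Rightarrow> real) \<Rightarrow>
   ennreal \<Rightarrow> (real \<Rightarrow> real) \<Rightarrow> 'v \<Rightarrow> ennreal" where
  "interp_L N0 N1 \<theta> r b q a f =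
     (if f \<in> sum_space N0 N1
      then wnorm 0 r {0<..} b (\<lambda>t. wnorm \<theta> q {0<..<t} a (\<lambda>u. Kfun N0 N1 u f))
      else \<infinity>)"

definition interp_LR ::
  "('v::real_vector \<Rightarrow> ennreal) \<Rightarrow> ('v \<Rightarrow> ennreal) \<Rightarrow> real \<Rightarrow> ennreal \<Rightarrow> (real \<Rightarrow> real) \<Rightarrow>
   ennreal \<Rightarrow> (real \<Rightarrow> real) \<Rightarrow> ennreal \<Rightarrow> (real \<Rightarrow> real) \<Rightarrow> 'v \<Rightarrow> ennreal" where
  "interp_LR N0 N1 \<theta> p c r b q a f =
     (if f \<in> sum_space N0 N1
      then wnorm 0 p {0<..} c (\<lambda>t. wnorm 0 r {t<..} b (\<lambda>u.
             wnorm \<theta> q {t<..<u} a (\<lambda>v. Kfun N0 N1 v f)))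
      else \<infinity>)"

text \<open>
  For slowly varying \<open>a\<close>, \<open>b\<close> with \<open>wnorm 0 r {1<..} b (\<lambda>_. 1) < \<infinity>\<close> and
  \<open>wnorm 0 r {0<..<1} b (\<lambda>s. wnorm 0 q {0<..<s} a (\<lambda>_. 1)) < \<infinity>\<close> the extended value below is
  finite and positive for every \<open>t > 0\<close>, so that \<^const>\<open>enn2real\<close> loses nothing.
\<close>

definition chi ::
  "ennreal \<Rightarrow> (real \<Rightarrow> real) \<Rightarrow> ennreal \<Rightarrow> (real \<Rightarrow> real) \<Rightarrow> real \<Rightarrow> real" where
  "chi r b q a t = enn2real
     (wnorm 0 r {0<..<t} b (\<lambda>s. wnorm 0 q {0<..<s} a (\<lambda>_. 1)) +
      wnorm 0 r {t<..} b (\<lambda>_. 1) * wnorm 0 q {0<..<t} a (\<lambda>_. 1))"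

definition rho ::
  "ennreal \<Rightarrow> (real \<Rightarrow> real) \<Rightarrow> ennreal \<Rightarrow> (real \<Rightarrow> real) \<Rightarrow> real \<Rightarrow> real" where
  "rho r b q a t = t / chi r b q a t"

end

theory Submission
  imports Defs
begin

text \<open>
  Let \<open>K\<close> be the K-functional of \<open>(A\<^sub>0, A\<^sub>1)\<close>. The norm of the second space \<open>AL\<close> of the new couple
  is \<open>\<Lambda>(K(u, f) / u)\<close>, where \<open>\<Lambda>\<close> is the lattice quasi-norm
  \<open>\<Lambda>(F) = \<parallel>b\<^sub>1(s) \<parallel>a\<^sub>1 F\<parallel> on (0, s)\<parallel> on (0, \<infinity>)\<close>, all norms being taken with respect to the Haar measure
  \<open>du/u\<close>. Up to constants, \<open>\<chi>\<^sub>1(t)\<close> is \<open>\<Lambda>\<close> of the indicator of \<open>(0, t)\<close>. Everything follows from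
  three facts about \<open>\<Lambda>\<close>: it satisfies a quasi-triangle inequality, \<open>\<Lambda>(1\<^bsub>(0,t)\<^esub>)\<close> is increasing and
  grows at most like \<open>t\<^bsup>1/2\<^esup>\<close>, and \<open>\<Lambda>(u\<^bsup>-d\<^esup> 1\<^bsub>(t,\<infinity>)\<^esub>) \<le> C t\<^bsup>-d\<^esup> \<chi>\<^sub>1(t)\<close> for every \<open>d > 0\<close>.
  
  The first and the last of these give a Holmstedt formula (\<open>Holmstedt_upper\<close>, \<open>Holmstedt_lower\<close>):
  with \<open>\<rho>(t) = t / \<chi>\<^sub>1(t)\<close>, the K-functional of \<open>(A\<^sub>0, AL)\<close> at \<open>\<rho>(t)\<close> is equivalent to
  \<open>K(t, f) + \<rho>(t) \<Lambda>((K(u, f) / u) 1\<^bsub>(t,\<infinity>)\<^esub>)\<close>. For the upper bound one takes a decomposition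
  \<open>f = f\<^sub>0 + f\<^sub>1\<close> for \<open>K(t, f)\<close> itself and estimates \<open>K(u, f\<^sub>1)\<close> by \<open>u \<parallel>f\<^sub>1\<parallel>\<close> below \<open>t\<close> and by
  \<open>K(u, f) + \<parallel>f\<^sub>0\<parallel>\<close> above \<open>t\<close>; the lower bounds rest on the fact that \<open>K(u, f\<^sub>1) / u\<close> is decreasing and, for the second
  term, on the estimate of \<open>\<Lambda>(u\<^bsup>-1\<^esup> 1\<^bsub>(t,\<infinity>)\<^esub>)\<close>.
  
  The substitution \<open>u = \<rho>(t)\<close> turns the norm of \<open>(A\<^sub>0, AL)\<close> with parameters \<open>\<theta>\<close>, \<open>r\<close>, \<open>a\<close> into a norm in \<open>t\<close>.
  The function \<open>\<rho>\<close> need be neither monotone nor differentiable, which rules out the classical rule. But the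
  function that is integrated changes by at most a constant factor on every interval \<open>[u, 2u]\<close>, and \<open>\<rho>\<close>
  is trapped between the powers \<open>t\<^bsup>1/2\<^esup>\<close> and \<open>t\<close>; Fubini's theorem for the kernel that is the indicator of
  \<open>u / \<kappa> \<le> \<rho>(t) \<le> \<kappa> u\<close> then takes its place
  (\<open>haar_norm_change_variable\<close>).
  
  For \<open>\<theta> = 1\<close> the two terms of the Holmstedt formula are exactly the two norms of the intersection.
  For \<open>\<theta> < 1\<close> the second term is absorbed by the first: \<open>\<rho>(t) \<Lambda>((K(u, f) / u) 1\<^bsub>(t,\<infinity>)\<^esub>)\<close> is dominated by the
  supremum of \<open>(t/u)\<^bsup>1-d\<^esup> K(u, f)\<close> over \<open>u \<ge> t\<close>, and the Hardy inequality \<open>haar_norm_Hardy_sup\<close> bounds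
  the norm of such suprema by the norm of \<open>K(\<cdot>, f)\<close>, with a weight for which the exponent \<open>1 - d\<close> still
  leaves some decay in \<open>t/u\<close> when \<open>d\<close> is small compared with \<open>1 - \<theta>\<close>.
\<close>

section \<open>Lebesgue quasi-norms for the measure du/u\<close>

lemma epow_top [simp]: "epow \<infinity> p = \<infinity>"
  by (simp add: epow_def)

lemma epow_ennreal: "0 \<le> x \<Longrightarrow> epow (ennreal x) p = ennreal (x powr p)"
  by (simp add: epow_def)

lemma epow_zero [simp]: "epow 0 p = 0"
  by (simp add: epow_def)

lemma epow_mono: "0 < p \<Longrightarrow> x \<le> y \<Longrightarrow> epow x p \<le> epow y p"
  by (cases x; cases y) (auto simp: epow_def top_unique intro!: ennreal_leI powr_mono2)

lemma epow_mult:
  assumes "0 < c"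
  shows "epow (ennreal c * x) p = ennreal (c powr p) * epow x p"
  using assms
  by (cases x) (auto simp: epow_def ennreal_mult_top powr_mult simp flip: ennreal_mult)

lemma epow_epow:
  assumes "p \<noteq> 0"
  shows "epow (epow x p) (1 / p) = x"
  using assms by (cases x) (auto simp: epow_def powr_powr)

lemma epow_add_le:
  assumes "0 < p"
  shows "epow (x + y) p \<le> ennreal (2 powr p) * (epow x p + epow y p)"
proof -
  have "epow (x + y) p \<le> epow (ennreal 2 * max x y) p"
  proof (rule epow_mono[OF assms])
    have "x + y \<le> max x y + max x y" by (intro add_mono) auto
    then show "x + y \<le> ennreal 2 * max x y" by (simp add: mult_2)
  qed
  also have "\<dots> = ennreal (2 powr p) * epow (max x y) p"
    by (rule epow_mult) simp
  also have "\<dots> \<le> ennreal (2 powr p) * (epow x p + epow y p)"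
    by (intro mult_left_mono) (auto simp: max_def)
  finally show ?thesis .
qed

lemma epow_measurable [measurable]: "(\<lambda>x. epow x p) \<in> borel_measurable borel"
  unfolding epow_def by measurable

text \<open>
  Absorbing the factor \<open>u\<^bsup>-1/q\<^esup>\<close> into the measure makes all exponents \<open>q\<close> look alike: every norm of the
  theorem is a \<open>haar_norm\<close> of its bare integrand, and all the inequalities below have constants that scale
  correctly in the endpoints of the interval.
\<close>
definition haar_norm :: "ennreal \<Rightarrow> real set \<Rightarrow> (real \<Rightarrow> ennreal) \<Rightarrow> ennreal" where
  "haar_norm q S f =
     (if q = top then Inf {z. AE u in lebesgue. u \<in> S \<longrightarrow> f u \<le> z}
      else epow (\<integral>\<^sup>+u. indicator S u * (ennreal (1 / u) * epow (f u) (enn2real q)) \<partial>lebesgue)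
             (1 / enn2real q))"

lemma haar_norm_infinity:
  "q = top \<Longrightarrow> haar_norm q S f = Inf {z. AE u in lebesgue. u \<in> S \<longrightarrow> f u \<le> z}"
  by (simp add: haar_norm_def)

lemma haar_norm_finite:
  "q \<noteq> top \<Longrightarrow> haar_norm q S f = 
     epow (\<integral>\<^sup>+u. indicator S u * (ennreal (1 / u) * epow (f u) (enn2real q)) \<partial>lebesgue)
             (1 / enn2real q)"
  by (simp add: haar_norm_def)

lemma wnorm_eq_haar_norm:
  assumes S: "S \<in> sets lebesgue" "S \<subseteq> {0<..}" and q: "0 < q"
  shows "wnorm \<theta> q S w F = haar_norm q S (\<lambda>u. ennreal (u powr - \<theta> * w u) * F u)"
proof (cases "q = top")
  case True
  have *: "u powr (- \<theta> - recip top) = u powr - \<theta>" for u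
    by (simp add: recip_def)
  show ?thesis
    using S by (simp add: True wnorm_def Lnorm_def haar_norm_def * AE_restrict_space_iff)
next
  case False
  define p where "p = enn2real q"
  have p: "0 < p" using q False by (simp add: p_def enn2real_positive_iff less_top)
  have "1 / q = ennreal (1 / p)"
    using q False p divide_ennreal[of 1 p] by (simp add: p_def less_top)
  then have rp: "recip q = 1 / p"
    using p by (simp add: recip_def)
  have e: "epow (ennreal (u powr (- \<theta> - recip q) * w u) * F u) p
       = ennreal (1 / u) * epow (ennreal (u powr - \<theta> * w u) * F u) p" if "0 < u" for u
  proof -
    have "u powr (- \<theta> - recip q) * w u = u powr (- 1 / p) * (u powr - \<theta> * w u)"
      using powr_add[of u "- 1 / p" "- \<theta>"] by (simp add: rp algebra_simps)
    then have "ennreal (u powr (- \<theta> - recip q) * w u) * F u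
        = ennreal (u powr (- 1 / p)) * (ennreal (u powr - \<theta> * w u) * F u)"
      by (metis ennreal_mult' mult.assoc powr_ge_zero)
    then have "epow (ennreal (u powr (- \<theta> - recip q) * w u) * F u) p
        = ennreal ((u powr (- 1 / p)) powr p) * epow (ennreal (u powr - \<theta> * w u) * F u) p"
      using that by (simp add: epow_mult)
    moreover have "(u powr (- 1 / p)) powr p = 1 / u"
      using that p by (simp only: powr_powr) (simp add: powr_minus_divide)
    ultimately show ?thesis
      by simp
  qed
  have "(\<integral>\<^sup>+x. epow (ennreal (x powr (- \<theta> - recip q) * w x) * F x) p \<partial>lebesgue_on S)
     = (\<integral>\<^sup>+u. indicator S u * (ennreal (1 / u) * epow (ennreal (u powr - \<theta> * w u) * F u) p) \<partial>lebesgue)"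
    using S e by (subst nn_integral_restrict_space)
      (auto intro!: nn_integral_cong simp: indicator_def subset_eq)
  then show ?thesis
    by (simp add: wnorm_def Lnorm_def haar_norm_def False p_def[symmetric])
qed

lemma haar_norm_mono_AE:
  assumes "0 < q" and le: "AE u in lebesgue. u \<in> S \<longrightarrow> u \<in> T \<and> f u \<le> g u"
  shows "haar_norm q S f \<le> haar_norm q T g"
proof (cases "q = top")
  case True
  have "AE u in lebesgue. u \<in> S \<longrightarrow> f u \<le> z" if "AE u in lebesgue. u \<in> T \<longrightarrow> g u \<le> z" for z
    using le that by eventually_elim (auto intro: order_trans)
  then show ?thesis
    unfolding haar_norm_infinity[OF True] by (intro Inf_superset_mono) blast
next
  case False
  then have "0 < enn2real q" using assms(1) by (simp add: enn2real_positive_iff less_top)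
  then show ?thesis unfolding haar_norm_def using False le
    by (auto intro!: epow_mono nn_integral_mono_AE mult_left_mono elim!: eventually_mono
        simp: indicator_def)
qed

lemma haar_norm_mono:
  assumes "0 < q" and "\<And>u. u \<in> S \<Longrightarrow> u \<in> T \<and> f u \<le> g u"
  shows "haar_norm q S f \<le> haar_norm q T g"
  using assms by (intro haar_norm_mono_AE) auto

lemma haar_norm_cong:
  assumes "0 < q" and "\<And>u. u \<in> S \<Longrightarrow> f u = g u"
  shows "haar_norm q S f = haar_norm q S g"
  using assms by (intro antisym haar_norm_mono) auto

lemma ennreal_cancel:
  assumes "0 < c"
  shows "ennreal c * (ennreal (1 / c) * x) = x" "ennreal (1 / c) * (ennreal c * x) = x"
  using assms by (simp_all add: ennreal_mult[symmetric] mult.assoc[symmetric])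

text \<open>
  The integrand may fail to be measurable: a weight \<open>a \<circ> \<rho>\<close> is only equivalent to a measurable one.
\<close>
lemma nn_integral_cmult_le:
  assumes "0 < c"
  shows "(\<integral>\<^sup>+x. ennreal c * f x \<partial>M) \<le> ennreal c * (\<integral>\<^sup>+x. f x \<partial>M)"
  unfolding nn_integral_def[of M "\<lambda>x. ennreal c * f x"]
proof (rule SUP_least, clarify)
  fix g assume g: "simple_function M g" "g \<le> (\<lambda>x. ennreal c * f x)"
  have [measurable]: "g \<in> borel_measurable M" using g(1) by (rule borel_measurable_simple_function)
  have "integral\<^sup>N M g = ennreal c * (\<integral>\<^sup>+x. ennreal (1 / c) * g x \<partial>M)"
    using assms by (subst nn_integral_cmult[symmetric]) (auto simp: ennreal_cancel)
  also have "\<dots> \<le> ennreal c * (\<integral>\<^sup>+x. f x \<partial>M)"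
  proof (intro mult_left_mono nn_integral_mono)
    fix x
    have "ennreal (1 / c) * g x \<le> ennreal (1 / c) * (ennreal c * f x)"
      using g(2) by (intro mult_left_mono) (auto simp: le_fun_def)
    also have "\<dots> = f x" using assms by (simp add: ennreal_cancel)
    finally show "ennreal (1 / c) * g x \<le> f x" .
  qed simp
  finally show "integral\<^sup>S M g \<le> ennreal c * (\<integral>\<^sup>+x. f x \<partial>M)"
    using g(1) by (simp add: nn_integral_eq_simple_integral)
qed

lemma haar_norm_cmult_le:
  assumes q: "0 < q" and c: "0 < c"
  shows "haar_norm q S (\<lambda>u. ennreal c * f u) \<le> ennreal c * haar_norm q S f"
proof (cases "q = top")
  case True
  let ?L = "haar_norm q S (\<lambda>u. ennreal c * f u)"
  have "ennreal (1 / c) * ?L \<le> haar_norm q S f"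
    unfolding haar_norm_infinity[OF True, of S f]
  proof (intro Inf_greatest, unfold mem_Collect_eq)
    fix z assume "AE u in lebesgue. u \<in> S \<longrightarrow> f u \<le> z"
    then have "AE u in lebesgue. u \<in> S \<longrightarrow> ennreal c * f u \<le> ennreal c * z"
      by eventually_elim (auto intro: mult_left_mono)
    then have "?L \<le> ennreal c * z"
      unfolding haar_norm_infinity[OF True] by (intro Inf_lower) simp
    then have "ennreal (1 / c) * ?L \<le> ennreal (1 / c) * (ennreal c * z)"
      by (intro mult_left_mono) auto
    then show "ennreal (1 / c) * ?L \<le> z"
      using c by (simp add: ennreal_cancel)
  qed
  then have "ennreal c * (ennreal (1 / c) * ?L) \<le> ennreal c * haar_norm q S f"
    by (intro mult_left_mono) auto
  then show ?thesis using c by (simp add: ennreal_cancel)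
next
  case False
  define p where "p = enn2real q"
  have p: "0 < p" using q False by (simp add: p_def enn2real_positive_iff less_top)
  have "(\<integral>\<^sup>+u. indicator S u * (ennreal (1 / u) * epow (ennreal c * f u) p) \<partial>lebesgue)
      = (\<integral>\<^sup>+u. ennreal (c powr p) * (indicator S u * (ennreal (1 / u) * epow (f u) p)) \<partial>lebesgue)"
    by (simp add: epow_mult c mult_ac)
  also have "\<dots> \<le> ennreal (c powr p) * (\<integral>\<^sup>+u. indicator S u * (ennreal (1 / u) * epow (f u) p) \<partial>lebesgue)"
    using c by (intro nn_integral_cmult_le) simp
  finally have "epow (\<integral>\<^sup>+u. indicator S u * (ennreal (1 / u) * epow (ennreal c * f u) p) \<partial>lebesgue) (1 / p)
     \<le> epow (ennreal (c powr p) * (\<integral>\<^sup>+u. indicator S u * (ennreal (1 / u) * epow (f u) p) \<partial>lebesgue)) (1 / p)"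
    using p by (intro epow_mono) auto
  also have "\<dots> = ennreal c * epow (\<integral>\<^sup>+u. indicator S u * (ennreal (1 / u) * epow (f u) p) \<partial>lebesgue) (1 / p)"
    using c p by (subst epow_mult) (auto simp: powr_powr)
  finally show ?thesis
    using False by (simp add: haar_norm_def p_def)
qed

lemma haar_norm_le_cmult:
  assumes q: "0 < q" and c: "0 < c"
    and "AE u in lebesgue. u \<in> S \<longrightarrow> u \<in> T \<and> f u \<le> ennreal c * g u"
  shows "haar_norm q S f \<le> ennreal c * haar_norm q T g"
  by (rule order_trans[OF haar_norm_mono_AE[OF q assms(3)] haar_norm_cmult_le[OF q c]])

lemma haar_norm_cmult:
  assumes q: "0 < q" and c: "0 \<le> c"
  shows "haar_norm q S (\<lambda>u. ennreal c * f u) = ennreal c * haar_norm q S f"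
proof (cases "c = 0")
  case True
  have "haar_norm q S (\<lambda>u. 0) = 0"
    by (simp add: haar_norm_def bot_ennreal)
  then show ?thesis using True by simp
next
  case False
  then have c: "0 < c" using c by simp
  have "haar_norm q S f \<le> ennreal (1 / c) * haar_norm q S (\<lambda>u. ennreal c * f u)"
    using c q by (intro haar_norm_le_cmult) (auto simp: ennreal_cancel)
  then have "ennreal c * haar_norm q S f
     \<le> ennreal c * (ennreal (1 / c) * haar_norm q S (\<lambda>u. ennreal c * f u))"
    by (intro mult_left_mono) auto
  also have "\<dots> = haar_norm q S (\<lambda>u. ennreal c * f u)" using c by (simp add: ennreal_cancel)
  finally show ?thesis using haar_norm_cmult_le[OF q c] by (intro antisym)
qed

lemma le_Inf_add_Inf:
  fixes x :: ennreal
  assumes "\<And>y z. y \<in> Y \<Longrightarrow> z \<in> Z \<Longrightarrow> x \<le> y + z"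
  shows "x \<le> Inf Y + Inf Z"
proof -
  have *: "x \<le> c + Inf W" if "\<And>w. w \<in> W \<Longrightarrow> x \<le> c + w" for c and W :: "ennreal set"
  proof (cases "c = top")
    case False
    then have "x - c \<le> Inf W" using that by (intro Inf_greatest) (auto simp: ennreal_minus_le_iff)
    with False show ?thesis by (simp add: ennreal_minus_le_iff)
  qed simp
  have "x \<le> y + Inf Z" if "y \<in> Y" for y using assms that by (intro *)
  then have "x \<le> Inf Z + Inf Y" by (intro *) (simp add: add.commute)
  then show ?thesis by (simp add: add.commute)
qed

text \<open>
  The constant depends on the exponent alone, not on the set; this uniformity is what lets the inner norm
  over \<open>(0, s)\<close> be estimated for all \<open>s\<close> at once.
\<close>
lemma haar_norm_triangle:
  assumes q: "0 < q"
  obtains C where "0 < C" and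
    "\<And>S f g. S \<in> sets lebesgue \<Longrightarrow> S \<subseteq> {0<..} \<Longrightarrow>
      f \<in> borel_measurable (lebesgue_on {0<..}) \<Longrightarrow> g \<in> borel_measurable (lebesgue_on {0<..}) \<Longrightarrow>
      haar_norm q S (\<lambda>u. f u + g u) \<le> ennreal C * (haar_norm q S f + haar_norm q S g)"
proof (cases "q = top")
  case True
  have "haar_norm q S (\<lambda>u. f u + g u) \<le> ennreal 1 * (haar_norm q S f + haar_norm q S g)" for S f g
  proof -
    have "haar_norm q S (\<lambda>u. f u + g u) \<le> y + z"
      if y: "AE u in lebesgue. u \<in> S \<longrightarrow> f u \<le> y" and z: "AE u in lebesgue. u \<in> S \<longrightarrow> g u \<le> z" for y z
    proof -
      have "AE u in lebesgue. u \<in> S \<longrightarrow> f u + g u \<le> y + z"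
        using y z by eventually_elim (auto intro: add_mono)
      then show ?thesis
        unfolding haar_norm_infinity[OF True] by (intro Inf_lower) simp
    qed
    then show ?thesis
      unfolding haar_norm_infinity[OF True, of S f] haar_norm_infinity[OF True, of S g] ennreal_1 mult_1
      by (intro le_Inf_add_Inf) simp
  qed
  then show thesis by (intro that[of 1]) auto
next
  case False
  define p where "p = enn2real q"
  have p: "0 < p" using q False by (simp add: p_def enn2real_positive_iff less_top)
  show thesis
  proof (rule that[of "2 * 2 powr (1 / p)"])
    fix S :: "real set" and f g :: "real \<Rightarrow> ennreal"
    assume S: "S \<in> sets lebesgue" "S \<subseteq> {0<..}"
      and fg: "f \<in> borel_measurable (lebesgue_on {0<..})" "g \<in> borel_measurable (lebesgue_on {0<..})"
    let ?I = "\<lambda>h. \<integral>\<^sup>+u. indicator S u * (ennreal (1 / u) * epow (h u) p) \<partial>lebesgue"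
    have I: "?I h = (\<integral>\<^sup>+u. ennreal (1 / u) * epow (h u) p \<partial>lebesgue_on S)" for h
      using S by (subst nn_integral_restrict_space) (auto intro!: nn_integral_cong simp: mult_ac)
    have [measurable]: "f \<in> borel_measurable (lebesgue_on S)" "g \<in> borel_measurable (lebesgue_on S)"
      using fg S(2) by (auto intro: measurable_restrict_mono)
    have [measurable]: "(\<lambda>u. ennreal (1 / u)) \<in> borel_measurable (lebesgue_on S)"
      by (intro measurable_restrict_space1 measurable_completion) simp
    have "?I (\<lambda>u. f u + g u) \<le> (\<integral>\<^sup>+u. ennreal (2 powr p) * (ennreal (1 / u) * epow (f u) p + ennreal (1 / u) * epow (g u) p) \<partial>lebesgue_on S)"
      unfolding I
    proof (rule nn_integral_mono)
      fix u
      have "ennreal (1 / u) * epow (f u + g u) p \<le> ennreal (1 / u) * (ennreal (2 powr p) * (epow (f u) p + epow (g u) p))"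
        using epow_add_le[OF p] by (intro mult_left_mono) auto
      then show "ennreal (1 / u) * epow (f u + g u) p \<le> ennreal (2 powr p) * (ennreal (1 / u) * epow (f u) p + ennreal (1 / u) * epow (g u) p)"
        by (simp add: distrib_left mult_ac)
    qed
    also have "\<dots> = ennreal (2 powr p) * (?I f + ?I g)"
      unfolding I by (subst nn_integral_cmult, simp, subst nn_integral_add, simp_all)
    finally have "haar_norm q S (\<lambda>u. f u + g u) \<le> epow (ennreal (2 powr p) * (?I f + ?I g)) (1 / p)"
      using p False by (auto simp: haar_norm_def p_def intro!: epow_mono)
    also have "\<dots> = ennreal 2 * epow (?I f + ?I g) (1 / p)"
      using p by (simp add: epow_mult powr_powr)
    also have "\<dots> \<le> ennreal 2 * (ennreal (2 powr (1 / p)) * (epow (?I f) (1 / p) + epow (?I g) (1 / p)))"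
      using p by (intro mult_left_mono epow_add_le) auto
    also have "\<dots> = ennreal (2 * 2 powr (1 / p)) * (haar_norm q S f + haar_norm q S g)"
      using False by (simp add: haar_norm_def p_def[symmetric] ennreal_mult mult.assoc)
    finally show "haar_norm q S (\<lambda>u. f u + g u) \<le> ennreal (2 * 2 powr (1 / p)) * (haar_norm q S f + haar_norm q S g)" .
  qed simp
qed

section \<open>Power weights and functions of polynomial growth\<close>

lemma nn_integral_le_interval:
  assumes "\<And>x. f x \<le> c * indicator {a..b} x" "a \<le> b"
  shows "(\<integral>\<^sup>+x. f x \<partial>lborel) \<le> c * ennreal (b - a)"
proof -
  have "(\<integral>\<^sup>+x. f x \<partial>lborel) \<le> (\<integral>\<^sup>+x. c * indicator {a..b} x \<partial>lborel)"
    using assms(1) by (rule nn_integral_mono)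
  also have "\<dots> = c * ennreal (b - a)"
    using assms(2) by (simp add: nn_integral_cmult_indicator)
  finally show ?thesis .
qed

lemma nn_integral_ge_interval:
  assumes "\<And>x. a < x \<Longrightarrow> x < b \<Longrightarrow> c \<le> f x" "a \<le> b"
  shows "c * ennreal (b - a) \<le> (\<integral>\<^sup>+x. f x \<partial>lborel)"
proof -
  have "c * ennreal (b - a) = (\<integral>\<^sup>+x. c * indicator {a<..<b} x \<partial>lborel)"
    using assms(2) by (simp add: nn_integral_cmult_indicator)
  also have "\<dots> \<le> (\<integral>\<^sup>+x. f x \<partial>lborel)"
    using assms(1) by (intro nn_integral_mono) (auto simp: indicator_def)
  finally show ?thesis .
qed

lemma nn_integral_powr_tail:
  assumes "0 < d" "0 < t"
  shows "(\<integral>\<^sup>+u. indicator {t<..} u * ennreal (u powr (- d - 1)) \<partial>lborel) \<le> ennreal (t powr - d / d)"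
proof -
  have "(\<integral>\<^sup>+u. indicator {t<..} u * ennreal (u powr (- d - 1)) \<partial>lborel)
      \<le> (\<integral>\<^sup>+u. ennreal (u powr (- d - 1)) * indicator {t..} u \<partial>lborel)"
    by (intro nn_integral_mono) (auto simp: indicator_def)
  also have "\<dots> = ennreal (- (t powr (- d - 1 + 1)) / (- d - 1 + 1))"
    using assms by (intro nn_integral_has_integral_lebesgue' has_integral_powr_to_inf) auto
  finally show ?thesis by simp
qed

lemma nn_integral_powr_head:
  assumes "0 < d" "0 < t"
  shows "(\<integral>\<^sup>+u. indicator {0<..<t} u * ennreal (u powr (d - 1)) \<partial>lborel) \<le> ennreal (t powr d / d)"
proof -
  have "(\<integral>\<^sup>+u. indicator {0<..<t} u * ennreal (u powr (d - 1)) \<partial>lborel)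
      \<le> (\<integral>\<^sup>+u. ennreal (u powr (d - 1)) * indicator {0..t} u \<partial>lborel)"
    by (intro nn_integral_mono) (auto simp: indicator_def)
  also have "\<dots> = ennreal (t powr (d - 1 + 1) / (d - 1 + 1))"
    using assms by (intro nn_integral_has_integral_lebesgue' has_integral_powr_from_0) auto
  finally show ?thesis by simp
qed

lemma haar_norm_powr:
  assumes q: "0 < q" and d: "0 < d"
  obtains C where "0 < C"
    "\<And>t. 0 < t \<Longrightarrow> haar_norm q {t<..} (\<lambda>u. ennreal (u powr - d)) \<le> ennreal (C * t powr - d)"
    "\<And>t. 0 < t \<Longrightarrow> haar_norm q {0<..<t} (\<lambda>u. ennreal (u powr d)) \<le> ennreal (C * t powr d)"
proof (cases "q = top")
  case True
  show thesis
  proof (rule that[of 1])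
    fix t :: real assume t: "0 < t"
    have "AE u in lebesgue. u \<in> {t<..} \<longrightarrow> ennreal (u powr - d) \<le> ennreal (t powr - d)"
      using t d by (intro AE_I2 impI ennreal_leI) (auto intro!: powr_mono2')
    then show "haar_norm q {t<..} (\<lambda>u. ennreal (u powr - d)) \<le> ennreal (1 * t powr - d)"
      unfolding haar_norm_infinity[OF True] mult_1 by (intro Inf_lower) simp
    have "AE u in lebesgue. u \<in> {0<..<t} \<longrightarrow> ennreal (u powr d) \<le> ennreal (t powr d)"
      using t d by (intro AE_I2 impI ennreal_leI) (auto intro!: powr_mono2)
    then show "haar_norm q {0<..<t} (\<lambda>u. ennreal (u powr d)) \<le> ennreal (1 * t powr d)"
      unfolding haar_norm_infinity[OF True] mult_1 by (intro Inf_lower) simp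
  qed simp
next
  case False
  define p where "p = enn2real q"
  have p: "0 < p" using q False by (simp add: p_def enn2real_positive_iff less_top)
  have e: "0 < d * p" using d p by simp
  show thesis
  proof (rule that[of "(1 / (d * p)) powr (1 / p)"])
    show "0 < (1 / (d * p)) powr (1 / p)" using d p by simp
    fix t :: real assume t: "0 < t"
    have root: "(t powr (c * p) / (d * p)) powr (1 / p) = (1 / (d * p)) powr (1 / p) * t powr c" for c
      using p by (simp only: powr_divide powr_powr) simp
    have "haar_norm q {t<..} (\<lambda>u. ennreal (u powr - d))
        = epow (\<integral>\<^sup>+u. indicator {t<..} u * ennreal (u powr (- (d * p) - 1)) \<partial>lborel) (1 / p)"
      unfolding haar_norm_finite[OF False] nn_integral_completion p_def[symmetric]
      using t by (intro arg_cong2[where f = epow] nn_integral_cong)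
        (auto simp: indicator_def epow_ennreal powr_powr powr_diff divide_simps simp flip: ennreal_mult')
    also have "\<dots> \<le> epow (ennreal (t powr - (d * p) / (d * p))) (1 / p)"
      using nn_integral_powr_tail[OF e t] p by (intro epow_mono) auto
    also have "\<dots> = ennreal ((1 / (d * p)) powr (1 / p) * t powr - d)"
      using p d root[of "- d"] by (subst epow_ennreal) auto
    finally show "haar_norm q {t<..} (\<lambda>u. ennreal (u powr - d)) \<le> ennreal ((1 / (d * p)) powr (1 / p) * t powr - d)" .
    have "haar_norm q {0<..<t} (\<lambda>u. ennreal (u powr d))
        = epow (\<integral>\<^sup>+u. indicator {0<..<t} u * ennreal (u powr (d * p - 1)) \<partial>lborel) (1 / p)"
      unfolding haar_norm_finite[OF False] nn_integral_completion p_def[symmetric]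
      using t by (intro arg_cong2[where f = epow] nn_integral_cong)
        (auto simp: indicator_def epow_ennreal powr_powr powr_diff divide_simps simp flip: ennreal_mult')
    also have "\<dots> \<le> epow (ennreal (t powr (d * p) / (d * p))) (1 / p)"
      using nn_integral_powr_head[OF e t] p by (intro epow_mono) auto
    also have "\<dots> = ennreal ((1 / (d * p)) powr (1 / p) * t powr d)"
      using p root[of d] d by (subst epow_ennreal) auto
    finally show "haar_norm q {0<..<t} (\<lambda>u. ennreal (u powr d)) \<le> ennreal ((1 / (d * p)) powr (1 / p) * t powr d)" .
  qed
qed

text \<open>
  An octave \<open>(t, 2t)\<close> has Haar measure independent of \<open>t\<close>, so a function that is large on one octave has a
  large norm.
\<close>
lemma haar_norm_lower_bound:
  assumes q: "0 < q"
  obtains k where "0 < k"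
    "\<And>t S f z. 0 < t \<Longrightarrow> {t<..<2 * t} \<subseteq> S \<Longrightarrow> (\<And>u. t < u \<Longrightarrow> u < 2 * t \<Longrightarrow> z \<le> f u)
       \<Longrightarrow> ennreal k * z \<le> haar_norm q S f"
proof (cases "q = top")
  case True
  show thesis
  proof (rule that[of 1])
    fix t :: real and S :: "real set" and f :: "real \<Rightarrow> ennreal" and z
    assume t: "0 < t" and S: "{t<..<2 * t} \<subseteq> S" and f: "\<And>u. t < u \<Longrightarrow> u < 2 * t \<Longrightarrow> z \<le> f u"
    have "z \<le> y" if y: "AE u in lebesgue. u \<in> S \<longrightarrow> f u \<le> y" for y
    proof (rule ccontr)
      assume z: "\<not> z \<le> y"
      have "AE u in lebesgue. u \<notin> {t<..<2 * t}"
      proof (rule eventually_mono[OF y], rule notI)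
        fix u assume 1: "u \<in> S \<longrightarrow> f u \<le> y" and u: "u \<in> {t<..<2 * t}"
        then have "f u \<le> y" using S by auto
        moreover have "z \<le> f u" using u f by simp
        ultimately show False using z by (meson order_trans)
      qed
      then have "emeasure lebesgue {t<..<2 * t} = 0"
        by (subst (asm) AE_iff_measurable[OF _ refl]) (auto simp: greaterThanLessThan_def greaterThan_def lessThan_def Collect_conj_eq[symmetric])
      then show False using t by simp
    qed
    then show "ennreal 1 * z \<le> haar_norm q S f"
      unfolding haar_norm_infinity[OF True] by (auto intro!: Inf_greatest)
  qed simp
next
  case False
  define p where "p = enn2real q"
  have p: "0 < p" using q False by (simp add: p_def enn2real_positive_iff less_top)
  show thesis
  proof (rule that[of "(1 / 2) powr (1 / p)"])
    fix t :: real and S :: "real set" and f :: "real \<Rightarrow> ennreal" and z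
    assume t: "0 < t" and S: "{t<..<2 * t} \<subseteq> S" and f: "\<And>u. t < u \<Longrightarrow> u < 2 * t \<Longrightarrow> z \<le> f u"
    have "ennreal (1 / (2 * t)) * epow z p * ennreal (2 * t - t)
       \<le> (\<integral>\<^sup>+u. indicator S u * (ennreal (1 / u) * epow (f u) p) \<partial>lborel)"
    proof (rule nn_integral_ge_interval)
      fix u assume u: "t < u" "u < 2 * t"
      have "ennreal (1 / (2 * t)) * epow z p \<le> ennreal (1 / u) * epow (f u) p"
        using u t p f by (intro mult_mono ennreal_leI epow_mono divide_left_mono) auto
      then show "ennreal (1 / (2 * t)) * epow z p \<le> indicator S u * (ennreal (1 / u) * epow (f u) p)"
        using u S by (auto simp: indicator_def)
    qed (use t in simp)
    also have "ennreal (1 / (2 * t)) * epow z p * ennreal (2 * t - t) = ennreal (1 / 2) * epow z p"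
    proof -
      have "ennreal (1 / (2 * t)) * ennreal (2 * t - t) = ennreal (1 / 2)"
        using t by (simp add: ennreal_mult'[symmetric] del: ennreal_half)
      then show ?thesis by (metis mult.assoc mult.commute)
    qed
    finally have "epow (ennreal (1 / 2) * epow z p) (1 / p) \<le> haar_norm q S f"
      unfolding haar_norm_finite[OF False] nn_integral_completion p_def[symmetric]
      using p by (intro epow_mono) auto
    then show "ennreal ((1 / 2) powr (1 / p)) * z \<le> haar_norm q S f"
      using p by (simp add: epow_mult epow_epow del: ennreal_half)
  qed simp
qed

text \<open>
  Covers increasing and decreasing functions at once, the only measurability that the K-functional and the
  truncated norms built from it need.
\<close>
lemma measurable_superlevel_intervals:
  fixes f :: "real \<Rightarrow> ennreal"
  assumes "\<And>y. is_interval {u. 0 < u \<and> y < f u}"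
  shows "f \<in> borel_measurable (lebesgue_on {0<..})"
proof (rule borel_measurableI_greater)
  fix y
  have "{u. 0 < u \<and> y < f u} \<in> sets lebesgue"
    using real_interval_borel_measurable[OF assms] by auto
  then show "{u \<in> space (lebesgue_on {0<..}). y < f u} \<in> sets (lebesgue_on {0<..})"
    by (subst sets_restrict_space_iff) (auto simp: space_restrict_space)
qed

lemma borel_measurable_increasing:
  fixes f :: "real \<Rightarrow> ennreal"
  assumes "\<And>s t. 0 < s \<Longrightarrow> s \<le> t \<Longrightarrow> f s \<le> f t"
  shows "f \<in> borel_measurable (lebesgue_on {0<..})"
  using assms by (intro measurable_superlevel_intervals) (force simp: is_interval_1 intro: less_le_trans)

lemma borel_measurable_decreasing:
  fixes f :: "real \<Rightarrow> ennreal"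
  assumes "\<And>s t. 0 < s \<Longrightarrow> s \<le> t \<Longrightarrow> f t \<le> f s"
  shows "f \<in> borel_measurable (lebesgue_on {0<..})"
  using assms by (intro measurable_superlevel_intervals) (force simp: is_interval_1 intro: less_le_trans)

definition ratio :: "real \<Rightarrow> real \<Rightarrow> real" where
  "ratio x y = max (x / y) (y / x)"

lemma ratio_ge_1: "0 < x \<Longrightarrow> 0 < y \<Longrightarrow> 1 \<le> ratio x y"
  by (cases "x \<le> y") (auto simp: ratio_def le_max_iff_disj)

lemma ratio_commute: "ratio x y = ratio y x"
  by (simp add: ratio_def max.commute)

lemma ratio_le_iff: "0 < x \<Longrightarrow> 0 < y \<Longrightarrow> ratio x y \<le> c \<longleftrightarrow> x \<le> c * y \<and> y \<le> c * x"
  by (auto simp: ratio_def divide_simps)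

text \<open>
  Polynomial growth and decay, with explicit constants. It is the common property of slowly varying functions, of
  powers, of K-functionals and of their products; the constants matter because those for \<open>K(\<cdot>, f)\<close> do
  not depend on \<open>f\<close>.
\<close>
definition moderate :: "real \<Rightarrow> real \<Rightarrow> (real \<Rightarrow> ennreal) \<Rightarrow> bool" where
  "moderate D p G \<longleftrightarrow> (\<forall>x>0. \<forall>y>0. G x \<le> ennreal (D * ratio x y powr p) * G y)"

lemma moderateD:
  assumes "moderate D p G" "0 < x" "0 < y" "ratio x y \<le> c" "0 \<le> p" "0 < D"
  shows "G x \<le> ennreal (D * c powr p) * G y"
proof -
  have "G x \<le> ennreal (D * ratio x y powr p) * G y"
    using assms by (simp add: moderate_def)
  also have "\<dots> \<le> ennreal (D * c powr p) * G y"
    using assms ratio_ge_1[of x y] by (intro mult_right_mono ennreal_leI mult_left_mono powr_mono2) auto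
  finally show ?thesis .
qed

lemma moderate_mult:
  assumes "moderate D p F" "moderate E q G" "0 < D" "0 < E"
  shows "moderate (D * E) (p + q) (\<lambda>x. F x * G x)"
  unfolding moderate_def
proof (intro allI impI)
  fix x y :: real assume xy: "0 < x" "0 < y"
  have "F x * G x \<le> (ennreal (D * ratio x y powr p) * F y) * (ennreal (E * ratio x y powr q) * G y)"
    using assms xy by (intro mult_mono) (auto simp: moderate_def)
  also have "\<dots> = (ennreal (D * ratio x y powr p) * ennreal (E * ratio x y powr q)) * (F y * G y)"
    by (simp add: mult_ac)
  also have "ennreal (D * ratio x y powr p) * ennreal (E * ratio x y powr q) = ennreal (D * E * ratio x y powr (p + q))"
    using assms by (simp add: ennreal_mult[symmetric] powr_add mult_ac)
  finally show "F x * G x \<le> ennreal (D * E * ratio x y powr (p + q)) * (F y * G y)" .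
qed

lemma moderate_epow:
  assumes "moderate D p F" "0 < D" "0 < q"
  shows "moderate (D powr q) (p * q) (\<lambda>x. epow (F x) q)"
  unfolding moderate_def
proof (intro allI impI)
  fix x y :: real assume xy: "0 < x" "0 < y"
  have r: "0 < ratio x y" using ratio_ge_1[OF xy] by simp
  have "epow (F x) q \<le> epow (ennreal (D * ratio x y powr p) * F y) q"
    using assms xy by (intro epow_mono) (auto simp: moderate_def)
  also have "\<dots> = ennreal (D powr q * ratio x y powr (p * q)) * epow (F y) q"
    using assms r by (subst epow_mult) (auto simp: powr_mult powr_powr)
  finally show "epow (F x) q \<le> ennreal (D powr q * ratio x y powr (p * q)) * epow (F y) q" .
qed

text \<open>
  The largest power of two that does not exceed \<open>x\<close>. A moderate function is equivalent to its value at
  \<open>dyadic x\<close>, which depends on \<open>x\<close> through an integer only and is therefore Borel measurable, whatever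
  the function is. This makes Fubini's theorem applicable to weights such as \<open>a \<circ> \<rho>\<close>.
\<close>
definition dyadic :: "real \<Rightarrow> real" where
  "dyadic x = 2 powr real_of_int \<lfloor>log 2 x\<rfloor>"

lemma dyadic_pos [simp]: "0 < dyadic x" by (simp add: dyadic_def)

lemma dyadic_le: "0 < x \<Longrightarrow> dyadic x \<le> x"
proof -
  assume "0 < x"
  then have "dyadic x \<le> 2 powr log 2 x" unfolding dyadic_def by (intro powr_mono) auto
  with \<open>0 < x\<close> show ?thesis by simp
qed

lemma dyadic_ge: "0 < x \<Longrightarrow> x \<le> 2 * dyadic x"
proof -
  assume "0 < x"
  have "2 powr log 2 x \<le> 2 powr (1 + real_of_int \<lfloor>log 2 x\<rfloor>)" by (intro powr_mono) linarith+
  with \<open>0 < x\<close> show ?thesis by (simp add: dyadic_def powr_add)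
qed

lemma dyadic_mono: "0 < x \<Longrightarrow> x \<le> y \<Longrightarrow> dyadic x \<le> dyadic y"
  unfolding dyadic_def by (intro powr_mono) (auto intro!: floor_mono)

lemma ratio_dyadic: "0 < x \<Longrightarrow> ratio x (dyadic x) \<le> 2"
  using dyadic_le[of x] dyadic_ge[of x] by (subst ratio_le_iff) (auto intro: order_trans[of _ x])

lemma ratio_dyadic_dyadic:
  assumes "0 < x" "0 < y" shows "ratio (dyadic x) (dyadic y) \<le> 2 * ratio x y"
proof -
  have *: "x \<le> ratio x y * y" "y \<le> ratio x y * x" "0 < ratio x y"
    using ratio_le_iff[of x y "ratio x y"] ratio_ge_1[of x y] assms by auto
  have "dyadic x \<le> ratio x y * (2 * dyadic y)"
    using * dyadic_le[of x] mult_left_mono[OF dyadic_ge[of y], of "ratio x y"] assms by linarith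
  moreover have "dyadic y \<le> ratio x y * (2 * dyadic x)"
    using * dyadic_le[of y] mult_left_mono[OF dyadic_ge[of x], of "ratio x y"] assms by linarith
  ultimately show ?thesis by (subst ratio_le_iff) auto
qed

lemma dyadic_measurable: "(\<lambda>x. G (dyadic x)) \<in> measurable borel M" if "\<And>x. G x \<in> space M"
proof -
  have "(\<lambda>x. \<lfloor>log 2 x\<rfloor>) \<in> measurable borel (count_space UNIV)" by measurable
  moreover have "(\<lambda>k. G (2 powr real_of_int k)) \<in> measurable (count_space UNIV) M"
    using that by simp
  ultimately show ?thesis unfolding dyadic_def by (rule measurable_compose)
qed

lemma moderate_dyadic:
  assumes "moderate D p G" "0 \<le> p" "0 < D"
  shows "(\<lambda>x. G (dyadic x)) \<in> borel_measurable borel"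
    and "moderate (D * 2 powr p) p (\<lambda>x. G (dyadic x))"
    and "\<And>x. 0 < x \<Longrightarrow> G x \<le> ennreal (D * 2 powr p) * G (dyadic x)"
    and "\<And>x. 0 < x \<Longrightarrow> G (dyadic x) \<le> ennreal (D * 2 powr p) * G x"
proof -
  show "(\<lambda>x. G (dyadic x)) \<in> borel_measurable borel" by (rule dyadic_measurable) simp
  show "G x \<le> ennreal (D * 2 powr p) * G (dyadic x)" if "0 < x" for x
    using that assms ratio_dyadic[of x] by (intro moderateD) auto
  show "G (dyadic x) \<le> ennreal (D * 2 powr p) * G x" if "0 < x" for x
    using that assms ratio_dyadic[of x] by (intro moderateD) (auto simp: ratio_commute)
  show "moderate (D * 2 powr p) p (\<lambda>x. G (dyadic x))"
    unfolding moderate_def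
  proof (intro allI impI)
    fix x y :: real assume xy: "0 < x" "0 < y"
    then have "G (dyadic x) \<le> ennreal (D * (2 * ratio x y) powr p) * G (dyadic y)"
      using assms ratio_dyadic_dyadic by (intro moderateD) auto
    then show "G (dyadic x) \<le> ennreal (D * 2 powr p * ratio x y powr p) * G (dyadic y)"
      using ratio_ge_1[OF xy] by (simp add: powr_mult mult.assoc)
  qed
qed

text \<open>
  A moderate function is comparable with its value at \<open>x\<close> on the octave \<open>(x, 2x)\<close>. For \<open>r = \<infinity>\<close> this
  identifies the essential supremum with the supremum, up to a constant.
\<close>
lemma moderate_le_haar_norm:
  assumes r: "0 < r" and "0 \<le> p" "0 < D"
  obtains C where "0 < C" "\<And>G x. moderate D p G \<Longrightarrow> 0 < x \<Longrightarrow> G x \<le> ennreal C * haar_norm r {0<..} G"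
proof -
  obtain k where k: "0 < k"
    "\<And>t S f z. 0 < t \<Longrightarrow> {t<..<2 * t} \<subseteq> S \<Longrightarrow> (\<And>u. t < u \<Longrightarrow> u < 2 * t \<Longrightarrow> z \<le> f u)
       \<Longrightarrow> ennreal k * z \<le> haar_norm r S f"
    using haar_norm_lower_bound[OF r] by blast
  define c where "c = D * 2 powr p"
  have c: "0 < c" using assms by (simp add: c_def)
  show thesis
  proof (rule that[of "c / k"])
    fix G x assume G: "moderate D p G" and x: "(0::real) < x"
    have "ennreal k * (ennreal (1 / c) * G x) \<le> haar_norm r {0<..} G"
    proof (rule k(2)[OF x])
      fix u assume u: "x < u" "u < 2 * x"
      have "ennreal (1 / c) * G x \<le> ennreal (1 / c) * (ennreal c * G u)"
        using u x assms G unfolding c_def by (intro mult_left_mono moderateD) (auto simp: ratio_le_iff)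
      then show "ennreal (1 / c) * G x \<le> G u" using c by (simp add: ennreal_cancel)
    qed (use x in auto)
    then have "ennreal (c / k) * (ennreal k * (ennreal (1 / c) * G x)) \<le> ennreal (c / k) * haar_norm r {0<..} G"
      by (intro mult_left_mono) auto
    moreover have "ennreal (c / k) * (ennreal k * (ennreal (1 / c) * G x)) = G x"
      using k(1) c by (simp add: mult.assoc[symmetric] ennreal_mult[symmetric])
    ultimately show "G x \<le> ennreal (c / k) * haar_norm r {0<..} G" by simp
  qed (use k c in simp)
qed

section \<open>Almost power-like substitutions\<close>

text \<open>
  The bounds \<open>t\<^bsup>1/2\<^esup>\<close> from below and \<open>t\<close> from above are those that hold for \<open>t / \<chi>\<^sub>1(t)\<close>. The upper one says
  that \<open>\<rho>\<close> does not jump over whole octaves, the lower one that it does not linger in one.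
\<close>
definition almost_power :: "real \<Rightarrow> (real \<Rightarrow> real) \<Rightarrow> bool" where
  "almost_power A \<rho> \<longleftrightarrow> (\<forall>t>0. 0 < \<rho> t) \<and>
     (\<forall>s>0. \<forall>t\<ge>s. \<rho> t \<le> A * (t / s) * \<rho> s \<and> (t / s) powr (1/2) * \<rho> s \<le> A * \<rho> t)"

lemma almost_powerD:
  assumes "almost_power A \<rho>" "0 < s" "s \<le> t"
  shows "0 < \<rho> s" "\<rho> t \<le> A * (t / s) * \<rho> s" "(t / s) powr (1/2) * \<rho> s \<le> A * \<rho> t" "\<rho> s \<le> A * \<rho> t"
proof -
  show *: "0 < \<rho> s" "\<rho> t \<le> A * (t / s) * \<rho> s" "(t / s) powr (1/2) * \<rho> s \<le> A * \<rho> t"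
    using assms by (auto simp: almost_power_def)
  have "1 * \<rho> s \<le> (t / s) powr (1/2) * \<rho> s"
    using assms * by (intro mult_right_mono ge_one_powr_ge_zero) auto
  then show "\<rho> s \<le> A * \<rho> t" using * by linarith
qed

lemma almost_power_dyadic:
  assumes \<rho>: "almost_power A \<rho>" and A: "1 \<le> A"
  shows "almost_power (2 * A) (\<lambda>t. \<rho> (dyadic t))"
  unfolding almost_power_def
proof (intro conjI allI impI)
  fix t :: real assume "0 < t"
  show "0 < \<rho> (dyadic t)" using \<rho> by (simp add: almost_power_def)
next
  fix s t :: real assume s: "0 < s" and t: "s \<le> t"
  then have t0: "0 < t" by simp
  note d = almost_powerD[OF \<rho> dyadic_pos dyadic_mono[OF s t]]
  have 1: "dyadic t / dyadic s \<le> 2 * (t / s)"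
    using frac_le[of t "dyadic t" "s / 2" "dyadic s"] dyadic_le[OF t0] dyadic_ge[OF s] s t0
    by (simp add: mult.commute)
  have 2: "t / s \<le> 2 * (dyadic t / dyadic s)"
    using frac_le[of "2 * dyadic t" t "dyadic s" s] dyadic_ge[OF t0] dyadic_le[OF s] by (simp add: less_imp_le)
  have "\<rho> (dyadic t) \<le> A * (dyadic t / dyadic s) * \<rho> (dyadic s)" by (rule d)
  also have "\<dots> \<le> A * (2 * (t / s)) * \<rho> (dyadic s)"
    using 1 A d(1) by (intro mult_right_mono mult_left_mono) auto
  finally show "\<rho> (dyadic t) \<le> 2 * A * (t / s) * \<rho> (dyadic s)" by (simp add: mult_ac)
  have "(t / s) powr (1/2) \<le> (2 * (dyadic t / dyadic s)) powr (1/2)"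
    using 2 s t0 by (intro powr_mono2) auto
  also have "\<dots> = 2 powr (1/2) * (dyadic t / dyadic s) powr (1/2)" by (simp only: powr_mult)
  also have "\<dots> \<le> 2 * (dyadic t / dyadic s) powr (1/2)"
    using powr_mono[of "1/2" 1 "2::real"] by (intro mult_right_mono) auto
  finally have "(t / s) powr (1/2) * \<rho> (dyadic s) \<le> 2 * (dyadic t / dyadic s) powr (1/2) * \<rho> (dyadic s)"
    using d(1) by (intro mult_right_mono) auto
  also have "\<dots> \<le> 2 * (A * \<rho> (dyadic t))" using d(3) by simp
  finally show "(t / s) powr (1/2) * \<rho> (dyadic s) \<le> 2 * A * \<rho> (dyadic t)" by simp
qed

lemma almost_power_ratio:
  assumes \<rho>: "almost_power A \<rho>" and A: "1 \<le> A" and x: "0 < x" and y: "0 < y"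
  shows "ratio (\<rho> x) (\<rho> y) \<le> A * ratio x y"
proof -
  have *: "ratio (\<rho> x) (\<rho> y) \<le> A * ratio x y" if x: "0 < x" and xy: "x \<le> y" for x y
  proof -
    note d = almost_powerD[OF \<rho> x xy]
    have r: "ratio x y = y / x" using x xy by (auto simp: ratio_def max_def divide_simps mult_mono)
    have y: "0 < \<rho> y" using \<rho> x xy by (simp add: almost_power_def)
    have "A * 1 \<le> A * (y / x)" using x xy A by (intro mult_left_mono) auto
    then have "\<rho> x \<le> A * (y / x) * \<rho> y" using d(4) y by (smt (verit) mult_right_mono)
    then show ?thesis using d y by (subst ratio_le_iff) (auto simp: r)
  qed
  show ?thesis
    using *[of x y] *[of y x] x y by (cases "x \<le> y") (auto simp: ratio_commute)
qed

text \<open>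
  Let \<open>t\<close> be close to the supremum of the points where \<open>\<rho>\<close> is at most \<open>u\<close>. Then \<open>\<rho>\<close> is above \<open>u\<close> at
  \<open>2 * t\<close>, and the growth bounds pin \<open>\<rho>\<close> to the size of \<open>u\<close> on the whole octave in between. This
  is the substitute for surjectivity.
\<close>

lemma almost_power_octave:
  assumes \<rho>: "almost_power A \<rho>" and A: "1 \<le> A" and u: "0 < u"
  obtains t where "0 < t" "\<And>s. t \<le> s \<Longrightarrow> s \<le> 2 * t \<Longrightarrow> ratio (\<rho> s) u \<le> 2 * A"
proof -
  define T where "T = {t. 0 < t \<and> \<rho> t \<le> u}"
  have \<rho>1: "0 < \<rho> 1" using \<rho> by (simp add: almost_power_def)
  \<comment> \<open>a point of \<open>T\<close>, since \<open>\<rho> e \<le> A * \<rho> 1 * e powr (1/2)\<close>\<close>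
  define e where "e = min 1 ((u / (A * \<rho> 1)) powr 2)"
  have e: "0 < e" "e \<le> 1" using u A \<rho>1 by (auto simp: e_def)
  have "e powr (1/2) \<le> ((u / (A * \<rho> 1)) powr 2) powr (1/2)"
    using e by (intro powr_mono2) (auto simp: e_def)
  also have "\<dots> = u / (A * \<rho> 1)" using u A \<rho>1 by (simp add: powr_powr)
  finally have e2: "A * \<rho> 1 * e powr (1/2) \<le> u" using A \<rho>1 by (simp add: field_simps)
  have "\<rho> e \<le> A * \<rho> 1 * e powr (1/2)"
    using almost_powerD(3)[OF \<rho> e] e by (simp add: powr_divide field_simps)
  then have eT: "e \<in> T" using e e2 by (simp add: T_def)
  \<comment> \<open>an upper bound of \<open>T\<close>, since \<open>t powr (1/2) * \<rho> 1 \<le> A * \<rho> t\<close> for \<open>t \<ge> 1\<close>\<close>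
  define M where "M = max 1 ((A * u / \<rho> 1) powr 2)"
  have bd: "t \<le> M" if "t \<in> T" for t
  proof (cases "t \<le> 1")
    case False
    then have "t powr (1/2) * \<rho> 1 \<le> A * \<rho> t" using almost_powerD(3)[OF \<rho>, of 1 t] by simp
    also have "\<dots> \<le> A * u" using that A by (simp add: T_def)
    finally have "t powr (1/2) \<le> A * u / \<rho> 1" using \<rho>1 by (simp add: field_simps)
    then have "(t powr (1/2)) powr 2 \<le> (A * u / \<rho> 1) powr 2" by (intro powr_mono2) auto
    then show ?thesis using False by (simp add: powr_powr M_def)
  qed (simp add: M_def)
  have bdd: "bdd_above T" using bd by (rule bdd_aboveI)
  have S: "0 < Sup T" using cSup_upper[OF eT bdd] e by simp
  have "\<exists>t\<in>T. Sup T / 2 < t" using eT S by (subst less_cSup_iff[symmetric]) (auto intro: bdd)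
  then obtain t where t: "t \<in> T" "Sup T < 2 * t" by auto
  then have t0: "0 < t" "\<rho> t \<le> u" by (auto simp: T_def)
  \<comment> \<open>\<open>\<rho>\<close> passes the level \<open>u\<close> between \<open>t\<close> and \<open>2 * t\<close>, so it stays near \<open>u\<close> in between\<close>
  have "2 * t \<notin> T" using t cSup_upper[OF _ bdd, of "2 * t"] by auto
  then have t2: "u < \<rho> (2 * t)" using t0 by (simp add: T_def)
  show thesis
  proof (rule that[OF t0(1)])
    fix s assume s: "t \<le> s" "s \<le> 2 * t"
    then have s0: "0 < s" using t0 by simp
    then have \<rho>s: "0 < \<rho> s" using \<rho> by (simp add: almost_power_def)
    have "\<rho> s \<le> A * (s / t) * \<rho> t" using almost_powerD(2)[OF \<rho> t0(1) s(1)] .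
    also have "\<dots> \<le> A * 2 * u"
      using s t0 A by (intro mult_mono mult_nonneg_nonneg) (auto simp: divide_simps less_imp_le almost_powerD(1)[OF \<rho>])
    finally have 1: "\<rho> s \<le> 2 * A * u" by simp
    have "\<rho> (2 * t) \<le> A * (2 * t / s) * \<rho> s" using almost_powerD(2)[OF \<rho> s0 s(2)] .
    also have "\<dots> \<le> A * 2 * \<rho> s"
      using s t0 s0 A \<rho>s by (intro mult_right_mono mult_left_mono) (auto simp: divide_simps)
    finally have "u \<le> 2 * A * \<rho> s" using t2 by simp
    then show "ratio (\<rho> s) u \<le> 2 * A" using 1 u \<rho>s by (subst ratio_le_iff) auto
  qed
qed

text \<open>
  The lower growth bound confines the points where \<open>\<rho>\<close> is comparable with a given value to an interval whose
  endpoints have a bounded quotient; so these points have bounded Haar measure.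
\<close>
lemma almost_power_level_sets:
  assumes \<rho>: "almost_power A \<rho>" and A: "1 \<le> A" and \<kappa>: "1 \<le> \<kappa>"
    and t: "0 < t" "0 < t'" and u: "0 < u" and "ratio (\<rho> t) u \<le> \<kappa>" "ratio (\<rho> t') u \<le> \<kappa>"
  shows "t \<le> (A * \<kappa>^2)^2 * t'"
proof (cases "t' \<le> t")
  case True
  have pos: "0 < \<rho> t" "0 < \<rho> t'" using \<rho> t by (auto simp: almost_power_def)
  have b: "\<rho> t \<le> \<kappa> * u" "u \<le> \<kappa> * \<rho> t'"
    using assms pos by (auto simp: ratio_le_iff)
  have "\<rho> t \<le> \<kappa> * (\<kappa> * \<rho> t')"
    using b \<kappa> by (auto intro: order_trans mult_left_mono)
  then have "A * \<rho> t \<le> A * (\<kappa> * (\<kappa> * \<rho> t'))" using A by (intro mult_left_mono) auto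
  with almost_powerD(3)[OF \<rho> t(2) True] have "(t / t') powr (1/2) * \<rho> t' \<le> (A * \<kappa>^2) * \<rho> t'"
    by (simp add: power2_eq_square mult_ac)
  then have "(t / t') powr (1/2) \<le> A * \<kappa>^2" using pos by simp
  then have "((t / t') powr (1/2))^2 \<le> (A * \<kappa>^2)^2" by (intro power_mono) auto
  moreover have "((t / t') powr (1/2))^2 = t / t'" using t by (simp add: powr_half_sqrt)
  ultimately show ?thesis using t by (simp add: divide_simps mult_ac)
next
  case False
  have "1 * t' \<le> (A * \<kappa>^2)^2 * t'"
  proof (intro mult_right_mono one_le_power)
    show "1 \<le> A * \<kappa>^2" using A \<kappa> mult_mono[OF A one_le_power[OF \<kappa>, of 2]] A by simp
  qed (use t in auto)
  then show ?thesis using False by simp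
qed

abbreviation haar_integral :: "(real \<Rightarrow> ennreal) \<Rightarrow> ennreal" where
  "haar_integral f \<equiv> \<integral>\<^sup>+u. indicator {0<..} u * (ennreal (1 / u) * f u) \<partial>lborel"

text \<open>
  Integrate the kernel that equals \<open>F u\<close> where \<open>\<rho>(t)\<close> and \<open>u\<close> are comparable, with respect to \<open>du/u dt/t\<close>.
  For fixed \<open>t\<close> the set of admissible \<open>u\<close> is an interval around \<open>\<rho>(t)\<close> on which \<open>F\<close> is comparable with
  \<open>F(\<rho>(t))\<close>; for fixed \<open>u\<close> the set of admissible \<open>t\<close> has Haar measure bounded from above by
  \<open>almost_power_level_sets\<close> and from below by \<open>almost_power_octave\<close>. Either order of integration therefore
  gives one side of the equivalence.
\<close>
lemma haar_integral_change_variable: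
  assumes \<rho>: "almost_power A \<rho>" and A: "1 \<le> A" and p: "0 \<le> p" and D: "0 < D"
    and \<rho>_borel [measurable]: "\<rho> \<in> borel_measurable borel"
  obtains C where "0 < C" and
    "\<And>F. F \<in> borel_measurable borel \<Longrightarrow> moderate D p F \<Longrightarrow>
      haar_integral F
        \<le> ennreal C * haar_integral (\<lambda>t. F (\<rho> t))"
    "\<And>F. F \<in> borel_measurable borel \<Longrightarrow> moderate D p F \<Longrightarrow>
      haar_integral (\<lambda>t. F (\<rho> t))
        \<le> ennreal C * haar_integral F"
proof -
  \<comment> \<open>the factor that \<open>almost_power_octave\<close> provides; in particular \<open>\<kappa> \<ge> 2\<close>, so that \<open>(\<rho> t, 2 * \<rho> t)\<close> lies in the support of the kernel\<close>
  define \<kappa> where "\<kappa> = 2 * A"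
  have \<kappa>: "2 \<le> \<kappa>" using A by (simp add: \<kappa>_def)
  define c where "c = D * \<kappa> powr p"
  have c: "0 < c" using D \<kappa> by (simp add: c_def)
  define Q where "Q = (A * \<kappa>^2)^2"
  have "1 \<le> A * \<kappa>^2" using mult_mono[OF A one_le_power[of \<kappa> 2]] \<kappa> A by simp
  then have Q: "1 \<le> Q" by (simp add: Q_def)
  have pos: "0 < \<rho> t" if "0 < t" for t using \<rho> that by (simp add: almost_power_def)
  define C where "C = 2 * c * (\<kappa>^2 + Q^2)"
  have C: "0 < C" using c Q by (simp add: C_def add_nonneg_pos)
  have main: "haar_integral F
        \<le> ennreal C * haar_integral (\<lambda>t. F (\<rho> t)) \<and>
      haar_integral (\<lambda>t. F (\<rho> t))
        \<le> ennreal C * haar_integral F"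
    if F [measurable]: "F \<in> borel_measurable borel" and mF: "moderate D p F" for F
  proof -
    define k where "k t u = (if 0 < t \<and> 0 < u \<and> \<rho> t \<le> \<kappa> * u \<and> u \<le> \<kappa> * \<rho> t
       then ennreal (1 / t) * (ennreal (1 / u) * F u) else 0)" for t u
    have k_meas [measurable]: "(\<lambda>(t, u). k t u) \<in> borel_measurable (lborel \<Otimes>\<^sub>M lborel)"
      unfolding k_def by measurable
    have Fubini: "(\<integral>\<^sup>+t. (\<integral>\<^sup>+u. k t u \<partial>lborel) \<partial>lborel) = (\<integral>\<^sup>+u. (\<integral>\<^sup>+t. k t u \<partial>lborel) \<partial>lborel)"
      using lborel_pair.Fubini'[of "\<lambda>t u. k t u"] by simp
    have t_le: "(\<integral>\<^sup>+u. k t u \<partial>lborel) \<le> ennreal (c * \<kappa>^2) * (indicator {0<..} t * (ennreal (1 / t) * F (\<rho> t)))" for t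
    proof (cases "0 < t")
      case t: True
      have "(\<integral>\<^sup>+u. k t u \<partial>lborel) \<le> (ennreal (1 / t) * (ennreal (\<kappa> / \<rho> t) * (ennreal c * F (\<rho> t)))) * ennreal (\<kappa> * \<rho> t - 0)"
      proof (rule nn_integral_le_interval)
        fix u show "k t u \<le> (ennreal (1 / t) * (ennreal (\<kappa> / \<rho> t) * (ennreal c * F (\<rho> t)))) * indicator {0..\<kappa> * \<rho> t} u"
        proof (cases "0 < u \<and> \<rho> t \<le> \<kappa> * u \<and> u \<le> \<kappa> * \<rho> t")
          case u: True
          have "F u \<le> ennreal c * F (\<rho> t)"
            unfolding c_def using u pos[OF t] p D by (intro moderateD[OF mF]) (auto simp: ratio_le_iff)
          moreover have "1 / u \<le> \<kappa> / \<rho> t" using u pos[OF t] by (simp add: divide_simps)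
          ultimately have "ennreal (1 / t) * (ennreal (1 / u) * F u) \<le> ennreal (1 / t) * (ennreal (\<kappa> / \<rho> t) * (ennreal c * F (\<rho> t)))"
            by (intro mult_mono ennreal_leI) auto
          then show ?thesis using u by (simp add: k_def)
        qed (auto simp: k_def)
      qed (use pos[OF t] \<kappa> in simp)
      also have "\<dots> = (ennreal (\<kappa> / \<rho> t) * ennreal c * ennreal (\<kappa> * \<rho> t)) * (ennreal (1 / t) * F (\<rho> t))"
        by (simp add: mult_ac)
      also have "ennreal (\<kappa> / \<rho> t) * ennreal c * ennreal (\<kappa> * \<rho> t) = ennreal (c * \<kappa>^2)"
        using pos[OF t] c \<kappa> by (simp add: ennreal_mult[symmetric] power2_eq_square mult_ac)
      finally show ?thesis using t by simp
    qed (simp add: k_def)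
    have t_ge: "indicator {0<..} t * (ennreal (1 / t) * F (\<rho> t)) \<le> ennreal (2 * c) * (\<integral>\<^sup>+u. k t u \<partial>lborel)" for t
    proof (cases "0 < t")
      case t: True
      have "(ennreal (1 / t) * (ennreal (1 / (2 * \<rho> t)) * (ennreal (1 / c) * F (\<rho> t)))) * ennreal (2 * \<rho> t - \<rho> t) \<le> (\<integral>\<^sup>+u. k t u \<partial>lborel)"
      proof (rule nn_integral_ge_interval)
        fix u assume u: "\<rho> t < u" "u < 2 * \<rho> t"
        then have u': "0 < u" "\<rho> t \<le> \<kappa> * u" "u \<le> \<kappa> * \<rho> t"
          using pos[OF t] \<kappa> mult_right_mono[of 2 \<kappa> "\<rho> t"] mult_right_mono[of 1 \<kappa> u] by linarith+
        have "ennreal (1 / c) * F (\<rho> t) \<le> ennreal (1 / c) * (ennreal c * F u)"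
          unfolding c_def using u' pos[OF t] p D by (intro mult_left_mono moderateD[OF mF]) (auto simp: ratio_le_iff)
        then have "ennreal (1 / c) * F (\<rho> t) \<le> F u" using c by (simp add: ennreal_cancel)
        moreover have "1 / (2 * \<rho> t) \<le> 1 / u" using u u' by (simp add: divide_simps)
        ultimately have "(ennreal (1 / t) * (ennreal (1 / (2 * \<rho> t)) * (ennreal (1 / c) * F (\<rho> t)))) \<le> ennreal (1 / t) * (ennreal (1 / u) * F u)"
          by (intro mult_mono ennreal_leI) auto
        then show "(ennreal (1 / t) * (ennreal (1 / (2 * \<rho> t)) * (ennreal (1 / c) * F (\<rho> t)))) \<le> k t u"
          using u' t by (simp add: k_def)
      qed (use pos[OF t] in simp)
      then have "ennreal (2 * c) * ((ennreal (1 / t) * (ennreal (1 / (2 * \<rho> t)) * (ennreal (1 / c) * F (\<rho> t)))) * ennreal (2 * \<rho> t - \<rho> t)) \<le> ennreal (2 * c) * (\<integral>\<^sup>+u. k t u \<partial>lborel)"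
        by (intro mult_left_mono) auto
      moreover have "ennreal (2 * c) * ((ennreal (1 / t) * (ennreal (1 / (2 * \<rho> t)) * (ennreal (1 / c) * F (\<rho> t)))) * ennreal (2 * \<rho> t - \<rho> t))
         = (ennreal (2 * c) * (ennreal (1 / (2 * \<rho> t)) * (ennreal (1 / c) * ennreal (2 * \<rho> t - \<rho> t)))) * (ennreal (1 / t) * F (\<rho> t))"
        by (simp only: mult_ac)
      moreover have "ennreal (2 * c) * (ennreal (1 / (2 * \<rho> t)) * (ennreal (1 / c) * ennreal (2 * \<rho> t - \<rho> t))) = 1"
        using pos[OF t] c by (simp add: ennreal_mult[symmetric])
      ultimately show ?thesis using t by simp
    qed simp
    let ?N = "\<lambda>u. \<integral>\<^sup>+t. (if 0 < t \<and> \<rho> t \<le> \<kappa> * u \<and> u \<le> \<kappa> * \<rho> t then ennreal (1 / t) else 0) \<partial>lborel"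
    have u_eq: "(\<integral>\<^sup>+t. k t u \<partial>lborel) = ?N u * (ennreal (1 / u) * F u)" if "0 < u" for u
      using that by (subst nn_integral_multc[symmetric]) (auto simp: k_def intro!: nn_integral_cong)
    have u_le: "(\<integral>\<^sup>+t. k t u \<partial>lborel) \<le> ennreal (Q^2) * (indicator {0<..} u * (ennreal (1 / u) * F u))" for u
    proof (cases "0 < u")
      case u: True
      have "?N u \<le> ennreal (Q^2)"
      proof (cases "\<exists>t>0. \<rho> t \<le> \<kappa> * u \<and> u \<le> \<kappa> * \<rho> t")
        case True
        then obtain s where s: "0 < s" "\<rho> s \<le> \<kappa> * u" "u \<le> \<kappa> * \<rho> s" by blast
        have "?N u
           \<le> ennreal (Q / s) * ennreal (Q * s - 0)"
        proof (rule nn_integral_le_interval)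
          fix t
          show "(if 0 < t \<and> \<rho> t \<le> \<kappa> * u \<and> u \<le> \<kappa> * \<rho> t then ennreal (1 / t) else 0) \<le> ennreal (Q / s) * indicator {0..Q * s} t"
          proof (cases "0 < t \<and> \<rho> t \<le> \<kappa> * u \<and> u \<le> \<kappa> * \<rho> t")
            case True
            have "ratio (\<rho> t) u \<le> \<kappa>" "ratio (\<rho> s) u \<le> \<kappa>"
              using True s by (simp_all add: ratio_le_iff pos u)
            then have "t \<le> Q * s"
              unfolding Q_def using True s u \<kappa> by (intro almost_power_level_sets[OF \<rho> A]) simp_all
            then have "1 / t \<le> Q / s" if "s \<le> Q * t" using that True s by (simp add: divide_simps)
            moreover have "s \<le> Q * t"
              unfolding Q_def using True s u \<kappa> \<open>ratio (\<rho> t) u \<le> \<kappa>\<close> \<open>ratio (\<rho> s) u \<le> \<kappa>\<close>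
              by (intro almost_power_level_sets[OF \<rho> A]) simp_all
            ultimately have "ennreal (1 / t) \<le> ennreal (Q / s)" by (intro ennreal_leI) simp
            then show ?thesis using True s \<open>t \<le> Q * s\<close> by simp
          qed auto
        qed (use s Q in simp)
        also have "\<dots> = ennreal (Q^2)" using s Q by (simp add: ennreal_mult[symmetric] power2_eq_square)
        finally show ?thesis .
      next
        case False
        then have "?N u = (\<integral>\<^sup>+(t::real). 0 \<partial>lborel)"
          by (intro nn_integral_cong) auto
        then show ?thesis by simp
      qed
      then show ?thesis unfolding u_eq[OF u] using u by (auto intro!: mult_right_mono)
    qed (simp add: k_def)
    have u_ge: "indicator {0<..} u * (ennreal (1 / u) * F u) \<le> ennreal 2 * (\<integral>\<^sup>+t. k t u \<partial>lborel)" for u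
    proof (cases "0 < u")
      case u: True
      obtain s where s: "0 < s" "\<And>t. s \<le> t \<Longrightarrow> t \<le> 2 * s \<Longrightarrow> ratio (\<rho> t) u \<le> \<kappa>"
        using almost_power_octave[OF \<rho> A u] unfolding \<kappa>_def by blast
      have "ennreal (1 / (2 * s)) * ennreal (2 * s - s) \<le> ?N u"
      proof (rule nn_integral_ge_interval)
        fix t assume t: "s < t" "t < 2 * s"
        then have "ratio (\<rho> t) u \<le> \<kappa>" "0 < t" using s by auto
        then have "\<rho> t \<le> \<kappa> * u" "u \<le> \<kappa> * \<rho> t" using pos u by (auto simp: ratio_le_iff)
        then show "ennreal (1 / (2 * s)) \<le> (if 0 < t \<and> \<rho> t \<le> \<kappa> * u \<and> u \<le> \<kappa> * \<rho> t then ennreal (1 / t) else 0)"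
          using t s by (auto intro!: ennreal_leI simp: divide_simps)
      qed (use s in simp)
      then have "ennreal 2 * (ennreal (1 / (2 * s)) * ennreal (2 * s - s)) \<le> ennreal 2 * ?N u"
        by (intro mult_left_mono) auto
      moreover have "ennreal 2 * (ennreal (1 / (2 * s)) * ennreal (2 * s - s)) = 1"
        using s(1) by (subst ennreal_mult'[symmetric], simp, subst ennreal_mult'[symmetric], simp, simp)
      ultimately have "1 \<le> ennreal 2 * ?N u"
        by simp
      then have "1 * (ennreal (1 / u) * F u) \<le> (ennreal 2 * ?N u) * (ennreal (1 / u) * F u)"
        by (rule mult_right_mono) simp
      then show ?thesis unfolding u_eq[OF u] using u by (simp only: mult.assoc) simp
    qed simp
    let ?U = "haar_integral F"
    let ?T = "haar_integral (\<lambda>t. F (\<rho> t))"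
    have "?U \<le> ennreal 2 * (\<integral>\<^sup>+u. (\<integral>\<^sup>+t. k t u \<partial>lborel) \<partial>lborel)"
      using u_ge by (subst nn_integral_cmult[symmetric]) (auto intro!: nn_integral_mono)
    also have "\<dots> \<le> ennreal 2 * (ennreal (c * \<kappa>^2) * ?T)"
      unfolding Fubini[symmetric]
      using t_le by (subst nn_integral_cmult[symmetric]) (auto intro!: nn_integral_mono mult_left_mono)
    also have "\<dots> = ennreal (2 * (c * \<kappa>^2)) * ?T"
      using c by (simp add: ennreal_mult mult.assoc del: ennreal_numeral)
    also have "\<dots> \<le> ennreal C * ?T"
      using c by (intro mult_right_mono ennreal_leI) (auto simp: C_def)
    finally have 1: "?U \<le> ennreal C * ?T" .
    have "?T \<le> ennreal (2 * c) * (\<integral>\<^sup>+t. (\<integral>\<^sup>+u. k t u \<partial>lborel) \<partial>lborel)"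
      using t_ge by (subst nn_integral_cmult[symmetric]) (auto intro!: nn_integral_mono)
    also have "\<dots> \<le> ennreal (2 * c) * (ennreal (Q^2) * ?U)"
      unfolding Fubini
      using u_le by (subst nn_integral_cmult[symmetric]) (auto intro!: nn_integral_mono mult_left_mono)
    also have "\<dots> = ennreal (2 * c * Q^2) * ?U"
      using c by (simp add: ennreal_mult mult.assoc del: ennreal_numeral)
    also have "\<dots> \<le> ennreal C * ?U"
      using c by (intro mult_right_mono ennreal_leI) (auto simp: C_def)
    finally show ?thesis using 1 by simp
  qed
  show thesis using that[OF C] main by blast
qed

section \<open>Change of variables and a Hardy inequality for the Haar quasi-norm\<close>

lemma haar_norm_finite_integral:
  assumes "q \<noteq> top"
  shows "haar_norm q {0<..} f =
    epow (haar_integral (\<lambda>u. epow (f u) (enn2real q))) (1 / enn2real q)"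
  using assms by (simp add: haar_norm_finite nn_integral_completion)

lemma epow_cmult_root:
  assumes "I \<le> ennreal c * J" "0 < c" "0 < p"
  shows "epow I (1 / p) \<le> ennreal (c powr (1 / p)) * epow J (1 / p)"
  using assms epow_mono[of "1 / p" I "ennreal c * J"] by (simp add: epow_mult)

text \<open>
  For \<open>r < \<infinity>\<close> both \<open>G\<close> and \<open>\<rho>\<close> are replaced by their dyadic versions, to which Fubini's theorem applies. For
  \<open>r = \<infinity>\<close> norms are suprema, and the range of \<open>\<rho>\<close> meets every neighbourhood of fixed
  multiplicative size.
\<close>
theorem haar_norm_change_variable:
  assumes r: "0 < r" and \<rho>: "almost_power A \<rho>" and A: "1 \<le> A" and p: "0 \<le> p" and D: "0 < D"
  obtains C where "0 < C" and
    "\<And>G. moderate D p G \<Longrightarrow> haar_norm r {0<..} G \<le> ennreal C * haar_norm r {0<..} (\<lambda>t. G (\<rho> t))"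
    "\<And>G. moderate D p G \<Longrightarrow> haar_norm r {0<..} (\<lambda>t. G (\<rho> t)) \<le> ennreal C * haar_norm r {0<..} G"
proof (cases "r = top")
  case True
  obtain k where k: "0 < k"
    "\<And>t S f z. 0 < t \<Longrightarrow> {t<..<2 * t} \<subseteq> S \<Longrightarrow> (\<And>u. t < u \<Longrightarrow> u < 2 * t \<Longrightarrow> z \<le> f u)
       \<Longrightarrow> ennreal k * z \<le> haar_norm r S f"
    using haar_norm_lower_bound[OF r] by blast
  obtain B where B: "0 < B" "\<And>G x. moderate D p G \<Longrightarrow> 0 < x \<Longrightarrow> G x \<le> ennreal B * haar_norm r {0<..} G"
    using moderate_le_haar_norm[OF r p D] by blast
  define c where "c = D * (2 * A) powr p"
  have c: "0 < c" using D A by (simp add: c_def)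
  have sup: "haar_norm r {0<..} f \<le> z" if "\<And>u. 0 < u \<Longrightarrow> f u \<le> z" for f z
    unfolding haar_norm_infinity[OF True] using that by (intro Inf_lower) simp
  have le: "ennreal x * z \<le> ennreal (x + y) * z" "ennreal y * z \<le> ennreal (x + y) * z" if "0 < x" "0 < y" for x y z
    using that by (auto intro!: mult_right_mono ennreal_leI)
  show thesis
  proof (rule that[of "c / k + B"])
    fix G assume G: "moderate D p G"
    have "G u \<le> ennreal (c / k) * haar_norm r {0<..} (\<lambda>t. G (\<rho> t))" if u: "0 < u" for u
    proof -
      obtain t where t: "0 < t" "\<And>s. t \<le> s \<Longrightarrow> s \<le> 2 * t \<Longrightarrow> ratio (\<rho> s) u \<le> 2 * A"
        using almost_power_octave[OF \<rho> A u] by blast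
      have "ennreal k * (ennreal (1 / c) * G u) \<le> haar_norm r {0<..} (\<lambda>t. G (\<rho> t))"
      proof (rule k(2)[OF t(1)])
        fix s assume s: "t < s" "s < 2 * t"
        then have "0 < \<rho> s" using \<rho> t by (simp add: almost_power_def)
        then have "ennreal (1 / c) * G u \<le> ennreal (1 / c) * (ennreal c * G (\<rho> s))"
          unfolding c_def using s t(2)[of s] u p D by (intro mult_left_mono moderateD[OF G]) (auto simp: ratio_commute)
        then show "ennreal (1 / c) * G u \<le> G (\<rho> s)" using c by (simp add: ennreal_cancel)
      qed (use t in auto)
      then have "ennreal (c / k) * (ennreal k * (ennreal (1 / c) * G u)) \<le> ennreal (c / k) * haar_norm r {0<..} (\<lambda>t. G (\<rho> t))"
        by (intro mult_left_mono) auto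
      moreover have "ennreal (c / k) * (ennreal k * (ennreal (1 / c) * G u)) = G u"
        using k(1) c by (simp add: mult.assoc[symmetric] ennreal_mult[symmetric])
      ultimately show ?thesis by simp
    qed
    then have "haar_norm r {0<..} G \<le> ennreal (c / k) * haar_norm r {0<..} (\<lambda>t. G (\<rho> t))" by (rule sup)
    then show "haar_norm r {0<..} G \<le> ennreal (c / k + B) * haar_norm r {0<..} (\<lambda>t. G (\<rho> t))"
      by (rule order_trans) (use le(1)[of "c / k" B] c k B in auto)
    have "haar_norm r {0<..} (\<lambda>t. G (\<rho> t)) \<le> ennreal B * haar_norm r {0<..} G"
      using \<rho> by (intro sup B(2)[OF G]) (simp add: almost_power_def)
    then show "haar_norm r {0<..} (\<lambda>t. G (\<rho> t)) \<le> ennreal (c / k + B) * haar_norm r {0<..} G"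
      by (rule order_trans) (use le(2)[of "c / k" B] c k B in auto)
  qed (use c k B in \<open>auto intro: add_pos_pos\<close>)
next
  case False
  define s where "s = enn2real r"
  have s: "0 < s" using r False by (simp add: s_def enn2real_positive_iff less_top)
  define \<sigma> where "\<sigma> t = \<rho> (dyadic t)" for t
  have \<sigma>: "almost_power (2 * A) \<sigma>"
    using almost_power_dyadic[OF \<rho> A] by (simp add: \<sigma>_def[abs_def])
  have \<sigma>_borel: "\<sigma> \<in> borel_measurable borel"
    unfolding \<sigma>_def[abs_def] by (rule dyadic_measurable) simp
  define E where "E = D * 2 powr p"
  have E: "0 < E" using D by (simp add: E_def)
  obtain B where B: "0 < B"
    "\<And>F. F \<in> borel_measurable borel \<Longrightarrow> moderate (E powr s) (p * s) F \<Longrightarrow>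
      haar_integral F
        \<le> ennreal B * haar_integral (\<lambda>t. F (\<sigma> t))"
    "\<And>F. F \<in> borel_measurable borel \<Longrightarrow> moderate (E powr s) (p * s) F \<Longrightarrow>
      haar_integral (\<lambda>t. F (\<sigma> t))
        \<le> ennreal B * haar_integral F"
    using haar_integral_change_variable[OF \<sigma>, of "p * s" "E powr s"] A p s E \<sigma>_borel by auto
  define a where "a = D * (4 * A) powr p"
  have a: "0 < a" using D A by (simp add: a_def)
  define b where "b = B powr (1 / s)"
  have b: "0 < b" using B by (simp add: b_def)
  show thesis
  proof (rule that[of "a * (b * a)"])
    fix G assume G: "moderate D p G"
    define H where "H x = G (dyadic x)" for x
    note H = moderate_dyadic[OF G p D, folded H_def E_def]
    have eH: "moderate (E powr s) (p * s) (\<lambda>x. epow (H x) s)" using moderate_epow[OF H(2) E s] .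
    have [measurable]: "(\<lambda>x. epow (H x) s) \<in> borel_measurable borel"
      using H(1) by (rule measurable_compose) simp
    have cmp: "G x \<le> ennreal a * H x" "H x \<le> ennreal a * G x"
         "G (\<rho> x) \<le> ennreal a * H (\<sigma> x)" "H (\<sigma> x) \<le> ennreal a * G (\<rho> x)" if x: "0 < x" for x
    proof -
      have 1: "ratio x (dyadic x) \<le> 4 * A" using ratio_dyadic[OF x] A by simp
      have px: "0 < \<rho> x" "0 < \<sigma> x" using \<rho> x by (auto simp: \<sigma>_def almost_power_def)
      have "ratio (\<rho> x) (\<sigma> x) \<le> A * 2"
        unfolding \<sigma>_def using almost_power_ratio[OF \<rho> A x dyadic_pos] ratio_dyadic[OF x] A
        by (meson mult_left_mono order_trans zero_le_one)
      then have "ratio (\<rho> x) (\<sigma> x) \<le> 2 * A" by simp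
      then have r: "\<rho> x \<le> 2 * A * \<sigma> x" "\<sigma> x \<le> 2 * A * \<rho> x" using px by (auto simp: ratio_le_iff)
      have "2 * A * \<sigma> x \<le> 2 * A * (2 * dyadic (\<sigma> x))" using dyadic_ge[OF px(2)] A by (intro mult_left_mono) auto
      moreover have "2 * A * \<rho> x \<le> 4 * A * \<rho> x" using A px by simp
      ultimately have 2: "ratio (\<rho> x) (dyadic (\<sigma> x)) \<le> 4 * A"
        using r px dyadic_le[OF px(2)] by (subst ratio_le_iff) auto
      show "G x \<le> ennreal a * H x" "H x \<le> ennreal a * G x"
         "G (\<rho> x) \<le> ennreal a * H (\<sigma> x)" "H (\<sigma> x) \<le> ennreal a * G (\<rho> x)"
        unfolding a_def H_def using 1 2 x px p D by (auto intro!: moderateD[OF G] simp: ratio_commute)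
    qed
    have fwd: "haar_norm r {0<..} H \<le> ennreal b * haar_norm r {0<..} (\<lambda>t. H (\<sigma> t))"
      unfolding haar_norm_finite_integral[OF False] s_def[symmetric] b_def
      using B(2)[OF _ eH] B(1) s by (intro epow_cmult_root) auto
    have bwd: "haar_norm r {0<..} (\<lambda>t. H (\<sigma> t)) \<le> ennreal b * haar_norm r {0<..} H"
      unfolding haar_norm_finite_integral[OF False] s_def[symmetric] b_def
      using B(3)[OF _ eH] B(1) s by (intro epow_cmult_root) auto
    have "haar_norm r {0<..} G \<le> ennreal a * haar_norm r {0<..} H"
      using cmp a r by (intro haar_norm_le_cmult) auto
    also have "\<dots> \<le> ennreal a * (ennreal b * haar_norm r {0<..} (\<lambda>t. H (\<sigma> t)))"
      using fwd by (intro mult_left_mono) auto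
    also have "haar_norm r {0<..} (\<lambda>t. H (\<sigma> t)) \<le> ennreal a * haar_norm r {0<..} (\<lambda>t. G (\<rho> t))"
      using cmp a r by (intro haar_norm_le_cmult) auto
    finally show "haar_norm r {0<..} G \<le> ennreal (a * (b * a)) * haar_norm r {0<..} (\<lambda>t. G (\<rho> t))"
      using a b by (simp add: ennreal_mult mult.assoc mult_left_mono)
    have "haar_norm r {0<..} (\<lambda>t. G (\<rho> t)) \<le> ennreal a * haar_norm r {0<..} (\<lambda>t. H (\<sigma> t))"
      using cmp a r by (intro haar_norm_le_cmult) auto
    also have "\<dots> \<le> ennreal a * (ennreal b * haar_norm r {0<..} H)"
      using bwd by (intro mult_left_mono) auto
    also have "haar_norm r {0<..} H \<le> ennreal a * haar_norm r {0<..} G"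
      using cmp a r by (intro haar_norm_le_cmult) auto
    finally show "haar_norm r {0<..} (\<lambda>t. G (\<rho> t)) \<le> ennreal (a * (b * a)) * haar_norm r {0<..} G"
      using a b by (simp add: ennreal_mult mult.assoc mult_left_mono)
  qed (use a b in simp)
qed

lemma haar_integral_tail_average:
  assumes e: "0 < e" and F [measurable]: "F \<in> borel_measurable borel"
  shows "(\<integral>\<^sup>+t. indicator {0<..} t * (ennreal (1 / t) *
            (\<integral>\<^sup>+v. indicator {t<..} v * (ennreal ((t / v) powr e / v) * F v) \<partial>lborel)) \<partial>lborel)
     \<le> ennreal (1 / e) * haar_integral F"
proof -
  define k where "k t v = (if 0 < t \<and> t < v then ennreal (t powr (e - 1)) * (ennreal (v powr (- e) / v) * F v) else 0)" for t v
  have [measurable]: "(\<lambda>(t, v). k t v) \<in> borel_measurable (lborel \<Otimes>\<^sub>M lborel)"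
    unfolding k_def by measurable
  have "(\<integral>\<^sup>+t. indicator {0<..} t * (ennreal (1 / t) *
            (\<integral>\<^sup>+v. indicator {t<..} v * (ennreal ((t / v) powr e / v) * F v) \<partial>lborel)) \<partial>lborel)
     = (\<integral>\<^sup>+t. (\<integral>\<^sup>+v. k t v \<partial>lborel) \<partial>lborel)"
  proof (rule nn_integral_cong)
    fix t :: real
    show "indicator {0<..} t * (ennreal (1 / t) * (\<integral>\<^sup>+v. indicator {t<..} v * (ennreal ((t / v) powr e / v) * F v) \<partial>lborel))
        = (\<integral>\<^sup>+v. k t v \<partial>lborel)"
    proof (cases "0 < t")
      case True
      have eq: "ennreal (1 / t) * (indicator {t<..} v * (ennreal ((t / v) powr e / v) * F v)) = k t v" for v
      proof (cases "t < v")
        case v: True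
        have "1 / t * ((t / v) powr e / v) = t powr (e - 1) * (v powr (- e) / v)"
          using True v by (simp add: powr_divide powr_diff powr_minus divide_simps)
        then have "ennreal (1 / t) * ennreal ((t / v) powr e / v) = ennreal (t powr (e - 1)) * ennreal (v powr (- e) / v)"
          using True v by (simp add: ennreal_mult'[symmetric])
        then show ?thesis using True v by (simp add: k_def mult.assoc[symmetric])
      qed (simp add: k_def)
      show ?thesis
        using True by (subst eq[symmetric], subst nn_integral_cmult) auto
    qed (simp add: k_def)
  qed
  also have "\<dots> = (\<integral>\<^sup>+v. (\<integral>\<^sup>+t. k t v \<partial>lborel) \<partial>lborel)"
    using lborel_pair.Fubini'[of "\<lambda>t u. k t u"] by simp
  also have "\<dots> \<le> (\<integral>\<^sup>+v. ennreal (1 / e) * (indicator {0<..} v * (ennreal (1 / v) * F v)) \<partial>lborel)"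
  proof (rule nn_integral_mono)
    fix v :: real
    show "(\<integral>\<^sup>+t. k t v \<partial>lborel) \<le> ennreal (1 / e) * (indicator {0<..} v * (ennreal (1 / v) * F v))"
    proof (cases "0 < v")
      case True
      have "(\<integral>\<^sup>+t. k t v \<partial>lborel) = (\<integral>\<^sup>+t. indicator {0<..<v} t * ennreal (t powr (e - 1)) \<partial>lborel) * (ennreal (v powr (- e) / v) * F v)"
        by (subst nn_integral_multc[symmetric]) (auto simp: k_def intro!: nn_integral_cong)
      also have "\<dots> \<le> ennreal (v powr e / e) * (ennreal (v powr (- e) / v) * F v)"
        using nn_integral_powr_head[OF e True] by (rule mult_right_mono) simp
      also have "ennreal (v powr e / e) * (ennreal (v powr (- e) / v) * F v) = ennreal (1 / e) * (ennreal (1 / v) * F v)"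
      proof -
        have "v powr e / e * (v powr (- e) / v) = 1 / e * (1 / v)"
          using True e by (simp add: powr_minus divide_simps)
        then have "ennreal (v powr e / e) * ennreal (v powr (- e) / v) = ennreal (1 / e) * ennreal (1 / v)"
          using True e by (simp add: ennreal_mult'[symmetric])
        then show ?thesis by (simp add: mult.assoc[symmetric])
      qed
      finally show ?thesis using True by simp
    next
      case False
      then have "k t v = 0" for t by (simp add: k_def)
      then show ?thesis by simp
    qed
  qed
  also have "\<dots> = ennreal (1 / e) * haar_integral F"
    by (rule nn_integral_cmult) measurable
  finally show ?thesis .
qed

text \<open>
  Since \<open>Z\<close> is moderate, its value at \<open>u\<close> is controlled by its average over \<open>(u, 2u)\<close>. The supremum is
  thus dominated by an integral over \<open>(t, \<infinity>)\<close> with the kernel \<open>(t/v)\<^bsup>dr\<^esup>\<close>, for which the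
  Hardy inequality is an exchange of integrals. Taking a supremum instead of a sum avoids any distinction
  between \<open>r \<ge> 1\<close> and \<open>r < 1\<close>.
\<close>
theorem haar_norm_Hardy_sup:
  assumes r: "0 < r" and d: "0 < d" and p: "0 \<le> p" and D: "0 < D"
  obtains C where "0 < C" and
    "\<And>Z. moderate D p Z \<Longrightarrow>
      haar_norm r {0<..} (\<lambda>t. SUP u\<in>{t..}. ennreal ((t / u) powr d) * Z u) \<le> ennreal C * haar_norm r {0<..} Z"
proof (cases "r = top")
  case True
  obtain B where B: "0 < B" "\<And>G x. moderate D p G \<Longrightarrow> 0 < x \<Longrightarrow> G x \<le> ennreal B * haar_norm r {0<..} G"
    using moderate_le_haar_norm[OF r p D] by blast
  show thesis
  proof (rule that[OF B(1)])
    fix Z assume Z: "moderate D p Z"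
    have "(SUP u\<in>{t..}. ennreal ((t / u) powr d) * Z u) \<le> ennreal B * haar_norm r {0<..} Z" if t: "0 < t" for t
    proof (rule SUP_least)
      fix u assume u: "u \<in> {t..}"
      have "(t / u) powr d \<le> 1" using t u d by (intro powr_le1) auto
      then have "ennreal ((t / u) powr d) * Z u \<le> 1 * Z u" by (intro mult_right_mono) auto
      also have "\<dots> \<le> ennreal B * haar_norm r {0<..} Z" using B(2)[OF Z, of u] t u by simp
      finally show "ennreal ((t / u) powr d) * Z u \<le> ennreal B * haar_norm r {0<..} Z" .
    qed
    then show "haar_norm r {0<..} (\<lambda>t. SUP u\<in>{t..}. ennreal ((t / u) powr d) * Z u) \<le> ennreal B * haar_norm r {0<..} Z"
      unfolding haar_norm_infinity[OF True, of _ "\<lambda>t. SUP u\<in>{t..}. ennreal ((t / u) powr d) * Z u"]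
      by (intro Inf_lower) simp
  qed
next
  case False
  define s where "s = enn2real r"
  have s: "0 < s" using r False by (simp add: s_def enn2real_positive_iff less_top)
  define e where "e = d * s"
  have e: "0 < e" using d s by (simp add: e_def)
  define a where "a = (D * 2 powr p) powr s"
  have a: "0 < a" using D by (simp add: a_def)
  define b where "b = (2 * (2 powr e * a * a))"
  have b: "0 < b" using a by (simp add: b_def)
  define c where "c = b * (1 / e) * a"
  have c: "0 < c" using a b e by (simp add: c_def)
  have cf: "ennreal c = ennreal b * (ennreal (1 / e) * ennreal a)"
    using a b e by (simp add: c_def ennreal_mult'[symmetric])
  show thesis
  proof (rule that[of "c powr (1 / s)"])
    fix Z assume Z: "moderate D p Z"
    define F where "F v = epow (Z (dyadic v)) s" for v
    have [measurable]: "F \<in> borel_measurable borel"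
      unfolding F_def[abs_def] using moderate_dyadic(1)[OF Z p D] by (rule measurable_compose) simp
    have c2: "0 < D * 2 powr p" using D by simp
    have F1: "epow (Z v) s \<le> ennreal a * F v" and F2: "F v \<le> ennreal a * epow (Z v) s" if "0 < v" for v
      using epow_mono[OF s moderate_dyadic(3)[OF Z p D that]] epow_mono[OF s moderate_dyadic(4)[OF Z p D that]]
      unfolding a_def F_def by (simp_all only: epow_mult[OF c2])
    let ?I = "\<lambda>t. \<integral>\<^sup>+v. indicator {t<..} v * (ennreal ((t / v) powr e / v) * F v) \<partial>lborel"
    have pt: "epow (SUP u\<in>{t..}. ennreal ((t / u) powr d) * Z u) s \<le> ennreal b * ?I t" if t: "0 < t" for t
    proof -
      have 1: "epow (ennreal ((t / u) powr d) * Z u) s \<le> ennreal b * ?I t" if u: "t \<le> u" for u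
      proof -
        have u0: "0 < u" using t u by simp
        define z where "z = ennreal ((t / u) powr e) * epow (Z u) s"
        have "(ennreal (1 / (2 powr e * a * a) / (2 * u)) * z) * ennreal (2 * u - u) \<le> ?I t"
        proof (rule nn_integral_ge_interval)
          fix v assume v: "u < v" "v < 2 * u"
          then have v0: "0 < v" using u0 by simp
          have "epow (Z u) s \<le> epow (ennreal (D * 2 powr p) * Z v) s"
            using u0 v v0 p D by (intro epow_mono[OF s] moderateD[OF Z]) (auto simp: ratio_le_iff)
          also have "\<dots> = ennreal a * epow (Z v) s" unfolding a_def by (rule epow_mult[OF c2])
          also have "\<dots> \<le> ennreal a * (ennreal a * F v)" using F1[OF v0] by (intro mult_left_mono) auto
          finally have Zu: "epow (Z u) s \<le> ennreal (a * a) * F v" using a by (simp add: ennreal_mult mult.assoc)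
          have "(t / u) powr e \<le> (2 * (t / v)) powr e"
            using v v0 u0 t e by (intro powr_mono2) (auto simp: divide_simps)
          also have "\<dots> = 2 powr e * (t / v) powr e" by (simp only: powr_mult)
          finally have tu: "(t / u) powr e \<le> 2 powr e * (t / v) powr e" .
          have "z \<le> ennreal (2 powr e * (t / v) powr e) * (ennreal (a * a) * F v)"
            unfolding z_def using tu Zu by (intro mult_mono ennreal_leI) auto
          also have "\<dots> = ennreal (2 powr e * a * a) * (ennreal ((t / v) powr e) * F v)"
            using a by (simp add: ennreal_mult mult_ac)
          finally have "ennreal (1 / (2 powr e * a * a)) * z \<le> ennreal (1 / (2 powr e * a * a)) * (ennreal (2 powr e * a * a) * (ennreal ((t / v) powr e) * F v))"
            by (intro mult_left_mono) auto
          then have z1: "ennreal (1 / (2 powr e * a * a)) * z \<le> ennreal ((t / v) powr e) * F v"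
            using a by (subst (asm) ennreal_cancel) auto
          have iu: "ennreal (1 / (2 * u)) \<le> ennreal (1 / v)"
            using v v0 by (intro ennreal_leI) (auto simp: divide_simps)
          have "ennreal (1 / (2 * u)) * (ennreal (1 / (2 powr e * a * a)) * z) \<le> ennreal (1 / v) * (ennreal ((t / v) powr e) * F v)"
            by (rule mult_mono[OF iu z1 zero_le zero_le])
          moreover have "ennreal (1 / (2 * u)) * (ennreal (1 / (2 powr e * a * a)) * z) = ennreal (1 / (2 powr e * a * a) / (2 * u)) * z"
          proof -
            have "ennreal (1 / (2 powr e * a * a) / (2 * u)) = ennreal (1 / (2 * u)) * ennreal (1 / (2 powr e * a * a))"
              using u0 by (subst ennreal_mult'[symmetric]) (auto simp: mult.commute)
            then show ?thesis by (simp only: mult.assoc)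
          qed
          moreover have "ennreal (1 / v) * (ennreal ((t / v) powr e) * F v) = ennreal ((t / v) powr e / v) * F v"
          proof -
            have "ennreal ((t / v) powr e / v) = ennreal (1 / v) * ennreal ((t / v) powr e)"
              using v0 by (subst ennreal_mult'[symmetric]) auto
            then show ?thesis by (simp only: mult.assoc)
          qed
          ultimately show "ennreal (1 / (2 powr e * a * a) / (2 * u)) * z \<le> indicator {t<..} v * (ennreal ((t / v) powr e / v) * F v)"
            using v u by simp
        qed (use u0 in simp)
        then have "ennreal b * ((ennreal (1 / (2 powr e * a * a) / (2 * u)) * z) * ennreal (2 * u - u)) \<le> ennreal b * ?I t"
          by (intro mult_left_mono) auto
        moreover have "ennreal b * ((ennreal (1 / (2 powr e * a * a) / (2 * u)) * z) * ennreal (2 * u - u)) = z"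
        proof -
          have "b * (1 / (2 powr e * a * a) / (2 * u)) * (2 * u - u) = 1"
            using u0 a by (simp add: b_def field_simps)
          then have "ennreal b * ennreal (1 / (2 powr e * a * a) / (2 * u)) * ennreal (2 * u - u) = 1"
            using u0 a b by (simp add: ennreal_mult'[symmetric])
          then show ?thesis by (metis mult.assoc mult.commute mult_1)
        qed
        moreover have "epow (ennreal ((t / u) powr d) * Z u) s = z"
          using t u0 by (subst epow_mult) (auto simp: z_def e_def powr_powr)
        ultimately show ?thesis by simp
      qed
      have "(SUP u\<in>{t..}. ennreal ((t / u) powr d) * Z u) \<le> epow (ennreal b * ?I t) (1 / s)"
      proof (rule SUP_least)
        fix u assume "u \<in> {t..}"
        then have "epow (epow (ennreal ((t / u) powr d) * Z u) s) (1 / s) \<le> epow (ennreal b * ?I t) (1 / s)"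
          using 1 s by (intro epow_mono) auto
        then show "ennreal ((t / u) powr d) * Z u \<le> epow (ennreal b * ?I t) (1 / s)"
          using s by (simp add: epow_epow)
      qed
      then have "epow (SUP u\<in>{t..}. ennreal ((t / u) powr d) * Z u) s \<le> epow (epow (ennreal b * ?I t) (1 / s)) s"
        by (rule epow_mono[OF s])
      also have "\<dots> = ennreal b * ?I t" using epow_epow[of "1 / s"] s by simp
      finally show ?thesis .
    qed
    have "haar_integral (\<lambda>t. epow (SUP u\<in>{t..}. ennreal ((t / u) powr d) * Z u) s)
       \<le> (\<integral>\<^sup>+t. ennreal b * (indicator {0<..} t * (ennreal (1 / t) * ?I t)) \<partial>lborel)"
    proof (rule nn_integral_mono)
      fix t :: real
      show "indicator {0<..} t * (ennreal (1 / t) * epow (SUP u\<in>{t..}. ennreal ((t / u) powr d) * Z u) s)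
         \<le> ennreal b * (indicator {0<..} t * (ennreal (1 / t) * ?I t))"
        using mult_left_mono[OF pt, of t "ennreal (1 / t)"] by (cases "0 < t") (auto simp: mult_ac)
    qed
    also have "\<dots> \<le> ennreal b * haar_integral (\<lambda>t. ?I t)"
      using b by (rule nn_integral_cmult_le)
    also have "\<dots> \<le> ennreal b * (ennreal (1 / e) * haar_integral F)"
      using haar_integral_tail_average[OF e, of F] by (intro mult_left_mono) auto
    also have "haar_integral F
       \<le> (\<integral>\<^sup>+v. ennreal a * (indicator {0<..} v * (ennreal (1 / v) * epow (Z v) s)) \<partial>lborel)"
    proof (rule nn_integral_mono)
      fix v :: real
      show "indicator {0<..} v * (ennreal (1 / v) * F v) \<le> ennreal a * (indicator {0<..} v * (ennreal (1 / v) * epow (Z v) s))"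
        using mult_left_mono[OF F2, of v "ennreal (1 / v)"] by (cases "0 < v") (auto simp: mult_ac)
    qed
    also have "\<dots> \<le> ennreal a * haar_integral (\<lambda>v. epow (Z v) s)"
      using a by (rule nn_integral_cmult_le)
    finally have "haar_integral (\<lambda>t. epow (SUP u\<in>{t..}. ennreal ((t / u) powr d) * Z u) s)
       \<le> ennreal c * haar_integral (\<lambda>v. epow (Z v) s)"
      unfolding cf by (simp only: mult.assoc) (simp add: mult_left_mono)
    then show "haar_norm r {0<..} (\<lambda>t. SUP u\<in>{t..}. ennreal ((t / u) powr d) * Z u) \<le> ennreal (c powr (1 / s)) * haar_norm r {0<..} Z"
      unfolding haar_norm_finite_integral[OF False] s_def[symmetric] using c s by (intro epow_cmult_root) auto
  qed (use c in simp)
qed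

section \<open>Slowly varying weights and the lattice norm\<close>

lemma le_ennreal_mult_trans:
  assumes "x \<le> ennreal c * y" "y \<le> ennreal d * z" "0 \<le> c"
  shows "x \<le> ennreal (c * d) * z"
proof -
  have "x \<le> ennreal c * (ennreal d * z)"
    using assms(1) mult_left_mono[OF assms(2), of "ennreal c"] by (auto intro: order_trans)
  then show ?thesis using assms(3) by (simp add: ennreal_mult' mult.assoc)
qed

lemma ratio_eq_divide:
  assumes "0 < y" "y \<le> x"
  shows "ratio x y = x / y"
proof -
  have "y / x \<le> 1" "1 \<le> x / y" using assms by auto
  then show ?thesis by (simp add: ratio_def)
qed

lemma haar_norm_indicator:
  assumes "0 < q"
  shows "haar_norm q T (\<lambda>u. f u * indicator S u) = haar_norm q (T \<inter> S) f"
proof (cases "q = top")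
  case True
  have "(u \<in> T \<longrightarrow> f u * indicator S u \<le> z) \<longleftrightarrow> (u \<in> T \<inter> S \<longrightarrow> f u \<le> z)" for u z
    by (auto simp: indicator_def)
  then show ?thesis unfolding haar_norm_infinity[OF True] by simp
next
  case False
  have "indicator T u * (ennreal (1 / u) * epow (f u * indicator S u) p)
      = indicator (T \<inter> S) u * (ennreal (1 / u) * epow (f u) p)" for u p
    by (auto simp: indicator_def)
  then show ?thesis unfolding haar_norm_finite[OF False] by simp
qed

text \<open>
  The exponent of growth is arbitrarily small, and it is fixed before the constant. Slow variation enters all
  later estimates through this bound.
\<close>
lemma SV_moderate:
  assumes b: "b \<in> SV" and e: "0 < e"
  obtains C where "0 < C" "moderate C e (\<lambda>x. ennreal (b x))"
    "\<And>s t. 0 < s \<Longrightarrow> 0 < t \<Longrightarrow> b s \<le> C * ratio s t powr e * b t"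
proof -
  have pos: "0 < b t" if "0 < t" for t using b that by (simp add: SV_def)
  obtain g where g: "mono_on {0<..} g" "equiv_pos (\<lambda>t. t powr e * b t) g"
    using b e by (auto simp: SV_def)
  obtain h where h: "antimono_on {0<..} h" "equiv_pos (\<lambda>t. t powr (- e) * b t) h"
    using b e by (auto simp: SV_def)
  obtain C where C: "0 < C" "\<And>t. 0 < t \<Longrightarrow> g t / C \<le> t powr e * b t \<and> t powr e * b t \<le> C * g t"
    using g(2) unfolding equiv_pos_def by auto
  obtain E where E: "0 < E" "\<And>t. 0 < t \<Longrightarrow> h t / E \<le> t powr (- e) * b t \<and> t powr (- e) * b t \<le> E * h t"
    using h(2) unfolding equiv_pos_def by auto
  have up: "b s \<le> C^2 * (t / s) powr e * b t" if st: "0 < s" "s \<le> t" for s t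
  proof -
    have t: "0 < t" using st by simp
    have "s powr e * b s \<le> C * g s" using C(2)[OF st(1)] by simp
    also have "\<dots> \<le> C * g t" using g(1) st C(1) by (auto simp: mono_on_def)
    also have "\<dots> \<le> C * (C * (t powr e * b t))"
      using C(2)[OF t] C(1) by (intro mult_left_mono) (auto simp: divide_simps mult_ac)
    finally have "b s \<le> C * (C * (t powr e * b t)) / s powr e"
      using st by (simp add: le_divide_eq mult.commute)
    also have "\<dots> = C^2 * (t / s) powr e * b t" by (simp add: powr_divide power2_eq_square)
    finally show ?thesis .
  qed
  have down: "b s \<le> E^2 * (s / t) powr e * b t" if st: "0 < t" "t \<le> s" for s t
  proof -
    have s: "0 < s" using st by simp
    have "s powr (- e) * b s \<le> E * h s" using E(2)[OF s] by simp
    also have "\<dots> \<le> E * h t" using h(1) st E(1) by (auto simp: monotone_on_def)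
    also have "\<dots> \<le> E * (E * (t powr (- e) * b t))"
      using E(2)[OF st(1)] E(1) by (intro mult_left_mono) (auto simp: divide_simps mult_ac)
    finally have "b s \<le> E * (E * (t powr (- e) * b t)) / s powr (- e)"
      using s by (simp add: le_divide_eq mult.commute)
    also have "\<dots> = E^2 * (s / t) powr e * b t"
      using s st by (simp add: powr_divide power2_eq_square powr_minus divide_simps)
    finally show ?thesis .
  qed
  define D where "D = max (C^2) (E^2)"
  have D: "0 < D" using C by (simp add: D_def less_max_iff_disj)
  have main: "b s \<le> D * ratio s t powr e * b t" if st: "0 < s" "0 < t" for s t
  proof (cases "s \<le> t")
    case True
    have "b s \<le> C^2 * (t / s) powr e * b t" using up True st by simp
    also have "\<dots> \<le> D * ratio s t powr e * b t"
      using st pos[OF st(2)] e D by (intro mult_mono powr_mono2) (auto simp: D_def ratio_def)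
    finally show ?thesis .
  next
    case False
    have "b s \<le> E^2 * (s / t) powr e * b t" using down False st by simp
    also have "\<dots> \<le> D * ratio s t powr e * b t"
      using st pos[OF st(2)] e D by (intro mult_mono powr_mono2) (auto simp: D_def ratio_def)
    finally show ?thesis .
  qed
  have "moderate D e (\<lambda>x. ennreal (b x))"
    unfolding moderate_def
  proof (intro allI impI)
    fix x y :: real assume xy: "0 < x" "0 < y"
    show "ennreal (b x) \<le> ennreal (D * ratio x y powr e) * ennreal (b y)"
      using main[OF xy] pos xy D by (subst ennreal_mult[symmetric]) (auto intro!: ennreal_leI simp: less_imp_le)
  qed
  with D main show thesis by (intro that)
qed

lemma SV_le_haar_norm:
  assumes b: "b \<in> SV" and q: "0 < q"
  obtains C where "0 < C"
    "\<And>t. 0 < t \<Longrightarrow> ennreal (b t) \<le> ennreal C * haar_norm q {0<..<t} (\<lambda>u. ennreal (b u))"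
    "\<And>t. 0 < t \<Longrightarrow> ennreal (b t) \<le> ennreal C * haar_norm q {t<..} (\<lambda>u. ennreal (b u))"
proof -
  obtain k where k: "0 < k"
    "\<And>t S f z. 0 < t \<Longrightarrow> {t<..<2 * t} \<subseteq> S \<Longrightarrow> (\<And>u. t < u \<Longrightarrow> u < 2 * t \<Longrightarrow> z \<le> f u)
       \<Longrightarrow> ennreal k * z \<le> haar_norm q S f"
    using haar_norm_lower_bound[OF q] by blast
  obtain D where D: "0 < D" "moderate D 1 (\<lambda>x. ennreal (b x))"
    by (rule SV_moderate[OF b zero_less_one]) (rule that)
  have *: "ennreal (b t) \<le> ennreal (D * 2 / k) * haar_norm q S (\<lambda>u. ennreal (b u))"
    if t: "0 < t" and s: "0 < s" "s \<le> t" "t \<le> 2 * s" and S: "{s<..<2 * s} \<subseteq> S" for s t S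
  proof -
    have "ennreal k * (ennreal (1 / (D * 2)) * ennreal (b t)) \<le> haar_norm q S (\<lambda>u. ennreal (b u))"
    proof (rule k(2)[OF s(1) S])
      fix u assume u: "s < u" "u < 2 * s"
      have "ennreal (b t) \<le> ennreal (D * 2 powr 1) * ennreal (b u)"
        using u s t D by (intro moderateD[OF D(2)]) (auto simp: ratio_le_iff)
      then have "ennreal (1 / (D * 2)) * ennreal (b t) \<le> ennreal (1 / (D * 2)) * (ennreal (D * 2) * ennreal (b u))"
        by (intro mult_left_mono) auto
      then show "ennreal (1 / (D * 2)) * ennreal (b t) \<le> ennreal (b u)"
        using D by (simp add: ennreal_cancel)
    qed
    then have "ennreal (D * 2 / k) * (ennreal k * (ennreal (1 / (D * 2)) * ennreal (b t))) \<le> ennreal (D * 2 / k) * haar_norm q S (\<lambda>u. ennreal (b u))"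
      by (intro mult_left_mono) auto
    moreover have "ennreal (D * 2 / k) * (ennreal k * ennreal (1 / (D * 2))) = 1"
      using k(1) D(1) by (simp add: ennreal_mult[symmetric])
    then have "ennreal (D * 2 / k) * (ennreal k * (ennreal (1 / (D * 2)) * ennreal (b t))) = ennreal (b t)"
      by (simp only: mult.assoc[symmetric]) simp
    ultimately show ?thesis by simp
  qed
  show thesis
  proof (rule that[of "D * 2 / k"])
    fix t :: real assume "0 < t"
    then show "ennreal (b t) \<le> ennreal (D * 2 / k) * haar_norm q {0<..<t} (\<lambda>u. ennreal (b u))"
      by (intro *[of t "t / 2"]) auto
  next
    fix t :: real assume "0 < t"
    then show "ennreal (b t) \<le> ennreal (D * 2 / k) * haar_norm q {t<..} (\<lambda>u. ennreal (b u))"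
      by (intro *[of t t]) auto
  qed (use D k in simp)
qed

lemma SV_pos: "b \<in> SV \<Longrightarrow> 0 < t \<Longrightarrow> 0 < b t"
  by (simp add: SV_def)

lemma SV_measurable: "b \<in> SV \<Longrightarrow> (\<lambda>x. ennreal (b x)) \<in> borel_measurable (lebesgue_on {0<..})"
  unfolding SV_def by (intro measurable_compose[OF _ measurable_ennreal]) simp

lemma indicator_measurable_Ioi:
  "(indicator {..<t} :: real \<Rightarrow> ennreal) \<in> borel_measurable (lebesgue_on {0<..})"
  "(indicator {t..} :: real \<Rightarrow> ennreal) \<in> borel_measurable (lebesgue_on {0<..})"
  "(indicator {t<..} :: real \<Rightarrow> ennreal) \<in> borel_measurable (lebesgue_on {0<..})"
proof -
  have "(indicator S :: real \<Rightarrow> ennreal) \<in> borel_measurable (lebesgue_on {0<..})" if "S \<in> sets borel" for S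
    using that by (intro measurable_restrict_space1 borel_measurable_indicator) simp
  then show "(indicator {..<t} :: real \<Rightarrow> ennreal) \<in> borel_measurable (lebesgue_on {0<..})"
    "(indicator {t..} :: real \<Rightarrow> ennreal) \<in> borel_measurable (lebesgue_on {0<..})"
    "(indicator {t<..} :: real \<Rightarrow> ennreal) \<in> borel_measurable (lebesgue_on {0<..})"
    by simp_all
qed

text \<open>
  The parameters of the space \<open>AL\<close>, with the two finiteness conditions that make \<open>\<chi>\<^sub>1\<close> finite.
\<close>
locale L_lattice =
  fixes q r :: ennreal and a b :: "real \<Rightarrow> real"
  assumes q: "0 < q" and r: "0 < r" and a: "a \<in> SV" and b: "b \<in> SV"
    and b_tail: "haar_norm r {1<..} (\<lambda>s. ennreal (b s)) < top"
    and b_head: "haar_norm r {0<..<1} (\<lambda>s. ennreal (b s) * haar_norm q {0<..<s} (\<lambda>u. ennreal (a u))) < top"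
begin

definition Phi :: "real \<Rightarrow> ennreal" where
  "Phi t = haar_norm q {0<..<t} (\<lambda>u. ennreal (a u))"

definition tail :: "real \<Rightarrow> ennreal" where
  "tail t = haar_norm r {t<..} (\<lambda>s. ennreal (b s))"

text \<open>
  The lattice quasi-norm that defines \<open>AL\<close>, as a functional of \<open>F(u) = K(u, f) / u\<close>. Dividing by \<open>u\<close>
  is convenient because \<open>K(u, f) / u\<close> is decreasing.
\<close>
definition Lambda :: "(real \<Rightarrow> ennreal) \<Rightarrow> ennreal" where
  "Lambda F = haar_norm r {0<..} (\<lambda>s. ennreal (b s) * haar_norm q {0<..<s} (\<lambda>u. ennreal (a u) * F u))"

text \<open>
  A model of \<open>\<chi>\<^sub>1\<close> as a single norm. Its monotonicity is obvious, which is not so for the defining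
  sum of \<open>\<chi>\<^sub>1\<close>.
\<close>
definition cutoff :: "real \<Rightarrow> ennreal" where
  "cutoff t = Lambda (indicator {..<t})"

lemmas a_meas [measurable] = SV_measurable[OF a]
lemmas b_meas [measurable] = SV_measurable[OF b]

lemma Phi_mono: "s \<le> t \<Longrightarrow> Phi s \<le> Phi t"
  unfolding Phi_def using q by (intro haar_norm_mono) auto

lemma a_le_Phi: obtains C where "0 < C" "\<And>t. 0 < t \<Longrightarrow> ennreal (a t) \<le> ennreal C * Phi t"
  using SV_le_haar_norm[OF a q] unfolding Phi_def by metis

lemma b_le_tail: obtains C where "0 < C" "\<And>t. 0 < t \<Longrightarrow> ennreal (b t) \<le> ennreal C * tail t"
  using SV_le_haar_norm[OF b r] unfolding tail_def by metis

text \<open>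
  Between \<open>s\<close> and \<open>t\<close> slow variation bounds \<open>a(u)\<close> by \<open>a(s) (u/s)\<^bsup>1/2\<^esup>\<close>, whose norm over \<open>(0, t)\<close> is
  a multiple of \<open>a(s) (t/s)\<^bsup>1/2\<^esup>\<close>; and \<open>a(s)\<close> is at most a multiple of \<open>Phi s\<close>.
\<close>
lemma Phi_growth:
  obtains C where "0 < C" "\<And>s t. 0 < s \<Longrightarrow> s \<le> t \<Longrightarrow> Phi t \<le> ennreal (C * (t / s) powr (1/2)) * Phi s"
proof -
  obtain T where T: "0 < T" and tri: "\<And>S f g. S \<in> sets lebesgue \<Longrightarrow> S \<subseteq> {0<..} \<Longrightarrow>
      f \<in> borel_measurable (lebesgue_on {0<..}) \<Longrightarrow> g \<in> borel_measurable (lebesgue_on {0<..}) \<Longrightarrow>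
      haar_norm q S (\<lambda>u. f u + g u) \<le> ennreal T * (haar_norm q S f + haar_norm q S g)"
    using haar_norm_triangle[OF q] by blast
  obtain D where D: "0 < D" "\<And>s t. 0 < s \<Longrightarrow> 0 < t \<Longrightarrow> a s \<le> D * ratio s t powr (1/2) * a t"
    by (rule SV_moderate[OF a half_gt_zero[OF zero_less_one]]) (rule that)
  obtain P where P: "0 < P" "\<And>t. 0 < t \<Longrightarrow> haar_norm q {0<..<t} (\<lambda>u. ennreal (u powr (1/2))) \<le> ennreal (P * t powr (1/2))"
    by (rule haar_norm_powr[OF q half_gt_zero[OF zero_less_one]]) (rule that)
  obtain L where L: "0 < L" "\<And>t. 0 < t \<Longrightarrow> ennreal (a t) \<le> ennreal L * Phi t"
    by (rule a_le_Phi) (rule that)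
  show thesis
  proof (rule that[of "T * (1 + D * P * L)"])
    show "0 < T * (1 + D * P * L)" using T D P L by (simp add: add_pos_pos)
    fix s t :: real assume s: "0 < s" and st: "s \<le> t"
    then have t: "0 < t" by simp
    define \<mu> where "\<mu> = (t / s) powr (1/2)"
    have \<mu>: "1 \<le> \<mu>" unfolding \<mu>_def using s st by (intro ge_one_powr_ge_zero) auto
    have "Phi t = haar_norm q {0<..<t} (\<lambda>u. ennreal (a u) * indicator {..<s} u + ennreal (a u) * indicator {s..} u)"
      unfolding Phi_def by (intro haar_norm_cong[OF q]) (auto simp: indicator_def)
    also have "\<dots> \<le> ennreal T * (haar_norm q {0<..<t} (\<lambda>u. ennreal (a u) * indicator {..<s} u) + haar_norm q {0<..<t} (\<lambda>u. ennreal (a u) * indicator {s..} u))"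
      by (intro tri borel_measurable_times_ennreal a_meas indicator_measurable_Ioi) auto
    also have "haar_norm q {0<..<t} (\<lambda>u. ennreal (a u) * indicator {..<s} u) \<le> Phi s"
      unfolding haar_norm_indicator[OF q] Phi_def by (intro haar_norm_mono[OF q]) auto
    also have "Phi s \<le> ennreal \<mu> * Phi s"
      using mult_right_mono[of 1 "ennreal \<mu>" "Phi s"] \<mu> by simp
    also have "haar_norm q {0<..<t} (\<lambda>u. ennreal (a u) * indicator {s..} u) \<le> ennreal (D * P * L * \<mu>) * Phi s"
    proof -
      have "haar_norm q {0<..<t} (\<lambda>u. ennreal (a u) * indicator {s..} u)
         \<le> ennreal (D * s powr - (1/2) * a s) * haar_norm q {0<..<t} (\<lambda>u. ennreal (u powr (1/2)))"
        unfolding haar_norm_indicator[OF q]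
      proof (intro haar_norm_le_cmult[OF q] AE_I2 impI)
        show "0 < D * s powr - (1/2) * a s" using D s SV_pos[OF a s] by simp
        fix u assume u: "u \<in> {0<..<t} \<inter> {s..}"
        have "ratio u s = u / s" using u s by (intro ratio_eq_divide) auto
        then have "a u \<le> D * (u / s) powr (1/2) * a s" using D(2)[of u s] u s by simp
        also have "\<dots> = D * s powr - (1/2) * a s * u powr (1/2)"
          using s u by (simp add: powr_divide powr_minus divide_simps)
        finally have "a u \<le> D * s powr - (1/2) * a s * u powr (1/2)" .
        then show "u \<in> {0<..<t} \<and> ennreal (a u) \<le> ennreal (D * s powr - (1/2) * a s) * ennreal (u powr (1/2))"
          using u D s SV_pos[OF a s] by (subst ennreal_mult[symmetric]) (auto intro!: ennreal_leI)
      qed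
      also have "\<dots> \<le> ennreal (D * s powr - (1/2) * a s) * ennreal (P * t powr (1/2))"
        using P(2)[OF t] by (intro mult_left_mono) auto
      also have "\<dots> = ennreal (D * P * \<mu>) * ennreal (a s)"
      proof -
        have "D * s powr - (1/2) * a s * (P * t powr (1/2)) = D * P * \<mu> * a s"
          unfolding \<mu>_def using s t by (simp add: powr_divide powr_minus divide_simps)
        then show ?thesis
          using D P s SV_pos[OF a s] \<mu> by (simp add: ennreal_mult[symmetric])
      qed
      also have "\<dots> \<le> ennreal (D * P * \<mu> * L) * Phi s"
        using L(2)[OF s] D P \<mu> by (intro le_ennreal_mult_trans[OF order_refl]) auto
      finally show ?thesis by (simp add: mult_ac)
    qed
    finally have "Phi t \<le> ennreal T * (ennreal \<mu> * Phi s + ennreal (D * P * L * \<mu>) * Phi s)"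
      by (simp add: add_mono mult_left_mono)
    also have "\<dots> = ennreal (T * (1 + D * P * L) * \<mu>) * Phi s"
    proof -
      have "T * (1 + D * P * L) * \<mu> = T * (\<mu> + D * P * L * \<mu>)" by (simp add: algebra_simps)
      then show ?thesis using T D P L \<mu>
        by (simp add: ennreal_mult ennreal_plus distrib_right mult.assoc)
    qed
    finally show "Phi t \<le> ennreal (T * (1 + D * P * L) * (t / s) powr (1/2)) * Phi s" unfolding \<mu>_def .
  qed
qed

lemma Phi_pos: "0 < t \<Longrightarrow> 0 < Phi t"
proof -
  assume t: "0 < t"
  obtain L where L: "0 < L" "\<And>t. 0 < t \<Longrightarrow> ennreal (a t) \<le> ennreal L * Phi t"
    by (rule a_le_Phi) (rule that)
  have "0 < ennreal (a t)" using SV_pos[OF a t] by simp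
  then have "0 < ennreal L * Phi t" using L(2)[OF t] by (rule less_le_trans)
  then show ?thesis by (auto simp: ennreal_zero_less_mult_iff)
qed

text \<open>
  If \<open>Phi\<close> were infinite on \<open>(1/2, 1)\<close>, so would be the second norm in the assumptions of the locale. Finiteness
  at one point spreads to all others by the growth bound.
\<close>
lemma Phi_finite: "0 < t \<Longrightarrow> Phi t < top"
proof -
  assume t: "0 < t"
  have "\<exists>s\<in>{1/2<..<1}. Phi s < top"
  proof (rule ccontr)
    assume "\<not> ?thesis"
    then have inf: "Phi s = top" if "1/2 < s" "s < 1" for s
      using that by (auto simp: not_less top_unique)
    obtain k where k: "0 < k"
      "\<And>t S f z. 0 < t \<Longrightarrow> {t<..<2 * t} \<subseteq> S \<Longrightarrow> (\<And>u. t < u \<Longrightarrow> u < 2 * t \<Longrightarrow> z \<le> f u)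
         \<Longrightarrow> ennreal k * z \<le> haar_norm r S f"
      using haar_norm_lower_bound[OF r] by blast
    have "ennreal k * top \<le> haar_norm r {0<..<1} (\<lambda>s. ennreal (b s) * Phi s)"
    proof (rule k(2)[of "1/2"])
      fix u :: real assume u: "1/2 < u" "u < 2 * (1/2)"
      then have "0 < b u" using SV_pos[OF b, of u] by simp
      then show "top \<le> ennreal (b u) * Phi u" using inf u by (simp add: ennreal_mult_top)
    qed auto
    then show False using b_head k(1) unfolding Phi_def by (simp add: ennreal_mult_top top_unique)
  qed
  then obtain s where "s \<in> {1/2<..<1}" and "Phi s < top" by (rule bexE)
  then have s: "0 < s" "Phi s < top" by auto
  obtain C where C: "0 < C" "\<And>s t. 0 < s \<Longrightarrow> s \<le> t \<Longrightarrow> Phi t \<le> ennreal (C * (t / s) powr (1/2)) * Phi s"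
    by (rule Phi_growth) (rule that)
  show ?thesis
  proof (cases "s \<le> t")
    case True
    have "ennreal (C * (t / s) powr (1/2)) * Phi s < top" using s by (simp add: ennreal_mult_less_top)
    then show ?thesis using C(2)[OF s(1) True] by (rule le_less_trans[rotated])
  next
    case False
    then show ?thesis using Phi_mono[of t s] s by (auto intro: le_less_trans)
  qed
qed

lemma Phi_real: "0 < t \<Longrightarrow> ennreal (enn2real (Phi t)) = Phi t"
  using Phi_finite by (simp add: less_top)

lemma inner_mono:
  assumes "s \<le> t"
  shows "haar_norm q {0<..<s} f \<le> haar_norm q {0<..<t} f"
  using assms q by (intro haar_norm_mono) auto

lemma Lambda_mono_AE:
  assumes "AE u in lebesgue. 0 < u \<longrightarrow> F u \<le> G u"
  shows "Lambda F \<le> Lambda G"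
  unfolding Lambda_def
proof (intro haar_norm_mono[OF r] conjI mult_left_mono haar_norm_mono_AE[OF q])
  fix s :: real
  show "AE u in lebesgue. u \<in> {0<..<s} \<longrightarrow> u \<in> {0<..<s} \<and> ennreal (a u) * F u \<le> ennreal (a u) * G u"
    using assms by eventually_elim (auto intro: mult_left_mono)
qed auto

lemma Lambda_mono: "(\<And>u. 0 < u \<Longrightarrow> F u \<le> G u) \<Longrightarrow> Lambda F \<le> Lambda G"
  by (intro Lambda_mono_AE AE_I2) auto

lemma Lambda_cmult:
  assumes c: "0 \<le> c"
  shows "Lambda (\<lambda>u. ennreal c * F u) = ennreal c * Lambda F"
proof -
  have "haar_norm q {0<..<s} (\<lambda>u. ennreal (a u) * (ennreal c * F u)) = ennreal c * haar_norm q {0<..<s} (\<lambda>u. ennreal (a u) * F u)" for s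
    using haar_norm_cmult[OF q c, of "{0<..<s}" "\<lambda>u. ennreal (a u) * F u"] by (simp add: mult.left_commute)
  then show ?thesis
    unfolding Lambda_def using haar_norm_cmult[OF r c, of "{0<..}"] by (simp add: mult.left_commute)
qed

lemma Lambda_triangle:
  obtains C where "0 < C" "\<And>F G. F \<in> borel_measurable (lebesgue_on {0<..}) \<Longrightarrow> G \<in> borel_measurable (lebesgue_on {0<..}) \<Longrightarrow>
    Lambda (\<lambda>u. F u + G u) \<le> ennreal C * (Lambda F + Lambda G)"
proof -
  obtain T where T: "0 < T" and tri: "\<And>S f g. S \<in> sets lebesgue \<Longrightarrow> S \<subseteq> {0<..} \<Longrightarrow>
      f \<in> borel_measurable (lebesgue_on {0<..}) \<Longrightarrow> g \<in> borel_measurable (lebesgue_on {0<..}) \<Longrightarrow>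
      haar_norm q S (\<lambda>u. f u + g u) \<le> ennreal T * (haar_norm q S f + haar_norm q S g)"
    using haar_norm_triangle[OF q] by blast
  obtain U where U: "0 < U" and tri2: "\<And>S f g. S \<in> sets lebesgue \<Longrightarrow> S \<subseteq> {0<..} \<Longrightarrow>
      f \<in> borel_measurable (lebesgue_on {0<..}) \<Longrightarrow> g \<in> borel_measurable (lebesgue_on {0<..}) \<Longrightarrow>
      haar_norm r S (\<lambda>u. f u + g u) \<le> ennreal U * (haar_norm r S f + haar_norm r S g)"
    using haar_norm_triangle[OF r] by blast
  show thesis
  proof (rule that[of "T * U"])
    fix F G :: "real \<Rightarrow> ennreal"
    assume [measurable]: "F \<in> borel_measurable (lebesgue_on {0<..})" "G \<in> borel_measurable (lebesgue_on {0<..})"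
    let ?f = "\<lambda>F s. ennreal (b s) * haar_norm q {0<..<s} (\<lambda>u. ennreal (a u) * F u)"
    have [measurable]: "?f H \<in> borel_measurable (lebesgue_on {0<..})" for H
      by (intro borel_measurable_times_ennreal b_meas borel_measurable_increasing inner_mono)
    have "Lambda (\<lambda>u. F u + G u) \<le> ennreal T * haar_norm r {0<..} (\<lambda>s. ?f F s + ?f G s)"
      unfolding Lambda_def
    proof (intro haar_norm_le_cmult[OF r T] AE_I2 impI conjI)
      fix s :: real assume s: "s \<in> {0<..}"
      have "haar_norm q {0<..<s} (\<lambda>u. ennreal (a u) * F u + ennreal (a u) * G u)
          \<le> ennreal T * (haar_norm q {0<..<s} (\<lambda>u. ennreal (a u) * F u) + haar_norm q {0<..<s} (\<lambda>u. ennreal (a u) * G u))"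
        by (intro tri borel_measurable_times_ennreal a_meas) auto
      from mult_left_mono[OF this, of "ennreal (b s)"]
      show "?f (\<lambda>u. F u + G u) s \<le> ennreal T * (?f F s + ?f G s)"
        by (simp add: distrib_left mult.left_commute)
    qed
    also have "haar_norm r {0<..} (\<lambda>s. ?f F s + ?f G s) \<le> ennreal U * (Lambda F + Lambda G)"
      unfolding Lambda_def by (intro tri2) auto
    finally show "Lambda (\<lambda>u. F u + G u) \<le> ennreal (T * U) * (Lambda F + Lambda G)"
      using T U by (simp add: ennreal_mult mult.assoc mult_left_mono)
  qed (use T U in simp)
qed

lemma inner_indicator:
  "haar_norm q {0<..<s} (\<lambda>u. ennreal (a u) * indicator {..<t} u) = Phi (min s t)"
proof -
  have "{0<..<s} \<inter> {..<t} = {0<..<min s t}" by auto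
  then show ?thesis unfolding haar_norm_indicator[OF q] Phi_def by simp
qed

lemma cutoff_eq: "cutoff t = haar_norm r {0<..} (\<lambda>s. ennreal (b s) * Phi (min s t))"
  unfolding cutoff_def Lambda_def inner_indicator ..

lemma cutoff_mono: "s \<le> t \<Longrightarrow> cutoff s \<le> cutoff t"
  unfolding cutoff_eq using r by (intro haar_norm_mono conjI mult_left_mono Phi_mono) auto

lemma cutoff_growth:
  obtains C where "0 < C" "\<And>s t. 0 < s \<Longrightarrow> s \<le> t \<Longrightarrow> cutoff t \<le> ennreal (C * (t / s) powr (1/2)) * cutoff s"
proof -
  obtain C where C: "0 < C" "\<And>s t. 0 < s \<Longrightarrow> s \<le> t \<Longrightarrow> Phi t \<le> ennreal (C * (t / s) powr (1/2)) * Phi s"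
    by (rule Phi_growth) (rule that)
  define D where "D = max 1 C"
  have D: "1 \<le> D" "C \<le> D" by (auto simp: D_def)
  show thesis
  proof (rule that[of D])
    fix s t :: real assume s: "0 < s" and st: "s \<le> t"
    define \<mu> where "\<mu> = (t / s) powr (1/2)"
    have \<mu>: "1 \<le> \<mu>" unfolding \<mu>_def using s st by (intro ge_one_powr_ge_zero) auto
    have *: "1 \<le> ennreal (D * \<mu>)" using D \<mu> mult_mono[of 1 D 1 \<mu>] by simp
    have "Phi (min v t) \<le> ennreal (D * \<mu>) * Phi (min v s)" if v: "0 < v" for v
    proof (cases "v \<le> s")
      case True
      then have "min v t = min v s" using st by simp
      then show ?thesis using mult_right_mono[OF *, of "Phi (min v s)"] by simp
    next
      case False
      have "Phi (min v t) \<le> ennreal (C * (min v t / s) powr (1/2)) * Phi s"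
        using False s st by (intro C(2)) auto
      also have "\<dots> \<le> ennreal (D * \<mu>) * Phi s"
        unfolding \<mu>_def using False s st C D
        by (intro mult_right_mono ennreal_leI mult_mono powr_mono2) (auto simp: divide_right_mono)
      finally show ?thesis using False by simp
    qed
    then have "cutoff t \<le> ennreal (D * \<mu>) * cutoff s"
      unfolding cutoff_eq using D \<mu>
      by (intro haar_norm_le_cmult[OF r] AE_I2) (auto simp: mult.left_commute intro!: mult_left_mono)
    then show "cutoff t \<le> ennreal (D * (t / s) powr (1/2)) * cutoff s" by (simp add: \<mu>_def)
  qed (use D in simp)
qed

lemma tail_Phi_le_cutoff: "0 < t \<Longrightarrow> tail t * Phi t \<le> cutoff t"
proof -
  assume t: "0 < t"
  define c where "c = enn2real (Phi t)"
  have c: "0 \<le> c" "Phi t = ennreal c" using Phi_real[OF t] by (auto simp: c_def)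
  have "tail t * Phi t = haar_norm r {t<..} (\<lambda>s. ennreal c * ennreal (b s))"
    unfolding tail_def c(2) by (subst haar_norm_cmult[OF r c(1)]) (rule mult.commute)
  also have "\<dots> \<le> cutoff t"
    unfolding cutoff_eq using t c by (intro haar_norm_mono[OF r]) (auto simp: mult.commute min_def)
  finally show ?thesis .
qed

lemma cutoff_pos: "0 < t \<Longrightarrow> 0 < cutoff t"
proof -
  assume t: "0 < t"
  obtain L where L: "0 < L" "\<And>t. 0 < t \<Longrightarrow> ennreal (b t) \<le> ennreal L * tail t"
    by (rule b_le_tail) (rule that)
  have "0 < ennreal (b t)" using SV_pos[OF b t] by simp
  then have "0 < ennreal L * tail t" using L(2)[OF t] by (rule less_le_trans)
  then have "0 < tail t * Phi t" using Phi_pos[OF t] by (auto simp: ennreal_zero_less_mult_iff)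
  then show ?thesis using tail_Phi_le_cutoff[OF t] by (rule less_le_trans)
qed

text \<open>
  The extended value that \<open>chi\<close> converts to a real number.
\<close>
definition chi_ext :: "real \<Rightarrow> ennreal" where
  "chi_ext t = haar_norm r {0<..<t} (\<lambda>s. ennreal (b s) * Phi s) + tail t * Phi t"

lemma chi_eq: "0 < t \<Longrightarrow> chi r b q a t = enn2real (chi_ext t)"
proof -
  assume t: "0 < t"
  have P: "wnorm 0 q {0<..<s} a (\<lambda>_. 1) = Phi s" for s
    unfolding Phi_def by (subst wnorm_eq_haar_norm) (auto simp: q intro!: haar_norm_cong)
  have T: "wnorm 0 r {t<..} b (\<lambda>_. 1) = tail t"
    unfolding tail_def using t by (subst wnorm_eq_haar_norm) (auto simp: r intro!: haar_norm_cong)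
  have "wnorm 0 r {0<..<t} b Phi = haar_norm r {0<..<t} (\<lambda>s. ennreal (b s) * Phi s)"
    by (subst wnorm_eq_haar_norm) (auto simp: r intro!: haar_norm_cong)
  then show ?thesis unfolding chi_def chi_ext_def P T by (simp add: P)
qed

lemma chi_ext_le_cutoff: "0 < t \<Longrightarrow> chi_ext t \<le> ennreal 2 * cutoff t"
proof -
  assume t: "0 < t"
  have "haar_norm r {0<..<t} (\<lambda>s. ennreal (b s) * Phi s) \<le> cutoff t"
    unfolding cutoff_eq by (intro haar_norm_mono[OF r]) (auto simp: min_def)
  then show ?thesis unfolding chi_ext_def using add_mono[OF _ tail_Phi_le_cutoff[OF t]] by (simp add: mult_2)
qed

text \<open>
  The two summands of \<open>\<chi>\<^sub>1\<close> are the parts of the norm \<open>cutoff\<close> over \<open>s < t\<close> and \<open>s > t\<close>.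
\<close>
lemma cutoff_le_chi_ext: obtains C where "0 < C" "\<And>t. 0 < t \<Longrightarrow> cutoff t \<le> ennreal C * chi_ext t"
proof -
  obtain U where U: "0 < U" and tri: "\<And>S f g. S \<in> sets lebesgue \<Longrightarrow> S \<subseteq> {0<..} \<Longrightarrow>
      f \<in> borel_measurable (lebesgue_on {0<..}) \<Longrightarrow> g \<in> borel_measurable (lebesgue_on {0<..}) \<Longrightarrow>
      haar_norm r S (\<lambda>u. f u + g u) \<le> ennreal U * (haar_norm r S f + haar_norm r S g)"
    using haar_norm_triangle[OF r] by blast
  show thesis
  proof (rule that[OF U])
    fix t :: real assume t: "0 < t"
    define c where "c = enn2real (Phi t)"
    have c: "0 \<le> c" "Phi t = ennreal c" using Phi_real[OF t] by (auto simp: c_def)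
    have m: "(\<lambda>s. ennreal (b s) * Phi (min s t)) \<in> borel_measurable (lebesgue_on {0<..})"
      by (intro borel_measurable_times_ennreal b_meas borel_measurable_increasing Phi_mono) auto
    have "cutoff t = haar_norm r {0<..} (\<lambda>s. ennreal (b s) * Phi (min s t) * indicator {..<t} s + ennreal (b s) * Phi (min s t) * indicator {t..} s)"
      unfolding cutoff_eq by (intro haar_norm_cong[OF r]) (auto simp: indicator_def)
    also have "\<dots> \<le> ennreal U * (haar_norm r {0<..} (\<lambda>s. ennreal (b s) * Phi (min s t) * indicator {..<t} s)
         + haar_norm r {0<..} (\<lambda>s. ennreal (b s) * Phi (min s t) * indicator {t..} s))"
      using m by (intro tri borel_measurable_times_ennreal[OF _ indicator_measurable_Ioi(1)] borel_measurable_times_ennreal[OF _ indicator_measurable_Ioi(2)]) auto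
    also have "haar_norm r {0<..} (\<lambda>s. ennreal (b s) * Phi (min s t) * indicator {..<t} s) \<le> haar_norm r {0<..<t} (\<lambda>s. ennreal (b s) * Phi s)"
      unfolding haar_norm_indicator[OF r] by (intro haar_norm_mono[OF r]) auto
    also have "haar_norm r {0<..} (\<lambda>s. ennreal (b s) * Phi (min s t) * indicator {t..} s) \<le> haar_norm r {t<..} (\<lambda>s. ennreal c * ennreal (b s))"
      unfolding haar_norm_indicator[OF r]
    proof (rule haar_norm_mono_AE[OF r])
      have "AE s in lebesgue. s \<noteq> t" by (intro AE_completion AE_lborel_singleton)
      then show "AE s in lebesgue. s \<in> {0<..} \<inter> {t..} \<longrightarrow> s \<in> {t<..} \<and> ennreal (b s) * Phi (min s t) \<le> ennreal c * ennreal (b s)"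
        by eventually_elim (auto simp: c(2) mult.commute)
    qed
    also have "haar_norm r {t<..} (\<lambda>s. ennreal c * ennreal (b s)) = tail t * Phi t"
      unfolding tail_def c(2) by (subst haar_norm_cmult[OF r c(1)]) (rule mult.commute)
    finally show "cutoff t \<le> ennreal U * chi_ext t" unfolding chi_ext_def by (simp add: add_mono mult_left_mono)
  qed
qed

lemma cutoff_finite: "0 < t \<Longrightarrow> cutoff t < top"
proof -
  assume t: "0 < t"
  obtain U where U: "0 < U" "\<And>t. 0 < t \<Longrightarrow> cutoff t \<le> ennreal U * chi_ext t" by (rule cutoff_le_chi_ext) (rule that)
  have "chi_ext 1 < top"
    using b_head b_tail Phi_finite[of 1] unfolding chi_ext_def tail_def Phi_def by (simp add: ennreal_mult_less_top)
  then have cut1: "cutoff 1 < top"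
    using U(2)[of 1] by (auto simp: ennreal_mult_less_top intro: le_less_trans)
  obtain C where C: "0 < C" "\<And>s t. 0 < s \<Longrightarrow> s \<le> t \<Longrightarrow> cutoff t \<le> ennreal (C * (t / s) powr (1/2)) * cutoff s"
    by (rule cutoff_growth) (rule that)
  show ?thesis
  proof (cases "1 \<le> t")
    case True
    then show ?thesis using C(2)[of 1 t] cut1 by (auto simp: ennreal_mult_less_top intro: le_less_trans)
  next
    case False
    then show ?thesis using cutoff_mono[of t 1] cut1 by (auto intro: le_less_trans)
  qed
qed

lemma chi_equiv:
  obtains C where "0 < C" "\<And>t. 0 < t \<Longrightarrow> ennreal (chi r b q a t) \<le> ennreal C * cutoff t"
    "\<And>t. 0 < t \<Longrightarrow> cutoff t \<le> ennreal C * ennreal (chi r b q a t)"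
proof -
  obtain U where U: "0 < U" "\<And>t. 0 < t \<Longrightarrow> cutoff t \<le> ennreal U * chi_ext t" by (rule cutoff_le_chi_ext) (rule that)
  have chi_ext: "ennreal (chi r b q a t) = chi_ext t" if "0 < t" for t
  proof -
    have "chi_ext t < top" using chi_ext_le_cutoff[OF that] cutoff_finite[OF that] by (auto simp: ennreal_mult_less_top intro: le_less_trans)
    then show ?thesis using chi_eq[OF that] by (simp add: less_top)
  qed
  show thesis
  proof (rule that[of "2 + U"])
    fix t :: real assume t: "0 < t"
    have "chi_ext t \<le> ennreal (2 + U) * cutoff t"
      using chi_ext_le_cutoff[OF t] by (rule order_trans) (use U in \<open>auto intro!: mult_right_mono ennreal_leI simp del: ennreal_numeral\<close>)
    then show "ennreal (chi r b q a t) \<le> ennreal (2 + U) * cutoff t" using chi_ext[OF t] by simp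
    have "cutoff t \<le> ennreal (2 + U) * chi_ext t"
      using U(2)[OF t] by (rule order_trans) (use U in \<open>auto intro!: mult_right_mono ennreal_leI\<close>)
    then show "cutoff t \<le> ennreal (2 + U) * ennreal (chi r b q a t)" using chi_ext[OF t] by simp
  qed (use U in simp)
qed

lemma chi_pos: "0 < t \<Longrightarrow> 0 < chi r b q a t"
proof -
  assume t: "0 < t"
  obtain C where C: "0 < C" "\<And>t. 0 < t \<Longrightarrow> cutoff t \<le> ennreal C * ennreal (chi r b q a t)"
    by (rule chi_equiv) (rule that)
  have "0 < ennreal C * ennreal (chi r b q a t)" using cutoff_pos[OF t] C(2)[OF t] by (rule less_le_trans)
  then show ?thesis by (simp add: ennreal_zero_less_mult_iff)
qed

lemma almost_power_rho: obtains A where "1 \<le> A" "almost_power A (rho r b q a)"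
proof -
  let ?c = "chi r b q a"
  obtain C where C: "0 < C" "\<And>t. 0 < t \<Longrightarrow> ennreal (?c t) \<le> ennreal C * cutoff t"
    "\<And>t. 0 < t \<Longrightarrow> cutoff t \<le> ennreal C * ennreal (?c t)"
    by (rule chi_equiv) (rule that)
  obtain B where B: "0 < B" "\<And>s t. 0 < s \<Longrightarrow> s \<le> t \<Longrightarrow> cutoff t \<le> ennreal (B * (t / s) powr (1/2)) * cutoff s"
    by (rule cutoff_growth) (rule that)
  have up: "?c s \<le> C * C * ?c t" if s: "0 < s" "s \<le> t" for s t
  proof -
    have "ennreal (?c s) \<le> ennreal C * cutoff t"
      using C(2)[OF s(1)] mult_left_mono[OF cutoff_mono[OF s(2)], of "ennreal C"] by (auto intro: order_trans)
    from le_ennreal_mult_trans[OF this C(3)] have "ennreal (?c s) \<le> ennreal (C * C) * ennreal (?c t)"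
      using C(1) s by auto
    then show ?thesis using s C(1) chi_pos[of t]
      by (simp add: ennreal_mult'[symmetric] ennreal_le_iff)
  qed
  have down: "?c t \<le> C * B * C * (t / s) powr (1/2) * ?c s" if s: "0 < s" "s \<le> t" for s t
  proof -
    have "ennreal (?c t) \<le> ennreal (C * (B * (t / s) powr (1/2))) * cutoff s"
      using C(1) s by (intro le_ennreal_mult_trans[OF C(2) B(2)]) auto
    from le_ennreal_mult_trans[OF this C(3)] have "ennreal (?c t) \<le> ennreal (C * (B * (t / s) powr (1/2)) * C) * ennreal (?c s)"
      using C(1) B(1) s by auto
    also have "C * (B * (t / s) powr (1/2)) * C = C * B * C * (t / s) powr (1/2)" by simp
    finally show ?thesis using s C(1) B(1) chi_pos[of s]
      by (simp add: ennreal_mult'[symmetric] ennreal_le_iff)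
  qed
  define A where "A = max 1 (max (C * C) (C * B * C))"
  have A: "1 \<le> A" "C * C \<le> A" "C * B * C \<le> A" by (auto simp: A_def)
  have "almost_power A (rho r b q a)"
    unfolding almost_power_def
  proof (intro conjI allI impI)
    fix t :: real assume "0 < t" then show "0 < rho r b q a t" by (simp add: rho_def chi_pos)
  next
    fix s t :: real assume s: "0 < s" "s \<le> t"
    then have t: "0 < t" by simp
    note p = chi_pos[OF s(1)] chi_pos[OF t]
    have "?c s \<le> A * ?c t" using up[OF s] mult_right_mono[OF A(2), of "?c t"] p by linarith
    then show "rho r b q a t \<le> A * (t / s) * rho r b q a s"
      using p s t by (simp add: rho_def divide_simps mult_ac)
    have "C * B * C * (t / s) powr (1/2) * ?c s \<le> A * (t / s) powr (1/2) * ?c s"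
      using A(3) p by (intro mult_right_mono) auto
    then have d: "?c t \<le> A * (t / s) powr (1/2) * ?c s" using down[OF s] by linarith
    have sq: "(t / s) powr (1/2) * (t / s) powr (1/2) = t / s" using s t by (simp flip: powr_add)
    have "(t / s) powr (1/2) * ?c t \<le> (t / s) powr (1/2) * (A * (t / s) powr (1/2) * ?c s)"
      using d by (intro mult_left_mono) auto
    also have "\<dots> = A * ((t / s) powr (1/2) * (t / s) powr (1/2)) * ?c s" by simp
    finally have "(t / s) powr (1/2) * ?c t \<le> A * (t / s) * ?c s" unfolding sq .
    then have "s * ((t / s) powr (1/2) * ?c t) \<le> A * t * ?c s"
      using s mult_left_mono[of "(t / s) powr (1/2) * ?c t" "A * (t / s) * ?c s" s] by simp
    then show "(t / s) powr (1/2) * rho r b q a s \<le> A * rho r b q a t"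
      using p s t by (simp add: rho_def pos_le_divide_eq pos_divide_le_eq mult_ac)
  qed
  with A(1) show thesis by (rule that)
qed

text \<open>
  Above \<open>t\<close> the factor \<open>u\<^bsup>-d\<^esup>\<close> beats the slowly varying \<open>a\<close>, so the inner norm is at most a multiple of
  \<open>t\<^bsup>-d\<^esup> a(t)\<close>, hence of \<open>t\<^bsup>-d\<^esup> Phi t\<close>, for every \<open>s\<close>; the outer norm then contributes the factor
  \<open>tail t\<close>, and \<open>tail t * Phi t\<close> is one of the two summands of \<open>\<chi>\<^sub>1(t)\<close>.
\<close>
lemma Lambda_tail_power:
  assumes d: "0 < d"
  obtains C where "0 < C"
    "\<And>t. 0 < t \<Longrightarrow> Lambda (\<lambda>u. ennreal (u powr - d) * indicator {t<..} u) \<le> ennreal (C * t powr - d) * cutoff t"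
proof -
  obtain D where D: "0 < D" "\<And>s t. 0 < s \<Longrightarrow> 0 < t \<Longrightarrow> a s \<le> D * ratio s t powr (d/2) * a t"
    by (rule SV_moderate[OF a half_gt_zero[OF d]]) (rule that)
  obtain P where P: "0 < P" "\<And>t. 0 < t \<Longrightarrow> haar_norm q {t<..} (\<lambda>u. ennreal (u powr - (d/2))) \<le> ennreal (P * t powr - (d/2))"
    by (rule haar_norm_powr[OF q half_gt_zero[OF d]]) (rule that)
  obtain L where L: "0 < L" "\<And>t. 0 < t \<Longrightarrow> ennreal (a t) \<le> ennreal L * Phi t"
    by (rule a_le_Phi) (rule that)
  show thesis
  proof (rule that[of "D * P * L"])
    fix t :: real assume t: "0 < t"
    note at = SV_pos[OF a t]
    have inner: "haar_norm q {t<..} (\<lambda>u. ennreal (a u) * ennreal (u powr - d)) \<le> ennreal (D * P * L * t powr - d) * Phi t"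
    proof -
      have "haar_norm q {t<..} (\<lambda>u. ennreal (a u) * ennreal (u powr - d))
         \<le> ennreal (D * t powr - (d/2) * a t) * haar_norm q {t<..} (\<lambda>u. ennreal (u powr - (d/2)))"
      proof (intro haar_norm_le_cmult[OF q] AE_I2 impI conjI)
        show "0 < D * t powr - (d/2) * a t" using D t at by simp
        fix u assume u: "u \<in> {t<..}"
        then have u0: "0 < u" using t by simp
        have "ratio u t = u / t" using u t by (intro ratio_eq_divide) auto
        then have "a u \<le> D * (u / t) powr (d/2) * a t" using D(2)[OF u0 t] by simp
        then have "a u * u powr - d \<le> D * (u / t) powr (d/2) * a t * u powr - d" by (rule mult_right_mono) simp
        also have "\<dots> = D * a t * ((u / t) powr (d/2) * u powr - d)" by simp
        also have "(u / t) powr (d/2) * u powr - d = t powr - (d/2) * u powr - (d/2)"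
        proof -
          have "u powr (d/2) * u powr - d = u powr (d/2 + - d)" by (rule powr_add[symmetric])
          also have "d/2 + - d = - (d/2)" by simp
          finally show ?thesis by (simp add: powr_divide powr_minus_divide[of t])
        qed
        finally have "a u * u powr - d \<le> D * t powr - (d/2) * a t * u powr - (d/2)" by (simp add: mult_ac)
        then show "ennreal (a u) * ennreal (u powr - d) \<le> ennreal (D * t powr - (d/2) * a t) * ennreal (u powr - (d/2))"
          using D at by (simp add: ennreal_mult''[symmetric] ennreal_leI)
      qed
      also have "\<dots> \<le> ennreal (D * t powr - (d/2) * a t) * ennreal (P * t powr - (d/2))"
        using P(2)[OF t] by (intro mult_left_mono) auto
      also have "\<dots> = ennreal (D * P * t powr - d) * ennreal (a t)"
      proof -
        have "t powr - (d/2) * t powr - (d/2) = t powr - d" by (simp flip: powr_add)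
        moreover have "D * x * a t * (P * x) = D * P * (x * x) * a t" for x by simp
        ultimately have "D * t powr - (d/2) * a t * (P * t powr - (d/2)) = D * P * t powr - d * a t"
          by simp
        then show ?thesis using D P at by (simp add: ennreal_mult[symmetric])
      qed
      also have "\<dots> \<le> ennreal (D * P * t powr - d * L) * Phi t"
        using L(2)[OF t] D P by (intro le_ennreal_mult_trans[OF order_refl]) auto
      finally show ?thesis by (simp add: mult_ac)
    qed
    define c where "c = enn2real (Phi t)"
    have c: "0 \<le> c" "Phi t = ennreal c" using Phi_real[OF t] by (auto simp: c_def)
    define m where "m = D * P * L * t powr - d * c"
    have m: "0 \<le> m" using D P L c by (simp add: m_def)
    have "Lambda (\<lambda>u. ennreal (u powr - d) * indicator {t<..} u) \<le> haar_norm r {0<..} (\<lambda>s. ennreal m * ennreal (b s) * indicator {t<..} s)"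
      unfolding Lambda_def
    proof (intro haar_norm_mono[OF r] conjI)
      fix s :: real assume s: "s \<in> {0<..}"
      have eq: "haar_norm q {0<..<s} (\<lambda>u. ennreal (a u) * (ennreal (u powr - d) * indicator {t<..} u))
        = haar_norm q ({0<..<s} \<inter> {t<..}) (\<lambda>u. ennreal (a u) * ennreal (u powr - d))"
        using haar_norm_indicator[OF q, of "{0<..<s}" "\<lambda>u. ennreal (a u) * ennreal (u powr - d)" "{t<..}"] by (simp add: mult.assoc)
      show "ennreal (b s) * haar_norm q {0<..<s} (\<lambda>u. ennreal (a u) * (ennreal (u powr - d) * indicator {t<..} u)) \<le> ennreal m * ennreal (b s) * indicator {t<..} s"
      proof (cases "t < s")
        case True
        have "haar_norm q ({0<..<s} \<inter> {t<..}) (\<lambda>u. ennreal (a u) * ennreal (u powr - d)) \<le> ennreal m"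
        proof -
          have "haar_norm q ({0<..<s} \<inter> {t<..}) (\<lambda>u. ennreal (a u) * ennreal (u powr - d)) \<le> haar_norm q {t<..} (\<lambda>u. ennreal (a u) * ennreal (u powr - d))"
            by (intro haar_norm_mono[OF q]) auto
          also note inner
          also have "ennreal (D * P * L * t powr - d) * Phi t = ennreal m"
            unfolding c(2) m_def using D P L c by (simp add: ennreal_mult)
          finally show ?thesis .
        qed
        from mult_left_mono[OF this, of "ennreal (b s)"] show ?thesis
          unfolding eq using True by (simp add: mult.commute[of "ennreal m"])
      next
        case False
        then have "{0<..<s} \<inter> {t<..} = {}" by auto
        moreover have "haar_norm q {} f = 0" for f :: "real \<Rightarrow> ennreal"
          by (simp add: haar_norm_def bot_ennreal)
        ultimately show ?thesis unfolding eq by simp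
      qed
    qed auto
    also have "\<dots> = ennreal m * tail t"
    proof -
      have "{0<..} \<inter> {t<..} = {t<..}" using t by auto
      then show ?thesis unfolding haar_norm_indicator[OF r] tail_def haar_norm_cmult[OF r m] by simp
    qed
    also have "\<dots> = ennreal (D * P * L * t powr - d) * (tail t * Phi t)"
      unfolding c(2) m_def using D P L c by (simp add: ennreal_mult mult_ac)
    also have "\<dots> \<le> ennreal (D * P * L * t powr - d) * cutoff t"
      using tail_Phi_le_cutoff[OF t] by (intro mult_left_mono) auto
    finally show "Lambda (\<lambda>u. ennreal (u powr - d) * indicator {t<..} u) \<le> ennreal (D * P * L * t powr - d) * cutoff t" .
  qed (use D P L in simp)
qed

end

section \<open>The K-functional and the Holmstedt formula\<close>

lemma quasi_norm_zero: "quasi_norm N \<Longrightarrow> N 0 = 0"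
  unfolding quasi_norm_def by blast

lemma quasi_norm_minus: "quasi_norm N \<Longrightarrow> N (- x) = N x"
proof -
  assume "quasi_norm N"
  then have "N ((-1) *\<^sub>R x) = ennreal \<bar>-1\<bar> * N x" unfolding quasi_norm_def by blast
  then show ?thesis by simp
qed

lemma quasi_norm_add:
  assumes "quasi_norm N"
  obtains C where "0 < C" "\<And>x y. N (x + y) \<le> ennreal C * (N x + N y)"
  using assms unfolding quasi_norm_def by blast

lemma carrier_add:
  assumes "quasi_norm N" "x \<in> carrier_of N" "y \<in> carrier_of N"
  shows "x + y \<in> carrier_of N"
proof -
  obtain C where C: "0 < C" "\<And>x y. N (x + y) \<le> ennreal C * (N x + N y)"
    using quasi_norm_add[OF assms(1)] by blast
  have "ennreal C * (N x + N y) < top" using assms by (simp add: carrier_of_def ennreal_mult_less_top)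
  then show ?thesis using C(2)[of x y] by (auto simp: carrier_of_def intro: le_less_trans)
qed

lemma sum_spaceI: "x \<in> carrier_of M \<Longrightarrow> y \<in> carrier_of N \<Longrightarrow> x + y \<in> sum_space M N"
  by (auto simp: sum_space_def)

lemma Kfun_le:
  assumes "f0 \<in> carrier_of N0" "f1 \<in> carrier_of N1"
  shows "Kfun N0 N1 t (f0 + f1) \<le> N0 f0 + ennreal t * N1 f1"
  unfolding Kfun_def using assms by (intro Inf_lower) auto

lemma Kfun_greatest:
  assumes "\<And>f0 f1. f = f0 + f1 \<Longrightarrow> f0 \<in> carrier_of N0 \<Longrightarrow> f1 \<in> carrier_of N1 \<Longrightarrow> x \<le> N0 f0 + ennreal t * N1 f1"
  shows "x \<le> Kfun N0 N1 t f"
  unfolding Kfun_def using assms by (intro Inf_greatest) auto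

text \<open>
  Passing to the infimum over decompositions inside an affine expression. Arguing with all decompositions instead of
  near-optimal ones avoids a separate treatment of \<open>K(t, f) = 0\<close>.
\<close>
lemma Kfun_greatest_affine:
  assumes C: "0 < C"
    and "\<And>f0 f1. f = f0 + f1 \<Longrightarrow> f0 \<in> carrier_of N0 \<Longrightarrow> f1 \<in> carrier_of N1 \<Longrightarrow>
      x \<le> ennreal C * (N0 f0 + ennreal t * N1 f1 + y)"
  shows "x \<le> ennreal C * (Kfun N0 N1 t f + y)"
proof -
  have "ennreal (1 / C) * x \<le> Kfun N0 N1 t f + Inf {y}"
    unfolding Kfun_def
  proof (rule le_Inf_add_Inf)
    fix k z assume "k \<in> {N0 f0 + ennreal t * N1 f1 | f0 f1. f = f0 + f1 \<and> f0 \<in> carrier_of N0 \<and> f1 \<in> carrier_of N1}" "z \<in> {y}"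
    then obtain f0 f1 where *: "k = N0 f0 + ennreal t * N1 f1" "f = f0 + f1" "f0 \<in> carrier_of N0" "f1 \<in> carrier_of N1" and z: "z = y"
      by blast
    have "ennreal (1 / C) * x \<le> ennreal (1 / C) * (ennreal C * (k + y))"
      using assms(2)[OF *(2-4)] * by (intro mult_left_mono) auto
    then show "ennreal (1 / C) * x \<le> k + z" using C z by (simp add: ennreal_cancel)
  qed
  then have "ennreal C * (ennreal (1 / C) * x) \<le> ennreal C * (Kfun N0 N1 t f + y)"
    by (intro mult_left_mono) auto
  then show ?thesis using C by (simp add: ennreal_cancel)
qed

lemma Kfun_outside: "f \<notin> sum_space N0 N1 \<Longrightarrow> Kfun N0 N1 t f = top"
  using Kfun_greatest[of f N0 N1 top t] by (auto simp: sum_space_def top_unique)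

lemma Kfun_finite: "f \<in> sum_space N0 N1 \<Longrightarrow> Kfun N0 N1 t f < top"
proof -
  assume "f \<in> sum_space N0 N1"
  then obtain f0 f1 where f: "f = f0 + f1" "f0 \<in> carrier_of N0" "f1 \<in> carrier_of N1"
    by (auto simp: sum_space_def)
  have "N0 f0 + ennreal t * N1 f1 < top"
    using f by (simp add: carrier_of_def ennreal_mult_less_top)
  then show ?thesis using Kfun_le[OF f(2,3), of t] f(1) by (auto intro: le_less_trans)
qed

lemma Kfun_mono:
  assumes "s \<le> t"
  shows "Kfun N0 N1 s f \<le> Kfun N0 N1 t f"
proof (rule Kfun_greatest)
  fix f0 f1 assume f: "f = f0 + f1" "f0 \<in> carrier_of N0" "f1 \<in> carrier_of N1"
  have "Kfun N0 N1 s f \<le> N0 f0 + ennreal s * N1 f1" using Kfun_le[OF f(2,3)] f(1) by simp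
  also have "\<dots> \<le> N0 f0 + ennreal t * N1 f1"
    using assms by (intro add_left_mono mult_right_mono ennreal_leI) auto
  finally show "Kfun N0 N1 s f \<le> N0 f0 + ennreal t * N1 f1" .
qed

lemma Kfun_quasiconcave:
  assumes s: "0 < s" "s \<le> t"
  shows "Kfun N0 N1 t f \<le> ennreal (t / s) * Kfun N0 N1 s f"
proof -
  have c: "0 < t / s" using s by simp
  have "Kfun N0 N1 t f \<le> ennreal (t / s) * (Kfun N0 N1 s f + 0)"
  proof (rule Kfun_greatest_affine[OF c])
    fix f0 f1 assume f: "f = f0 + f1" "f0 \<in> carrier_of N0" "f1 \<in> carrier_of N1"
    have "Kfun N0 N1 t f \<le> 1 * N0 f0 + ennreal t * N1 f1" using Kfun_le[OF f(2,3)] f(1) by simp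
    also have "\<dots> \<le> ennreal (t / s) * N0 f0 + ennreal t * N1 f1"
      using s by (intro add_right_mono mult_right_mono) auto
    also have "\<dots> = ennreal (t / s) * (N0 f0 + ennreal s * N1 f1 + 0)"
      using s by (simp add: distrib_left mult.assoc[symmetric] ennreal_mult'[symmetric])
    finally show "Kfun N0 N1 t f \<le> ennreal (t / s) * (N0 f0 + ennreal s * N1 f1 + 0)" .
  qed
  then show ?thesis by simp
qed

lemma Kfun_moderate: "moderate 1 1 (\<lambda>t. Kfun N0 N1 t f)"
  unfolding moderate_def
proof (intro allI impI)
  fix x y :: real assume xy: "0 < x" "0 < y"
  show "Kfun N0 N1 x f \<le> ennreal (1 * ratio x y powr 1) * Kfun N0 N1 y f"
  proof (cases "x \<le> y")
    case True
    have "Kfun N0 N1 x f \<le> 1 * Kfun N0 N1 y f" using Kfun_mono[OF True, of N0 N1 f] by simp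
    also have "\<dots> \<le> ennreal (1 * ratio x y powr 1) * Kfun N0 N1 y f"
      using ratio_ge_1[OF xy] by (intro mult_right_mono) auto
    finally show ?thesis .
  next
    case False
    then have "ratio x y = x / y" using xy by (intro ratio_eq_divide) auto
    then show ?thesis using Kfun_quasiconcave[of y x N0 N1 f] xy False by simp
  qed
qed

lemma Kfun_le_left:
  assumes "quasi_norm N1" "f \<in> carrier_of N0"
  shows "Kfun N0 N1 t f \<le> N0 f"
  using Kfun_le[of f N0 0 N1 t] assms quasi_norm_zero[of N1] by (simp add: carrier_of_def)

lemma Kfun_le_right:
  assumes "quasi_norm N0" "f \<in> carrier_of N1"
  shows "Kfun N0 N1 t f \<le> ennreal t * N1 f"
  using Kfun_le[of 0 N0 f N1 t] assms quasi_norm_zero[of N0] by (simp add: carrier_of_def)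

lemma Kfun_triangle:
  assumes N0: "quasi_norm N0" and N1: "quasi_norm N1"
  obtains C where "0 < C" "\<And>t f g. Kfun N0 N1 t (f + g) \<le> ennreal C * (Kfun N0 N1 t f + Kfun N0 N1 t g)"
proof -
  obtain C0 where C0: "0 < C0" "\<And>x y. N0 (x + y) \<le> ennreal C0 * (N0 x + N0 y)"
    using quasi_norm_add[OF N0] by blast
  obtain C1 where C1: "0 < C1" "\<And>x y. N1 (x + y) \<le> ennreal C1 * (N1 x + N1 y)"
    using quasi_norm_add[OF N1] by blast
  define C where "C = max C0 C1"
  have C: "0 < C" "C0 \<le> C" "C1 \<le> C" using C0(1) by (auto simp: C_def)
  show thesis
  proof (rule that[OF C(1)])
    fix t f g
    have "Kfun N0 N1 t (f + g) \<le> ennreal C * (Kfun N0 N1 t g + Kfun N0 N1 t f)"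
    proof (rule Kfun_greatest_affine[OF C(1)])
      fix g0 g1 assume g: "g = g0 + g1" "g0 \<in> carrier_of N0" "g1 \<in> carrier_of N1"
      have "Kfun N0 N1 t (f + g) \<le> ennreal C * (Kfun N0 N1 t f + (N0 g0 + ennreal t * N1 g1))"
      proof (rule Kfun_greatest_affine[OF C(1)])
        fix f0 f1 assume f: "f = f0 + f1" "f0 \<in> carrier_of N0" "f1 \<in> carrier_of N1"
        have "Kfun N0 N1 t ((f0 + g0) + (f1 + g1)) \<le> N0 (f0 + g0) + ennreal t * N1 (f1 + g1)"
          by (intro Kfun_le carrier_add N0 N1 f g)
        also have "\<dots> \<le> ennreal C * (N0 f0 + N0 g0) + ennreal t * (ennreal C * (N1 f1 + N1 g1))"
        proof (intro add_mono mult_left_mono)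
          show "N0 (f0 + g0) \<le> ennreal C * (N0 f0 + N0 g0)"
            using C0(2) by (rule order_trans) (use C in \<open>auto intro: mult_right_mono ennreal_leI\<close>)
          show "N1 (f1 + g1) \<le> ennreal C * (N1 f1 + N1 g1)"
            using C1(2) by (rule order_trans) (use C in \<open>auto intro: mult_right_mono ennreal_leI\<close>)
        qed auto
        also have "\<dots> = ennreal C * (N0 f0 + ennreal t * N1 f1 + (N0 g0 + ennreal t * N1 g1))"
          by (simp add: distrib_left mult.left_commute add_ac)
        finally show "Kfun N0 N1 t (f + g) \<le> ennreal C * (N0 f0 + ennreal t * N1 f1 + (N0 g0 + ennreal t * N1 g1))"
          unfolding f(1) g(1) by (simp add: add_ac)
      qed
      then show "Kfun N0 N1 t (f + g) \<le> ennreal C * (N0 g0 + ennreal t * N1 g1 + Kfun N0 N1 t f)"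
        by (simp add: add_ac)
    qed
    then show "Kfun N0 N1 t (f + g) \<le> ennreal C * (Kfun N0 N1 t f + Kfun N0 N1 t g)"
      by (simp add: add.commute)
  qed
qed

locale L_couple = L_lattice q r a b
  for q r :: ennreal and a b :: "real \<Rightarrow> real" +
  fixes A0 A1 :: "'v::real_vector \<Rightarrow> ennreal"
  assumes A0: "quasi_norm A0" and A1: "quasi_norm A1"
begin

abbreviation K :: "real \<Rightarrow> 'v \<Rightarrow> ennreal" where
  "K u f \<equiv> Kfun A0 A1 u f"

abbreviation AL :: "'v \<Rightarrow> ennreal" where
  "AL \<equiv> interp_L A0 A1 1 r b q a"

abbreviation chi1 :: "real \<Rightarrow> real" where "chi1 \<equiv> chi r b q a"
abbreviation \<rho> :: "real \<Rightarrow> real" where "\<rho> \<equiv> rho r b q a"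

definition slope :: "'v \<Rightarrow> real \<Rightarrow> ennreal" where
  "slope f u = ennreal (1 / u) * K u f"

text \<open>
  The second term of the Holmstedt formula, without the factor \<open>\<rho>(t)\<close>. It is also the inner expression
  of the space in the third part of the theorem.
\<close>
definition K_tail :: "real \<Rightarrow> 'v \<Rightarrow> ennreal" where
  "K_tail t f = Lambda (\<lambda>u. slope f u * indicator {t<..} u)"

lemma AL_eq: "f \<in> sum_space A0 A1 \<Longrightarrow> AL f = Lambda (slope f)"
proof -
  assume f: "f \<in> sum_space A0 A1"
  have inner: "wnorm 1 q {0<..<t} a (\<lambda>u. K u f) = haar_norm q {0<..<t} (\<lambda>u. ennreal (a u) * slope f u)" for t
    by (subst wnorm_eq_haar_norm)
      (auto simp: q slope_def powr_minus divide_inverse ennreal_mult' mult_ac intro!: haar_norm_cong[OF q])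
  show ?thesis
    unfolding interp_L_def Lambda_def inner using f
    by (subst wnorm_eq_haar_norm) (auto simp: r intro!: haar_norm_cong)
qed

lemma carrier_AL: "f \<in> carrier_of AL \<Longrightarrow> f \<in> sum_space A0 A1"
  by (auto simp: carrier_of_def interp_L_def split: if_splits)

lemma sum_space_AL: "f \<in> sum_space A0 AL \<Longrightarrow> f \<in> sum_space A0 A1"
proof -
  assume "f \<in> sum_space A0 AL"
  then obtain f0 f1 where f: "f = f0 + f1" "f0 \<in> carrier_of A0" "f1 \<in> carrier_of AL"
    by (auto simp: sum_space_def)
  from carrier_AL[OF f(3)] obtain g0 g1 where g: "f1 = g0 + g1" "g0 \<in> carrier_of A0" "g1 \<in> carrier_of A1"
    by (auto simp: sum_space_def)
  have "(f0 + g0) + g1 \<in> sum_space A0 A1" by (intro sum_spaceI carrier_add A0 f g)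
  then show ?thesis using f(1) g(1) by (simp add: add.assoc)
qed

lemma slope_measurable: "slope f \<in> borel_measurable (lebesgue_on {0<..})"
proof -
  have "(\<lambda>u. ennreal (1 / u)) \<in> borel_measurable (lebesgue_on {0<..})"
    by (intro measurable_restrict_space1 measurable_completion) simp
  moreover have "(\<lambda>u. K u f) \<in> borel_measurable (lebesgue_on {0<..})"
    by (intro borel_measurable_increasing Kfun_mono)
  ultimately show ?thesis unfolding slope_def[abs_def] by (rule borel_measurable_times_ennreal)
qed

lemma slope_antimono: "0 < s \<Longrightarrow> s \<le> t \<Longrightarrow> slope f t \<le> slope f s"
proof -
  assume s: "0 < s" "s \<le> t"
  have "slope f t \<le> ennreal (1 / t) * (ennreal (t / s) * K s f)"
    unfolding slope_def using Kfun_quasiconcave[OF s] by (intro mult_left_mono) auto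
  also have "\<dots> = slope f s"
    unfolding slope_def using s by (simp add: mult.assoc[symmetric] ennreal_mult'[symmetric])
  finally show ?thesis .
qed

lemma chi_rho: "0 < t \<Longrightarrow> \<rho> t * chi1 t = t"
  using chi_pos[of t] by (simp add: rho_def)

lemma rho_pos: "0 < t \<Longrightarrow> 0 < \<rho> t"
  using chi_pos[of t] by (simp add: rho_def)

text \<open>
  Finite real values of \<open>cutoff\<close>, so that the products in the Holmstedt formula can be estimated by real
  arithmetic; the last two bounds state \<open>\<chi>\<^sub>1(t) = t / \<rho>(t)\<close> up to constants.
\<close>
lemma cutoff_real:
  obtains C x where "0 < C" "\<And>t. 0 < t \<Longrightarrow> 0 \<le> x t" "\<And>t. 0 < t \<Longrightarrow> cutoff t = ennreal (x t)"
    "\<And>t. 0 < t \<Longrightarrow> \<rho> t * x t \<le> C * t" "\<And>t. 0 < t \<Longrightarrow> t \<le> C * (\<rho> t * x t)"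
proof -
  obtain C where C: "0 < C" "\<And>t. 0 < t \<Longrightarrow> ennreal (chi1 t) \<le> ennreal C * cutoff t"
    "\<And>t. 0 < t \<Longrightarrow> cutoff t \<le> ennreal C * ennreal (chi1 t)"
    by (rule chi_equiv) (rule that)
  define x where "x t = enn2real (cutoff t)" for t
  have cutoff: "cutoff t = ennreal (x t)" if "0 < t" for t using cutoff_finite[OF that] by (simp add: x_def less_top)
  have x0: "0 \<le> x t" for t by (simp add: x_def)
  show thesis
  proof (rule that[OF C(1), of x])
    fix t :: real assume t: "0 < t"
    note p = chi_pos[OF t] rho_pos[OF t]
    show "0 \<le> x t" "cutoff t = ennreal (x t)" using cutoff[OF t] x0 by auto
    have 1: "chi1 t \<le> C * x t" using C(2)[OF t] C(1) x0[of t] unfolding cutoff[OF t]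
      by (simp add: ennreal_mult'[symmetric] ennreal_le_iff)
    have 2: "x t \<le> C * chi1 t" using C(3)[OF t] C(1) x0[of t] p unfolding cutoff[OF t]
      by (simp add: ennreal_mult'[symmetric] ennreal_le_iff)
    show "\<rho> t * x t \<le> C * t"
      using mult_left_mono[OF 2, of "\<rho> t"] chi_rho[OF t] p by (simp add: mult.left_commute)
    show "t \<le> C * (\<rho> t * x t)"
      using mult_left_mono[OF 1, of "\<rho> t"] chi_rho[OF t] p by (simp add: mult.left_commute)
  qed
qed

lemma Lambda_tail_inverse:
  obtains C where "0 < C"
    "\<And>t. 0 < t \<Longrightarrow> Lambda (\<lambda>u. ennreal (1 / u) * indicator {t<..} u) \<le> ennreal (C / t) * cutoff t"
proof -
  obtain C where C: "0 < C"
    "\<And>t. 0 < t \<Longrightarrow> Lambda (\<lambda>u. ennreal (u powr - 1) * indicator {t<..} u) \<le> ennreal (C * t powr - 1) * cutoff t"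
    by (rule Lambda_tail_power[OF zero_less_one]) (rule that)
  show thesis
  proof (rule that[OF C(1)])
    fix t :: real assume t: "0 < t"
    have "Lambda (\<lambda>u. ennreal (1 / u) * indicator {t<..} u) \<le> Lambda (\<lambda>u. ennreal (u powr - 1) * indicator {t<..} u)"
      by (intro Lambda_mono) (auto simp: powr_minus_divide)
    then show "Lambda (\<lambda>u. ennreal (1 / u) * indicator {t<..} u) \<le> ennreal (C / t) * cutoff t"
      using C(2)[OF t] t by (simp add: powr_minus_divide)
  qed
qed

lemma tail_inverse_measurable:
  "(\<lambda>u. ennreal (1 / u) * indicator {t<..} u) \<in> borel_measurable (lebesgue_on {0<..})"
proof -
  have "(\<lambda>u. ennreal (1 / u)) \<in> borel_measurable (lebesgue_on {0<..})"
    by (intro measurable_restrict_space1 measurable_completion) simp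
  then show ?thesis by (rule borel_measurable_times_ennreal[OF _ indicator_measurable_Ioi(3)])
qed

lemma slope_triangle:
  obtains C where "0 < C" "\<And>u f g. 0 < u \<Longrightarrow> slope (f + g) u \<le> ennreal C * (slope f u + slope g u)"
proof -
  obtain C where C: "0 < C" "\<And>t f g. K t (f + g) \<le> ennreal C * (K t f + K t g)"
    using Kfun_triangle[OF A0 A1] by blast
  show thesis
  proof (rule that[OF C(1)])
    fix u :: real and f g :: 'v assume "0 < u"
    from mult_left_mono[OF C(2)[of u f g], of "ennreal (1 / u)"]
    show "slope (f + g) u \<le> ennreal C * (slope f u + slope g u)"
      unfolding slope_def by (simp add: distrib_left mult.left_commute)
  qed
qed

lemma slope_le_left: "f \<in> carrier_of A0 \<Longrightarrow> slope f u \<le> ennreal (1 / u) * A0 f"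
  unfolding slope_def using Kfun_le_left[OF A1] by (intro mult_left_mono) auto

lemma slope_le_right: "f \<in> carrier_of A1 \<Longrightarrow> 0 < u \<Longrightarrow> slope f u \<le> A1 f"
proof -
  assume f: "f \<in> carrier_of A1" and u: "0 < u"
  have "slope f u \<le> ennreal (1 / u) * (ennreal u * A1 f)"
    unfolding slope_def using Kfun_le_right[OF A0 f] by (intro mult_left_mono) auto
  then show ?thesis using u by (simp add: ennreal_cancel)
qed

text \<open>
  For \<open>f = f\<^sub>0 + f\<^sub>1\<close> with \<open>\<parallel>f\<^sub>0\<parallel> + t \<parallel>f\<^sub>1\<parallel> = \<kappa>\<close>, the slope of \<open>K(\<cdot>, f\<^sub>1)\<close> is at most
  \<open>\<parallel>f\<^sub>1\<parallel> \<le> \<kappa>/t\<close> below \<open>t\<close> and at most a multiple of \<open>K(u, f)/u + \<kappa>/u\<close> above. Applying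
  \<open>Lambda\<close>, the terms with \<open>\<kappa>\<close> contribute at most a multiple of \<open>\<kappa> \<chi>\<^sub>1(t)/t = \<kappa>/\<rho>(t)\<close> each. In particular \<open>f\<^sub>1\<close>
  belongs to \<open>AL\<close> as soon as \<open>K_tail t f\<close> is finite.
\<close>
theorem Holmstedt_upper:
  obtains C where "0 < C"
    "\<And>t f. 0 < t \<Longrightarrow> Kfun A0 AL (\<rho> t) f \<le> ennreal C * (K t f + ennreal (\<rho> t) * K_tail t f)"
proof -
  obtain B x where B: "0 < B" and x0: "\<And>t. 0 < t \<Longrightarrow> 0 \<le> x t" and cutoff: "\<And>t. 0 < t \<Longrightarrow> cutoff t = ennreal (x t)"
    and \<rho>x: "\<And>t. 0 < t \<Longrightarrow> \<rho> t * x t \<le> B * t" "\<And>t. 0 < t \<Longrightarrow> t \<le> B * (\<rho> t * x t)"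
    by (rule cutoff_real) (rule that)
  obtain D where D: "0 < D"
    "\<And>t. 0 < t \<Longrightarrow> Lambda (\<lambda>u. ennreal (1 / u) * indicator {t<..} u) \<le> ennreal (D / t) * cutoff t"
    by (rule Lambda_tail_inverse) (rule that)
  obtain T where T: "0 < T" "\<And>F G. F \<in> borel_measurable (lebesgue_on {0<..}) \<Longrightarrow> G \<in> borel_measurable (lebesgue_on {0<..}) \<Longrightarrow>
    Lambda (\<lambda>u. F u + G u) \<le> ennreal T * (Lambda F + Lambda G)"
    by (rule Lambda_triangle) (rule that)
  obtain Q where Q: "0 < Q" "\<And>u f g. 0 < u \<Longrightarrow> slope (f + g) u \<le> ennreal Q * (slope f u + slope g u)"
    by (rule slope_triangle) (rule that)
  define C where "C = 1 + T * B + T * T * Q + T * T * Q * D * B"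
  have "0 < T * B + T * T * Q + T * T * Q * D * B" using T B D Q by (simp add: add_pos_pos)
  then have C: "0 < C" by (simp add: C_def)
  show thesis
  proof (rule that[OF C])
    fix t :: real and f :: 'v assume t: "0 < t"
    note \<rho>t = rho_pos[OF t]
    show "Kfun A0 AL (\<rho> t) f \<le> ennreal C * (K t f + ennreal (\<rho> t) * K_tail t f)"
    proof (cases "K_tail t f = top")
      case True
      then show ?thesis using \<rho>t C by (simp add: ennreal_mult_top)
    next
      case False
      define h where "h = enn2real (K_tail t f)"
      have h: "0 \<le> h" "K_tail t f = ennreal h" using False by (auto simp: h_def less_top)
      show ?thesis
      proof (rule Kfun_greatest_affine[OF C])
        fix f0 f1 assume f: "f = f0 + f1" "f0 \<in> carrier_of A0" "f1 \<in> carrier_of A1"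
        define m0 where "m0 = enn2real (A0 f0)"
        define m1 where "m1 = enn2real (A1 f1)"
        have m: "0 \<le> m0" "A0 f0 = ennreal m0" "0 \<le> m1" "A1 f1 = ennreal m1"
          using f by (auto simp: m0_def m1_def carrier_of_def less_top)
        have sum1: "f1 \<in> sum_space A0 A1"
          using sum_spaceI[of 0 A0 f1 A1] f quasi_norm_zero[OF A0] by (simp add: carrier_of_def)
        have f1: "f1 = f + - f0" using f by simp
        have mf0: "- f0 \<in> carrier_of A0" "A0 (- f0) = ennreal m0"
          using f m quasi_norm_minus[OF A0] by (auto simp: carrier_of_def)
        let ?F = "\<lambda>u. ennreal m1 * indicator {..<t} u"
        let ?G = "\<lambda>u. ennreal Q * (slope f u * indicator {t<..} u)"
        let ?J = "\<lambda>u. ennreal (Q * m0) * (ennreal (1 / u) * indicator {t<..} u)"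
        have meas: "?F \<in> borel_measurable (lebesgue_on {0<..})" "?G \<in> borel_measurable (lebesgue_on {0<..})"
            "?J \<in> borel_measurable (lebesgue_on {0<..})"
          by (intro borel_measurable_times_ennreal borel_measurable_const indicator_measurable_Ioi slope_measurable tail_inverse_measurable)+
        have "Lambda (slope f1) \<le> Lambda (\<lambda>u. ?F u + (?G u + ?J u))"
        proof (rule Lambda_mono_AE)
          have "AE u in lebesgue. u \<noteq> t" by (intro AE_completion AE_lborel_singleton)
          then show "AE u in lebesgue. 0 < u \<longrightarrow> slope f1 u \<le> ?F u + (?G u + ?J u)"
          proof eventually_elim
            fix u :: real assume ut: "u \<noteq> t"
            show "0 < u \<longrightarrow> slope f1 u \<le> ?F u + (?G u + ?J u)"
            proof (intro impI)
              assume u: "0 < u"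
              show "slope f1 u \<le> ?F u + (?G u + ?J u)"
              proof (cases "u < t")
                case True
                then show ?thesis using slope_le_right[OF f(3) u] m by simp
              next
                case False
                then have tu: "t < u" using ut by simp
                have "slope f1 u \<le> ennreal Q * (slope f u + slope (- f0) u)"
                  unfolding f1 by (rule Q(2)[OF u])
                also have "\<dots> \<le> ennreal Q * (slope f u + ennreal (1 / u) * ennreal m0)"
                  using slope_le_left[OF mf0(1), of u] mf0(2) by (intro mult_left_mono add_left_mono) auto
                also have "\<dots> = ?F u + (?G u + ?J u)"
                  using tu Q m by (simp add: distrib_left ennreal_mult mult_ac)
                finally show ?thesis .
              qed
            qed
          qed
        qed
        also have "\<dots> \<le> ennreal T * (Lambda ?F + Lambda (\<lambda>u. ?G u + ?J u))"
          using meas by (intro T(2) borel_measurable_add) auto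
        also have "\<dots> \<le> ennreal T * (Lambda ?F + ennreal T * (Lambda ?G + Lambda ?J))"
          using meas by (intro mult_left_mono add_left_mono T(2)) auto
        also have "\<dots> \<le> ennreal T * (ennreal (m1 * x t) + ennreal T * (ennreal (Q * h) + ennreal (Q * m0 * (D / t * x t))))"
        proof (intro mult_left_mono add_mono)
          show "Lambda ?F \<le> ennreal (m1 * x t)"
            using Lambda_cmult[OF m(3), of "indicator {..<t}"] cutoff[OF t] m x0[OF t] by (simp add: cutoff_def ennreal_mult)
          show "Lambda ?G \<le> ennreal (Q * h)"
            using Lambda_cmult[of Q "\<lambda>u. slope f u * indicator {t<..} u"] Q h by (simp add: K_tail_def ennreal_mult)
          have "Lambda ?J = ennreal (Q * m0) * Lambda (\<lambda>u. ennreal (1 / u) * indicator {t<..} u)"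
            using Q m by (intro Lambda_cmult) auto
          also have "\<dots> \<le> ennreal (Q * m0) * ennreal (D / t * x t)"
            using D(2)[OF t] D(1) t x0[OF t] unfolding cutoff[OF t] by (intro mult_left_mono) (auto simp: ennreal_mult'[symmetric])
          finally show "Lambda ?J \<le> ennreal (Q * m0 * (D / t * x t))"
            using Q m D t x0[OF t] by (simp add: ennreal_mult'[symmetric])
        qed auto
        also have "\<dots> = ennreal (T * (m1 * x t + T * (Q * h + Q * m0 * (D / t * x t))))"
          using T Q m h D t x0[OF t] by (simp add: ennreal_mult'[symmetric] ennreal_plus[symmetric] del: ennreal_plus)
        finally have lam1: "Lambda (slope f1) \<le> ennreal (T * (m1 * x t + T * (Q * h + Q * m0 * (D / t * x t))))" .
        then have "Lambda (slope f1) < top" by (rule le_less_trans) simp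
        then have c1: "f1 \<in> carrier_of AL" using AL_eq[OF sum1] by (simp add: carrier_of_def)
        have "Kfun A0 AL (\<rho> t) f \<le> A0 f0 + ennreal (\<rho> t) * AL f1"
          using Kfun_le[OF f(2) c1] f(1) by simp
        also have "\<dots> \<le> ennreal m0 + ennreal (\<rho> t) * ennreal (T * (m1 * x t + T * (Q * h + Q * m0 * (D / t * x t))))"
          unfolding AL_eq[OF sum1] m(2) using lam1 by (intro add_left_mono mult_left_mono) auto
        also have "\<dots> = ennreal (m0 + \<rho> t * (T * (m1 * x t + T * (Q * h + Q * m0 * (D / t * x t)))))"
          using T Q m h D t x0[OF t] \<rho>t by (simp add: ennreal_mult'[symmetric] ennreal_plus[symmetric] del: ennreal_plus)
        also have "\<dots> \<le> ennreal (C * (m0 + t * m1 + \<rho> t * h))"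
        proof (rule ennreal_leI)
          have "\<rho> t * x t / t \<le> B" using \<rho>x(1)[OF t] t by (simp add: divide_simps)
          then have e1: "(T * T * Q * m0 * D) * (\<rho> t * x t / t) \<le> (T * T * Q * m0 * D) * B"
            using T Q D m by (intro mult_left_mono) auto
          have e2: "(T * m1) * (\<rho> t * x t) \<le> (T * m1) * (B * t)"
            using \<rho>x(1)[OF t] T m by (intro mult_left_mono) auto
          have "m0 + \<rho> t * (T * (m1 * x t + T * (Q * h + Q * m0 * (D / t * x t))))
             = m0 + (T * m1) * (\<rho> t * x t) + (T * T * Q) * (\<rho> t * h) + (T * T * Q * m0 * D) * (\<rho> t * x t / t)"
            by (simp add: algebra_simps)
          also have "\<dots> \<le> m0 + (T * m1) * (B * t) + (T * T * Q) * (\<rho> t * h) + (T * T * Q * m0 * D) * B"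
            using e1 e2 by simp
          also have "\<dots> = 1 * m0 + (T * B) * (t * m1) + (T * T * Q) * (\<rho> t * h) + (T * T * Q * D * B) * m0"
            by (simp add: algebra_simps)
          also have "\<dots> \<le> C * (m0 + t * m1 + \<rho> t * h)"
          proof -
            have n: "0 \<le> T * B" "0 \<le> T * T * Q" "0 \<le> T * T * Q * D * B" "0 \<le> t * m1" "0 \<le> \<rho> t * h"
              using T B D Q m h t \<rho>t by auto
            have "1 * m0 + (T * T * Q * D * B) * m0 \<le> C * m0"
              unfolding distrib_right[symmetric] using n m by (intro mult_right_mono) (auto simp: C_def)
            moreover have "(T * B) * (t * m1) \<le> C * (t * m1)"
              using n by (intro mult_right_mono) (auto simp: C_def)
            moreover have "(T * T * Q) * (\<rho> t * h) \<le> C * (\<rho> t * h)"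
              using n by (intro mult_right_mono) (auto simp: C_def)
            ultimately show ?thesis by (simp only: distrib_left)
          qed
          finally show "m0 + \<rho> t * (T * (m1 * x t + T * (Q * h + Q * m0 * (D / t * x t)))) \<le> C * (m0 + t * m1 + \<rho> t * h)" .
        qed
        also have "\<dots> = ennreal C * (A0 f0 + ennreal t * A1 f1 + ennreal (\<rho> t) * K_tail t f)"
          unfolding m(2,4) h(2) using C m h t \<rho>t by (simp add: ennreal_mult ennreal_plus)
        finally show "Kfun A0 AL (\<rho> t) f \<le> ennreal C * (A0 f0 + ennreal t * A1 f1 + ennreal (\<rho> t) * K_tail t f)" .
      qed
    qed
  qed
qed

text \<open>
  For \<open>f = f\<^sub>0 + f\<^sub>1\<close> with \<open>f\<^sub>1\<close> in \<open>AL\<close>: the slope of \<open>K(\<cdot>, f\<^sub>1)\<close> is decreasing, so on \<open>(0, t)\<close> it is at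
  least \<open>K(t, f\<^sub>1)/t\<close>, and \<open>Lambda\<close> of that constant on \<open>(0, t)\<close> is \<open>K(t, f\<^sub>1)/\<rho>(t)\<close> up to constants. In the tail, \<open>K(u, f\<^sub>0)\<close> is at most
  \<open>\<parallel>f\<^sub>0\<parallel>\<close>, and \<open>Lambda\<close> of \<open>1/u\<close> above \<open>t\<close> is at most a multiple of \<open>1/\<rho>(t)\<close>.
\<close>
theorem Holmstedt_lower:
  obtains C where "0 < C"
    "\<And>t f. 0 < t \<Longrightarrow> K t f \<le> ennreal C * Kfun A0 AL (\<rho> t) f"
    "\<And>t f. 0 < t \<Longrightarrow> ennreal (\<rho> t) * K_tail t f \<le> ennreal C * Kfun A0 AL (\<rho> t) f"
proof -
  obtain B x where B: "0 < B" and x0: "\<And>t. 0 < t \<Longrightarrow> 0 \<le> x t" and cutoff: "\<And>t. 0 < t \<Longrightarrow> cutoff t = ennreal (x t)"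
    and \<rho>x: "\<And>t. 0 < t \<Longrightarrow> \<rho> t * x t \<le> B * t" "\<And>t. 0 < t \<Longrightarrow> t \<le> B * (\<rho> t * x t)"
    by (rule cutoff_real) (rule that)
  obtain D where D: "0 < D"
    "\<And>t. 0 < t \<Longrightarrow> Lambda (\<lambda>u. ennreal (1 / u) * indicator {t<..} u) \<le> ennreal (D / t) * cutoff t"
    by (rule Lambda_tail_inverse) (rule that)
  obtain T where T: "0 < T" "\<And>F G. F \<in> borel_measurable (lebesgue_on {0<..}) \<Longrightarrow> G \<in> borel_measurable (lebesgue_on {0<..}) \<Longrightarrow>
    Lambda (\<lambda>u. F u + G u) \<le> ennreal T * (Lambda F + Lambda G)"
    by (rule Lambda_triangle) (rule that)
  obtain Q where Q: "0 < Q" "\<And>u f g. 0 < u \<Longrightarrow> slope (f + g) u \<le> ennreal Q * (slope f u + slope g u)"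
    by (rule slope_triangle) (rule that)
  obtain P where P: "0 < P" "\<And>t f g. K t (f + g) \<le> ennreal P * (K t f + K t g)"
    using Kfun_triangle[OF A0 A1] by blast
  define C where "C = P * (1 + B) + T * Q * (1 + D * B)"
  have n: "0 < P * (1 + B)" "0 < T * Q * (1 + D * B)" using P B T Q D by (auto intro!: mult_pos_pos add_pos_pos)
  then have C: "0 < C" "P * (1 + B) \<le> C" "T * Q * (1 + D * B) \<le> C" by (auto simp: C_def)
  have main: "K t f \<le> ennreal C * (A0 f0 + ennreal (\<rho> t) * AL f1) \<and> ennreal (\<rho> t) * K_tail t f \<le> ennreal C * (A0 f0 + ennreal (\<rho> t) * AL f1)"
    if t: "0 < t" and f: "f = f0 + f1" "f0 \<in> carrier_of A0" "f1 \<in> carrier_of AL" for t f f0 f1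
  proof -
    note \<rho>t = rho_pos[OF t]
    have sum1: "f1 \<in> sum_space A0 A1" by (rule carrier_AL[OF f(3)])
    define m0 where "m0 = enn2real (A0 f0)"
    define l where "l = enn2real (AL f1)"
    define k where "k = enn2real (K t f1)"
    have m: "0 \<le> m0" "A0 f0 = ennreal m0" "0 \<le> l" "AL f1 = ennreal l" "0 \<le> k" "K t f1 = ennreal k"
      using f Kfun_finite[OF sum1, of t] by (auto simp: m0_def l_def k_def carrier_of_def less_top)
    have lam1: "Lambda (slope f1) = ennreal l" using AL_eq[OF sum1] m by simp
    have "ennreal (k / t * x t) \<le> ennreal l"
    proof -
      have "ennreal (k / t * x t) = ennreal (k / t) * cutoff t"
        unfolding cutoff[OF t] using m t x0[OF t] by (intro ennreal_mult) auto
      also have "\<dots> = Lambda (\<lambda>u. ennreal (k / t) * indicator {..<t} u)"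
        unfolding cutoff_def using m t by (intro Lambda_cmult[symmetric]) auto
      also have "\<dots> \<le> Lambda (slope f1)"
      proof (rule Lambda_mono)
        fix u :: real assume u: "0 < u"
        have "ennreal (k / t) = slope f1 t"
          unfolding slope_def m(6) using t by (subst ennreal_mult'[symmetric]) auto
        then show "ennreal (k / t) * indicator {..<t} u \<le> slope f1 u"
          using slope_antimono[OF u, of t f1] by (simp add: indicator_def)
      qed
      finally show ?thesis unfolding lam1 .
    qed
    then have kl: "k / t * x t \<le> l" using m by (simp add: ennreal_le_iff)
    have kb: "k \<le> B * (\<rho> t * l)"
    proof -
      have "k = k / t * t" using t by simp
      also have "\<dots> \<le> k / t * (B * (\<rho> t * x t))" using \<rho>x(2)[OF t] m t by (intro mult_left_mono) auto
      also have "\<dots> = B * \<rho> t * (k / t * x t)" by simp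
      also have "\<dots> \<le> B * \<rho> t * l" using kl B \<rho>t by (intro mult_left_mono) auto
      finally show ?thesis by simp
    qed
    have C_eq: "ennreal C * (A0 f0 + ennreal (\<rho> t) * AL f1) = ennreal (C * (m0 + \<rho> t * l))"
      unfolding m(2,4) using C m \<rho>t by (simp add: ennreal_mult ennreal_plus)
    have "K t f \<le> ennreal P * (K t f0 + K t f1)" unfolding f(1) by (rule P(2))
    also have "\<dots> \<le> ennreal P * (ennreal m0 + ennreal k)"
      using Kfun_le_left[OF A1 f(2), of t] m by (intro mult_left_mono add_mono) auto
    also have "\<dots> = ennreal (P * (m0 + k))" using P m by (simp add: ennreal_mult ennreal_plus)
    also have "\<dots> \<le> ennreal (C * (m0 + \<rho> t * l))"
    proof (rule ennreal_leI)
      have "0 \<le> B * m0" "0 \<le> \<rho> t * l" using B m \<rho>t by auto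
      then have "m0 + k \<le> (1 + B) * (m0 + \<rho> t * l)" using kb by (simp add: algebra_simps)
      then have "P * (m0 + k) \<le> P * (1 + B) * (m0 + \<rho> t * l)" using P by (simp add: mult.assoc)
      also have "\<dots> \<le> C * (m0 + \<rho> t * l)" using C m \<rho>t by (intro mult_right_mono) auto
      finally show "P * (m0 + k) \<le> C * (m0 + \<rho> t * l)" .
    qed
    finally have 1: "K t f \<le> ennreal C * (A0 f0 + ennreal (\<rho> t) * AL f1)" unfolding C_eq .
    let ?G = "\<lambda>u. ennreal Q * slope f1 u"
    let ?J = "\<lambda>u. ennreal (Q * m0) * (ennreal (1 / u) * indicator {t<..} u)"
    have "K_tail t f \<le> Lambda (\<lambda>u. ?J u + ?G u)"
      unfolding K_tail_def
    proof (rule Lambda_mono)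
      fix u :: real assume u: "0 < u"
      show "slope f u * indicator {t<..} u \<le> ?J u + ?G u"
      proof (cases "t < u")
        case True
        have "slope f u \<le> ennreal Q * (slope f0 u + slope f1 u)" unfolding f(1) by (rule Q(2)[OF u])
        also have "\<dots> \<le> ennreal Q * (ennreal (1 / u) * ennreal m0 + slope f1 u)"
          using slope_le_left[OF f(2), of u] m(2) by (intro mult_left_mono add_right_mono) auto
        also have "\<dots> = ?J u + ?G u" using True Q m by (simp add: distrib_left ennreal_mult mult_ac)
        finally show ?thesis using True by simp
      qed simp
    qed
    also have "\<dots> \<le> ennreal T * (Lambda ?J + Lambda ?G)"
      by (intro T(2) borel_measurable_times_ennreal borel_measurable_const slope_measurable tail_inverse_measurable)
    also have "\<dots> \<le> ennreal T * (ennreal (Q * m0 * (D / t * x t)) + ennreal (Q * l))"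
    proof (intro mult_left_mono add_mono)
      have "Lambda ?J = ennreal (Q * m0) * Lambda (\<lambda>u. ennreal (1 / u) * indicator {t<..} u)"
        using Q m by (intro Lambda_cmult) auto
      also have "\<dots> \<le> ennreal (Q * m0) * ennreal (D / t * x t)"
        using D(2)[OF t] D(1) t x0[OF t] unfolding cutoff[OF t] by (intro mult_left_mono) (auto simp: ennreal_mult'[symmetric])
      finally show "Lambda ?J \<le> ennreal (Q * m0 * (D / t * x t))"
        using Q m D t x0[OF t] by (simp add: ennreal_mult'[symmetric])
      show "Lambda ?G \<le> ennreal (Q * l)"
        using Lambda_cmult[of Q "slope f1"] Q m lam1 by (simp add: ennreal_mult)
    qed auto
    also have "\<dots> = ennreal (T * (Q * m0 * (D / t * x t) + Q * l))"
      using T Q m D t x0[OF t] by (simp add: ennreal_mult'[symmetric] ennreal_plus[symmetric] del: ennreal_plus)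
    finally have "ennreal (\<rho> t) * K_tail t f \<le> ennreal (\<rho> t) * ennreal (T * (Q * m0 * (D / t * x t) + Q * l))"
      by (intro mult_left_mono) auto
    also have "\<dots> = ennreal (\<rho> t * (T * (Q * m0 * (D / t * x t) + Q * l)))"
      using \<rho>t by (simp add: ennreal_mult'[symmetric])
    also have "\<dots> \<le> ennreal (C * (m0 + \<rho> t * l))"
    proof (rule ennreal_leI)
      have "\<rho> t * x t / t \<le> B" using \<rho>x(1)[OF t] t by (simp add: divide_simps)
      then have e1: "(T * Q * m0 * D) * (\<rho> t * x t / t) \<le> (T * Q * m0 * D) * B"
        using T Q D m by (intro mult_left_mono) auto
      have "\<rho> t * (T * (Q * m0 * (D / t * x t) + Q * l))
         = (T * Q * m0 * D) * (\<rho> t * x t / t) + T * Q * (\<rho> t * l)"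
        by (simp add: algebra_simps)
      also have "\<dots> \<le> (T * Q * m0 * D) * B + T * Q * (\<rho> t * l)" using e1 by simp
      also have "\<dots> = T * Q * (D * B * m0 + \<rho> t * l)" by (simp add: algebra_simps)
      also have "\<dots> \<le> T * Q * ((1 + D * B) * (m0 + \<rho> t * l))"
      proof (rule mult_left_mono)
        have "0 \<le> D * B * (\<rho> t * l)" using D B m \<rho>t by auto
        then show "D * B * m0 + \<rho> t * l \<le> (1 + D * B) * (m0 + \<rho> t * l)" using m by (simp add: algebra_simps)
      qed (use T Q in auto)
      also have "\<dots> = T * Q * (1 + D * B) * (m0 + \<rho> t * l)" by (simp add: mult.assoc)
      also have "\<dots> \<le> C * (m0 + \<rho> t * l)" using C m \<rho>t by (intro mult_right_mono) auto
      finally show "\<rho> t * (T * (Q * m0 * (D / t * x t) + Q * l)) \<le> C * (m0 + \<rho> t * l)" .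
    qed
    finally show ?thesis using 1 unfolding C_eq by simp
  qed
  show thesis
  proof (rule that[OF C(1)])
    fix t :: real and f :: 'v assume t: "0 < t"
    have "K t f \<le> ennreal C * (Kfun A0 AL (\<rho> t) f + 0)"
      using main[OF t] by (intro Kfun_greatest_affine[OF C(1)]) simp
    then show "K t f \<le> ennreal C * Kfun A0 AL (\<rho> t) f" by simp
    have "ennreal (\<rho> t) * K_tail t f \<le> ennreal C * (Kfun A0 AL (\<rho> t) f + 0)"
      using main[OF t] by (intro Kfun_greatest_affine[OF C(1)]) simp
    then show "ennreal (\<rho> t) * K_tail t f \<le> ennreal C * Kfun A0 AL (\<rho> t) f" by simp
  qed
qed

text \<open>
  If \<open>S\<close> is the supremum on the right, then \<open>K(u, f)/u \<le> S t\<^bsup>d-1\<^esup> u\<^bsup>-d\<^esup>\<close> above \<open>t\<close>, and \<open>Lambda\<close> of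
  \<open>u\<^bsup>-d\<^esup>\<close> above \<open>t\<close> is known. This replaces a decomposition of \<open>(t, \<infinity>)\<close> into octaves.
\<close>
lemma K_tail_le_sup:
  assumes d: "0 < d"
  obtains C where "0 < C"
    "\<And>t f. 0 < t \<Longrightarrow> ennreal (\<rho> t) * K_tail t f \<le> ennreal C * (SUP u\<in>{t..}. ennreal ((t / u) powr (1 - d)) * K u f)"
proof -
  obtain B x where B: "0 < B" and x0: "\<And>t. 0 < t \<Longrightarrow> 0 \<le> x t" and cutoff: "\<And>t. 0 < t \<Longrightarrow> cutoff t = ennreal (x t)"
    and \<rho>x: "\<And>t. 0 < t \<Longrightarrow> \<rho> t * x t \<le> B * t" "\<And>t. 0 < t \<Longrightarrow> t \<le> B * (\<rho> t * x t)"
    by (rule cutoff_real) (rule that)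
  obtain D where D: "0 < D"
    "\<And>t. 0 < t \<Longrightarrow> Lambda (\<lambda>u. ennreal (u powr - d) * indicator {t<..} u) \<le> ennreal (D * t powr - d) * cutoff t"
    by (rule Lambda_tail_power[OF d]) (rule that)
  show thesis
  proof (rule that[of "D * B"])
    fix t :: real and f :: 'v assume t: "0 < t"
    note \<rho>t = rho_pos[OF t]
    let ?S = "SUP u\<in>{t..}. ennreal ((t / u) powr (1 - d)) * K u f"
    show "ennreal (\<rho> t) * K_tail t f \<le> ennreal (D * B) * ?S"
    proof (cases "?S = top")
      case True
      then show ?thesis unfolding True using D B by (simp add: ennreal_mult_top)
    next
      case False
      define s where "s = enn2real ?S"
      have s: "0 \<le> s" "?S = ennreal s"
        using False unfolding s_def by (simp_all only: ennreal_enn2real_if enn2real_nonneg if_False)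
      have "K_tail t f \<le> Lambda (\<lambda>u. ennreal (s * t powr (d - 1)) * (ennreal (u powr - d) * indicator {t<..} u))"
        unfolding K_tail_def
      proof (rule Lambda_mono)
        fix u :: real assume u: "0 < u"
        show "slope f u * indicator {t<..} u \<le> ennreal (s * t powr (d - 1)) * (ennreal (u powr - d) * indicator {t<..} u)"
        proof (cases "t < u")
          case True
          have "ennreal ((t / u) powr (1 - d)) * K u f \<le> ennreal s"
            unfolding s(2)[symmetric] using True by (intro SUP_upper) auto
          then have "ennreal (t powr (d - 1) * u powr - d) * (ennreal ((t / u) powr (1 - d)) * K u f) \<le> ennreal (t powr (d - 1) * u powr - d) * ennreal s"
            by (intro mult_left_mono) auto
          moreover have "ennreal (t powr (d - 1) * u powr - d) * (ennreal ((t / u) powr (1 - d)) * K u f) = slope f u"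
          proof -
            have "t powr (d - 1) * t powr (1 - d) = 1" using t by (simp flip: powr_add)
            moreover have "u powr - d / u powr (1 - d) = 1 / u"
              using u by (simp add: powr_diff powr_minus divide_simps)
            moreover have "t powr (d - 1) * u powr - d * (t / u) powr (1 - d)
                = (t powr (d - 1) * t powr (1 - d)) * (u powr - d / u powr (1 - d))"
              by (simp add: powr_divide)
            ultimately have "t powr (d - 1) * u powr - d * (t / u) powr (1 - d) = 1 / u" by simp
            then show ?thesis
              unfolding slope_def by (simp add: mult.assoc[symmetric] ennreal_mult'[symmetric])
          qed
          moreover have "ennreal (t powr (d - 1) * u powr - d) * ennreal s = ennreal (s * t powr (d - 1)) * ennreal (u powr - d)"
            using s by (simp add: ennreal_mult'[symmetric] mult_ac)
          ultimately show ?thesis using True by simp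
        qed simp
      qed
      also have "\<dots> = ennreal (s * t powr (d - 1)) * Lambda (\<lambda>u. ennreal (u powr - d) * indicator {t<..} u)"
        using s by (intro Lambda_cmult) auto
      also have "\<dots> \<le> ennreal (s * t powr (d - 1)) * (ennreal (D * t powr - d) * ennreal (x t))"
        using D(2)[OF t] cutoff[OF t] by (intro mult_left_mono) auto
      also have "\<dots> = ennreal (s * t powr (d - 1) * (D * t powr - d * x t))"
        using s D x0[OF t] by (simp add: ennreal_mult)
      finally have "ennreal (\<rho> t) * K_tail t f \<le> ennreal (\<rho> t) * ennreal (s * t powr (d - 1) * (D * t powr - d * x t))"
        by (intro mult_left_mono) auto
      also have "\<dots> = ennreal (\<rho> t * (s * t powr (d - 1) * (D * t powr - d * x t)))"
        using \<rho>t by (simp add: ennreal_mult')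
      also have "\<dots> \<le> ennreal (D * B * s)"
      proof (rule ennreal_leI)
        have p: "t powr (d - 1) * t powr - d = 1 / t"
          using t by (simp add: powr_minus_divide powr_diff)
        have "\<rho> t * (s * t powr (d - 1) * (D * t powr - d * x t)) = D * s * (t powr (d - 1) * t powr - d) * (\<rho> t * x t)"
          by simp
        also have "\<dots> \<le> D * s * (1 / t) * (B * t)"
          unfolding p using \<rho>x(1)[OF t] D s t by (intro mult_left_mono) auto
        also have "\<dots> = D * B * s" using t by simp
        finally show "\<rho> t * (s * t powr (d - 1) * (D * t powr - d * x t)) \<le> D * B * s" .
      qed
      also have "\<dots> = ennreal (D * B) * ?S" unfolding s(2) using D B s by (simp add: ennreal_mult)
      finally show ?thesis .
    qed
  qed (use D B in simp)
qed

end

section \<open>Reiteration\<close>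

lemma powr_moderate:
  assumes "0 \<le> p"
  shows "moderate 1 p (\<lambda>x. ennreal (x powr - p))"
  unfolding moderate_def
proof (intro allI impI)
  fix x y :: real assume xy: "0 < x" "0 < y"
  have "y \<le> ratio x y * x" using ratio_le_iff[OF xy, of "ratio x y"] by simp
  then have "y powr p \<le> (ratio x y * x) powr p" using xy assms by (intro powr_mono2) auto
  then have "y powr p \<le> ratio x y powr p * x powr p" by (simp only: powr_mult)
  then have "x powr - p \<le> ratio x y powr p * y powr - p"
    using xy by (simp add: powr_minus divide_simps mult.commute)
  then show "ennreal (x powr - p) \<le> ennreal (1 * ratio x y powr p) * ennreal (y powr - p)"
    by (simp add: ennreal_mult'[symmetric] ennreal_leI)
qed

lemma moderate_compose:
  assumes G: "moderate D p G" and \<rho>: "almost_power A \<rho>" and A: "1 \<le> A" and p: "0 \<le> p" and D: "0 < D"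
  shows "moderate (D * A powr p) p (\<lambda>t. G (\<rho> t))"
  unfolding moderate_def
proof (intro allI impI)
  fix x y :: real assume xy: "0 < x" "0 < y"
  have "G (\<rho> x) \<le> ennreal (D * (A * ratio x y) powr p) * G (\<rho> y)"
    using xy \<rho> p D almost_power_ratio[OF \<rho> A xy] by (intro moderateD[OF G]) (auto simp: almost_power_def)
  then show "G (\<rho> x) \<le> ennreal (D * A powr p * ratio x y powr p) * G (\<rho> y)"
    by (simp only: powr_mult mult.assoc)
qed

lemma SV_weight_moderate:
  assumes c: "c \<in> SV" and \<theta>: "0 \<le> \<theta>" and e: "0 < e"
  obtains D where "0 < D" "moderate D (\<theta> + e) (\<lambda>x. ennreal (x powr - \<theta> * c x))"
proof -
  obtain D where D: "0 < D" "moderate D e (\<lambda>x. ennreal (c x))"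
    by (rule SV_moderate[OF c e]) (rule that)
  have "moderate (1 * D) (\<theta> + e) (\<lambda>x. ennreal (x powr - \<theta>) * ennreal (c x))"
    by (rule moderate_mult[OF powr_moderate[OF \<theta>] D(2) zero_less_one D(1)])
  then have "moderate D (\<theta> + e) (\<lambda>x. ennreal (x powr - \<theta> * c x))"
    by (simp add: ennreal_mult')
  with D(1) show thesis by (rule that)
qed

lemma same_spaceI:
  assumes "0 < C" "\<And>f. M f \<le> ennreal C * N f" "0 < D" "\<And>f. N f \<le> ennreal D * M f"
  shows "same_space M N"
proof -
  have *: "cont_embedded M N" if "0 < D" "\<And>f. N f \<le> ennreal D * M f" for M N :: "'a \<Rightarrow> ennreal" and D
    unfolding cont_embedded_def carrier_of_def
  proof (intro conjI subsetI exI[of _ D] ballI that)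
    fix f assume "f \<in> {x. M x < \<infinity>}"
    then have "ennreal D * M f < top" by (simp add: ennreal_mult_less_top)
    then show "f \<in> {x. N x < \<infinity>}" using that(2)[of f] by (auto intro: le_less_trans)
  qed
  show ?thesis unfolding same_space_def using * assms by blast
qed

context L_couple
begin

lemma rho_nonzero: "0 < t \<Longrightarrow> \<rho> t \<noteq> 0"
  using rho_pos[of t] by simp

text \<open>
  Outside the sum of \<open>A\<^sub>0\<close> and \<open>AL\<close> the K-functional is infinite, and so is the norm on the right. Hence the
  membership condition of \<open>interp\<close> takes care of itself.
\<close>
lemma interp_AL_eq:
  assumes p: "0 < p" and c: "c \<in> SV" and f: "f \<in> sum_space A0 A1"
  shows "interp A0 AL \<theta> p c f = haar_norm p {0<..} (\<lambda>u. ennreal (u powr - \<theta> * c u) * Kfun A0 AL u f)"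
proof (cases "f \<in> sum_space A0 AL")
  case True
  then show ?thesis unfolding interp_def by (simp add: wnorm_eq_haar_norm p)
next
  case False
  obtain k where k: "0 < k"
    "\<And>t S f z. 0 < t \<Longrightarrow> {t<..<2 * t} \<subseteq> S \<Longrightarrow> (\<And>u. t < u \<Longrightarrow> u < 2 * t \<Longrightarrow> z \<le> f u)
       \<Longrightarrow> ennreal k * z \<le> haar_norm p S f"
    using haar_norm_lower_bound[OF p] by blast
  have "ennreal k * top \<le> haar_norm p {0<..} (\<lambda>u. ennreal (u powr - \<theta> * c u) * Kfun A0 AL u f)"
  proof (rule k(2)[of 1])
    fix u :: real assume u: "1 < u" "u < 2 * 1"
    then have "0 < c u" using SV_pos[OF c, of u] by simp
    with u show "top \<le> ennreal (u powr - \<theta> * c u) * Kfun A0 AL u f"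
      unfolding Kfun_outside[OF False] by (simp add: ennreal_mult_top)
  qed auto
  then show ?thesis using False k(1) by (simp add: interp_def ennreal_mult_top top_unique)
qed

lemma interp_outside: "f \<notin> sum_space A0 A1 \<Longrightarrow> interp A0 AL \<theta> p c f = top"
  "f \<notin> sum_space A0 A1 \<Longrightarrow> interp A0 A1 \<theta> p c f = top"
  "f \<notin> sum_space A0 A1 \<Longrightarrow> interp_LR A0 A1 \<theta> p c r b q a f = top"
  using sum_space_AL by (auto simp: interp_def interp_LR_def)

text \<open>
  The weight \<open>u\<^bsup>-\<theta>\<^esup> c(u)\<close> of the outer norm after the substitution \<open>u = \<rho>(t)\<close>; in the notation of the
  theorem it is \<open>t\<^bsup>-\<theta>\<^esup> a\<^sup>#(t)\<close> for \<open>c = a\<close>.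
\<close>
definition weight :: "real \<Rightarrow> (real \<Rightarrow> real) \<Rightarrow> real \<Rightarrow> ennreal" where
  "weight \<theta> c t = ennreal (\<rho> t powr - \<theta> * c (\<rho> t))"

lemma weight_moderate:
  assumes c: "c \<in> SV" and \<theta>: "0 \<le> \<theta>" and e: "0 < e"
  obtains D where "0 < D" "moderate D (\<theta> + e) (weight \<theta> c)"
proof -
  obtain A where A: "1 \<le> A" "almost_power A \<rho>" by (rule almost_power_rho) (rule that)
  obtain D where D: "0 < D" "moderate D (\<theta> + e) (\<lambda>x. ennreal (x powr - \<theta> * c x))"
    by (rule SV_weight_moderate[OF c \<theta> e]) (rule that)
  have "moderate (D * A powr (\<theta> + e)) (\<theta> + e) (weight \<theta> c)"
    unfolding weight_def[abs_def] using moderate_compose[OF D(2) A(2,1) _ D(1)] \<theta> e by simp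
  moreover have "0 < D * A powr (\<theta> + e)" using D A by simp
  ultimately show thesis by (intro that)
qed

lemma interp_weight_eq:
  assumes p: "0 < p" and f: "f \<in> sum_space A0 A1"
    and g: "\<And>t. 0 < t \<Longrightarrow> t powr - \<theta> * g t = \<rho> t powr - \<theta> * c (\<rho> t)"
  shows "interp A0 A1 \<theta> p g f = haar_norm p {0<..} (\<lambda>t. weight \<theta> c t * K t f)"
  unfolding interp_def weight_def using f
  by (simp add: wnorm_eq_haar_norm p) (intro haar_norm_cong[OF p], simp add: g)

lemma K_tail_eq: "0 < t \<Longrightarrow> wnorm 0 r {t<..} b (\<lambda>u. wnorm 1 q {t<..<u} a (\<lambda>v. K v f)) = K_tail t f"
proof -
  assume t: "0 < t"
  have inner: "wnorm 1 q {t<..<s} a (\<lambda>u. K u f) = haar_norm q {t<..<s} (\<lambda>u. ennreal (a u) * slope f u)" for s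
    using t by (subst wnorm_eq_haar_norm)
      (auto simp: q slope_def powr_minus divide_inverse ennreal_mult' mult_ac intro!: haar_norm_cong[OF q])
  have empty: "haar_norm q {} f = 0" for f :: "real \<Rightarrow> ennreal"
    by (simp add: haar_norm_def bot_ennreal)
  have cut: "haar_norm q {0<..<s} (\<lambda>u. ennreal (a u) * (slope f u * indicator {t<..} u))
      = haar_norm q {t<..<s} (\<lambda>u. ennreal (a u) * slope f u)" for s
  proof -
    have "{0<..<s} \<inter> {t<..} = {t<..<s}" using t by auto
    then show ?thesis
      using haar_norm_indicator[OF q, of "{0<..<s}" "\<lambda>u. ennreal (a u) * slope f u" "{t<..}"] by (simp add: mult.assoc)
  qed
  have "K_tail t f = haar_norm r {0<..} (\<lambda>s. ennreal (b s) * haar_norm q {t<..<s} (\<lambda>u. ennreal (a u) * slope f u) * indicator {t<..} s)"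
    unfolding K_tail_def Lambda_def cut by (intro haar_norm_cong[OF r]) (auto simp: indicator_def empty)
  also have "\<dots> = haar_norm r {t<..} (\<lambda>s. ennreal (b s) * haar_norm q {t<..<s} (\<lambda>u. ennreal (a u) * slope f u))"
  proof -
    have "{0<..} \<inter> {t<..} = {t<..}" using t by auto
    then show ?thesis unfolding haar_norm_indicator[OF r] by simp
  qed
  also have "\<dots> = wnorm 0 r {t<..} b (\<lambda>u. wnorm 1 q {t<..<u} a (\<lambda>v. K v f))"
    unfolding inner using t by (subst wnorm_eq_haar_norm) (auto simp: r intro!: haar_norm_cong[OF r])
  finally show ?thesis by simp
qed

lemma interp_LR_eq:
  assumes p: "0 < p" and f: "f \<in> sum_space A0 A1"
  shows "interp_LR A0 A1 1 p (c \<circ> \<rho>) r b q a f = haar_norm p {0<..} (\<lambda>t. weight 0 c t * K_tail t f)"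
  unfolding interp_LR_def weight_def using f
  by (simp add: wnorm_eq_haar_norm[of "{0<..}"] p) (intro haar_norm_cong[OF p], simp add: K_tail_eq rho_nonzero)

text \<open>
  The function \<open>u\<^bsup>-\<theta>\<^esup> c(u) K(u, f; A\<^sub>0, AL)\<close> is moderate with constants independent of \<open>f\<close>; so the
  substitution \<open>u = \<rho>(t)\<close> is allowed, and the Holmstedt formula evaluates the result.
\<close>
theorem interp_AL_equiv:
  assumes p: "0 < p" and c: "c \<in> SV" and \<theta>: "0 \<le> \<theta>"
  obtains C where "0 < C"
    "\<And>f. f \<in> sum_space A0 A1 \<Longrightarrow> interp A0 AL \<theta> p c f
      \<le> ennreal C * haar_norm p {0<..} (\<lambda>t. weight \<theta> c t * (K t f + ennreal (\<rho> t) * K_tail t f))"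
    "\<And>f. f \<in> sum_space A0 A1 \<Longrightarrow> haar_norm p {0<..} (\<lambda>t. weight \<theta> c t * K t f) \<le> ennreal C * interp A0 AL \<theta> p c f"
    "\<And>f. f \<in> sum_space A0 A1 \<Longrightarrow>
      haar_norm p {0<..} (\<lambda>t. weight \<theta> c t * (ennreal (\<rho> t) * K_tail t f)) \<le> ennreal C * interp A0 AL \<theta> p c f"
proof -
  obtain A where A: "1 \<le> A" "almost_power A \<rho>" by (rule almost_power_rho) (rule that)
  obtain D where D: "0 < D" "moderate D (\<theta> + 1) (\<lambda>x. ennreal (x powr - \<theta> * c x))"
    by (rule SV_weight_moderate[OF c \<theta> zero_less_one]) (rule that)
  define G where "G f x = ennreal (x powr - \<theta> * c x) * Kfun A0 AL x f" for f x
  have G: "moderate (D * 1) (\<theta> + 1 + 1) (G f)" for f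
    unfolding G_def[abs_def] by (rule moderate_mult[OF D(2) Kfun_moderate D(1) zero_less_one])
  have pp: "0 \<le> \<theta> + 1 + 1" "0 < D * 1" using \<theta> D by auto
  obtain B where B: "0 < B"
    "\<And>G. moderate (D * 1) (\<theta> + 1 + 1) G \<Longrightarrow> haar_norm p {0<..} G \<le> ennreal B * haar_norm p {0<..} (\<lambda>t. G (\<rho> t))"
    "\<And>G. moderate (D * 1) (\<theta> + 1 + 1) G \<Longrightarrow> haar_norm p {0<..} (\<lambda>t. G (\<rho> t)) \<le> ennreal B * haar_norm p {0<..} G"
    by (rule haar_norm_change_variable[OF p A(2,1) pp]) (rule that)
  obtain U where U: "0 < U"
    "\<And>t f. 0 < t \<Longrightarrow> Kfun A0 AL (\<rho> t) f \<le> ennreal U * (K t f + ennreal (\<rho> t) * K_tail t f)"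
    by (rule Holmstedt_upper) (rule that)
  obtain L where L: "0 < L"
    "\<And>t f. 0 < t \<Longrightarrow> K t f \<le> ennreal L * Kfun A0 AL (\<rho> t) f"
    "\<And>t f. 0 < t \<Longrightarrow> ennreal (\<rho> t) * K_tail t f \<le> ennreal L * Kfun A0 AL (\<rho> t) f"
    by (rule Holmstedt_lower) (rule that)
  have eq: "interp A0 AL \<theta> p c f = haar_norm p {0<..} (G f)" if "f \<in> sum_space A0 A1" for f
    unfolding G_def[abs_def] by (rule interp_AL_eq[OF p c that])
  have G\<rho>: "G f (\<rho> t) = weight \<theta> c t * Kfun A0 AL (\<rho> t) f" for f t
    by (simp add: G_def weight_def)
  have low: "haar_norm p {0<..} (\<lambda>t. weight \<theta> c t * F t) \<le> ennreal (L * B) * interp A0 AL \<theta> p c f"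
    if f: "f \<in> sum_space A0 A1" and F: "\<And>t. 0 < t \<Longrightarrow> F t \<le> ennreal L * Kfun A0 AL (\<rho> t) f" for f F
  proof -
    have "haar_norm p {0<..} (\<lambda>t. weight \<theta> c t * F t) \<le> ennreal L * haar_norm p {0<..} (\<lambda>t. G f (\<rho> t))"
    proof (intro haar_norm_le_cmult[OF p L(1)] AE_I2 impI conjI)
      fix t :: real assume t: "t \<in> {0<..}"
      then show "weight \<theta> c t * F t \<le> ennreal L * G f (\<rho> t)"
        using mult_left_mono[OF F, of t "weight \<theta> c t"] by (simp add: G\<rho> mult.left_commute)
    qed
    from le_ennreal_mult_trans[OF this B(3)[OF G]] show ?thesis
      using L(1) unfolding eq[OF f] by simp
  qed
  have LB: "0 < B * U" "0 < L * B" using B L U by auto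
  have weaken: "ennreal x * z \<le> ennreal (B * U + L * B) * z" if "x \<le> B * U + L * B" for x z
    using that by (intro mult_right_mono ennreal_leI) auto
  show thesis
  proof (rule that[of "B * U + L * B"])
    show "0 < B * U + L * B" using LB by simp
    fix f assume f: "f \<in> sum_space A0 A1"
    have "haar_norm p {0<..} (\<lambda>t. G f (\<rho> t)) \<le> ennreal U * haar_norm p {0<..} (\<lambda>t. weight \<theta> c t * (K t f + ennreal (\<rho> t) * K_tail t f))"
    proof (intro haar_norm_le_cmult[OF p U(1)] AE_I2 impI conjI)
      fix t :: real assume t: "t \<in> {0<..}"
      then show "G f (\<rho> t) \<le> ennreal U * (weight \<theta> c t * (K t f + ennreal (\<rho> t) * K_tail t f))"
        using mult_left_mono[OF U(2), of t "weight \<theta> c t" f] by (simp add: G\<rho> mult.left_commute)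
    qed
    from le_ennreal_mult_trans[OF B(2)[OF G] this]
    have "interp A0 AL \<theta> p c f \<le> ennreal (B * U) * haar_norm p {0<..} (\<lambda>t. weight \<theta> c t * (K t f + ennreal (\<rho> t) * K_tail t f))"
      using B(1) unfolding eq[OF f] by simp
    then show "interp A0 AL \<theta> p c f \<le> ennreal (B * U + L * B) * haar_norm p {0<..} (\<lambda>t. weight \<theta> c t * (K t f + ennreal (\<rho> t) * K_tail t f))"
      by (rule order_trans) (rule weaken, use LB in simp)
    show "haar_norm p {0<..} (\<lambda>t. weight \<theta> c t * K t f) \<le> ennreal (B * U + L * B) * interp A0 AL \<theta> p c f"
      by (rule order_trans[OF low[OF f] weaken]) (use L(2) LB in simp_all)
    show "haar_norm p {0<..} (\<lambda>t. weight \<theta> c t * (ennreal (\<rho> t) * K_tail t f)) \<le> ennreal (B * U + L * B) * interp A0 AL \<theta> p c f"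
      by (rule order_trans[OF low[OF f] weaken]) (use L(3) LB in simp_all)
  qed
qed

text \<open>
  The weight loses at most \<open>(u/t)\<^bsup>\<theta>+e\<^esup>\<close> when \<open>t\<close> is moved up to \<open>u\<close>, and the supremum that dominates the tail
  gains \<open>(t/u)\<^bsup>1-e\<^esup>\<close>. With \<open>e = (1 - \<theta>)/3\<close> a factor \<open>(t/u)\<^bsup>e\<^esup>\<close> remains, which is what the Hardy
  inequality needs.
\<close>
theorem haar_norm_K_tail_absorbed:
  assumes p: "0 < p" and c: "c \<in> SV" and \<theta>: "0 \<le> \<theta>" "\<theta> < 1"
  obtains C where "0 < C"
    "\<And>f. haar_norm p {0<..} (\<lambda>t. weight \<theta> c t * (K t f + ennreal (\<rho> t) * K_tail t f))
      \<le> ennreal C * haar_norm p {0<..} (\<lambda>t. weight \<theta> c t * K t f)"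
proof -
  define e where "e = (1 - \<theta>) / 3"
  have e: "0 < e" "1 - e = \<theta> + e + e" using \<theta> by (auto simp: e_def field_simps)
  obtain D where D: "0 < D" "moderate D (\<theta> + e) (weight \<theta> c)"
    by (rule weight_moderate[OF c \<theta>(1) e(1)]) (rule that)
  obtain B where B: "0 < B"
    "\<And>t f. 0 < t \<Longrightarrow> ennreal (\<rho> t) * K_tail t f \<le> ennreal B * (SUP u\<in>{t..}. ennreal ((t / u) powr (1 - e)) * K u f)"
    by (rule K_tail_le_sup[OF e(1)]) (rule that)
  have pp: "0 \<le> \<theta> + e + 1" "0 < D * 1" using \<theta> e D by auto
  obtain M where M: "0 < M"
    "\<And>Z. moderate (D * 1) (\<theta> + e + 1) Z \<Longrightarrow>
      haar_norm p {0<..} (\<lambda>t. SUP u\<in>{t..}. ennreal ((t / u) powr e) * Z u) \<le> ennreal M * haar_norm p {0<..} Z"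
    by (rule haar_norm_Hardy_sup[OF p e(1) pp]) (rule that)
  show thesis
  proof (rule that[of "(1 + B) * D * M"])
    show "0 < (1 + B) * D * M" using B D M by simp
    fix f :: 'v
    define Z where "Z u = weight \<theta> c u * K u f" for u
    have Z: "moderate (D * 1) (\<theta> + e + 1) Z"
      unfolding Z_def[abs_def] by (rule moderate_mult[OF D(2) Kfun_moderate D(1) zero_less_one])
    have "haar_norm p {0<..} (\<lambda>t. weight \<theta> c t * (K t f + ennreal (\<rho> t) * K_tail t f))
       \<le> ennreal ((1 + B) * D) * haar_norm p {0<..} (\<lambda>t. SUP u\<in>{t..}. ennreal ((t / u) powr e) * Z u)"
    proof (intro haar_norm_le_cmult[OF p] AE_I2 impI conjI)
      show "0 < (1 + B) * D" using B D by simp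
      fix t :: real assume "t \<in> {0<..}"
      then have t: "0 < t" by simp
      let ?S = "SUP u\<in>{t..}. ennreal ((t / u) powr (1 - e)) * K u f"
      let ?T = "SUP u\<in>{t..}. ennreal ((t / u) powr e) * Z u"
      have "ennreal ((t / t) powr (1 - e)) * K t f \<le> ?S" by (intro SUP_upper) simp
      then have "K t f + ennreal (\<rho> t) * K_tail t f \<le> ?S + ennreal B * ?S"
        using B(2)[OF t, of f] t by (intro add_mono) auto
      also have "\<dots> = ennreal (1 + B) * ?S" using B by (simp add: ennreal_plus distrib_right)
      finally have "weight \<theta> c t * (K t f + ennreal (\<rho> t) * K_tail t f) \<le> weight \<theta> c t * (ennreal (1 + B) * ?S)"
        by (rule mult_left_mono) simp
      also have "\<dots> = ennreal (1 + B) * (weight \<theta> c t * ?S)" by (rule mult.left_commute)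
      also have "weight \<theta> c t * ?S \<le> ennreal D * ?T"
        unfolding SUP_mult_left_ennreal
      proof (rule SUP_mono)
        fix u assume u: "u \<in> {t..}"
        then have u0: "0 < u" using t by simp
        have "ratio t u = u / t" using u t by (subst ratio_commute, intro ratio_eq_divide) auto
        then have "weight \<theta> c t \<le> ennreal (D * (u / t) powr (\<theta> + e)) * weight \<theta> c u"
          using D(2) t u0 unfolding moderate_def by metis
        then have "weight \<theta> c t * (ennreal ((t / u) powr (1 - e)) * K u f)
           \<le> ennreal (D * (u / t) powr (\<theta> + e)) * weight \<theta> c u * (ennreal ((t / u) powr (1 - e)) * K u f)"
          by (rule mult_right_mono) simp
        also have "\<dots> = (ennreal (D * (u / t) powr (\<theta> + e)) * ennreal ((t / u) powr (1 - e))) * Z u"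
          unfolding Z_def by (simp only: mult_ac)
        also have "ennreal (D * (u / t) powr (\<theta> + e)) * ennreal ((t / u) powr (1 - e)) = ennreal D * ennreal ((t / u) powr e)"
        proof -
          have "(u / t) powr (\<theta> + e) * (t / u) powr (\<theta> + e) = ((u / t) * (t / u)) powr (\<theta> + e)"
            by (simp only: powr_mult)
          also have "(u / t) * (t / u) = 1" using t u0 by simp
          finally have "(u / t) powr (\<theta> + e) * (t / u) powr (\<theta> + e) = 1" by simp
          moreover have "(t / u) powr (1 - e) = (t / u) powr (\<theta> + e) * (t / u) powr e"
            unfolding e(2) by (rule powr_add)
          ultimately have "(u / t) powr (\<theta> + e) * (t / u) powr (1 - e) = (t / u) powr e" by simp
          then have "D * (u / t) powr (\<theta> + e) * (t / u) powr (1 - e) = D * (t / u) powr e" by simp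
          then show ?thesis using D(1) by (simp add: ennreal_mult'[symmetric])
        qed
        finally show "\<exists>m\<in>{t..}. weight \<theta> c t * (ennreal ((t / u) powr (1 - e)) * K u f) \<le> ennreal D * (ennreal ((t / m) powr e) * Z m)"
          using u by (intro bexI[of _ u]) (simp_all add: mult.assoc)
      qed
      finally show "weight \<theta> c t * (K t f + ennreal (\<rho> t) * K_tail t f) \<le> ennreal ((1 + B) * D) * ?T"
        using B D by (simp add: ennreal_mult mult.assoc mult_left_mono)
    qed auto
    from le_ennreal_mult_trans[OF this M(2)[OF Z]]
    show "haar_norm p {0<..} (\<lambda>t. weight \<theta> c t * (K t f + ennreal (\<rho> t) * K_tail t f))
       \<le> ennreal ((1 + B) * D * M) * haar_norm p {0<..} (\<lambda>t. weight \<theta> c t * K t f)"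
      using B D unfolding Z_def by simp
  qed
qed

theorem reiteration_below_one:
  assumes p: "0 < p" and c: "c \<in> SV" and \<theta>: "0 \<le> \<theta>" "\<theta> < 1"
    and g: "\<And>t. 0 < t \<Longrightarrow> t powr - \<theta> * g t = \<rho> t powr - \<theta> * c (\<rho> t)"
  shows "same_space (interp A0 AL \<theta> p c) (interp A0 A1 \<theta> p g)"
proof -
  obtain B where B: "0 < B"
    "\<And>f. f \<in> sum_space A0 A1 \<Longrightarrow> interp A0 AL \<theta> p c f
      \<le> ennreal B * haar_norm p {0<..} (\<lambda>t. weight \<theta> c t * (K t f + ennreal (\<rho> t) * K_tail t f))"
    "\<And>f. f \<in> sum_space A0 A1 \<Longrightarrow> haar_norm p {0<..} (\<lambda>t. weight \<theta> c t * K t f) \<le> ennreal B * interp A0 AL \<theta> p c f"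
    by (rule interp_AL_equiv[OF p c \<theta>(1)]) (rule that)
  obtain M where M: "0 < M"
    "\<And>f. haar_norm p {0<..} (\<lambda>t. weight \<theta> c t * (K t f + ennreal (\<rho> t) * K_tail t f))
      \<le> ennreal M * haar_norm p {0<..} (\<lambda>t. weight \<theta> c t * K t f)"
    by (rule haar_norm_K_tail_absorbed[OF p c \<theta>]) (rule that)
  have eq: "interp A0 A1 \<theta> p g f = haar_norm p {0<..} (\<lambda>t. weight \<theta> c t * K t f)" if "f \<in> sum_space A0 A1" for f
    by (rule interp_weight_eq[OF p that]) (rule g)
  show ?thesis
  proof (rule same_spaceI[of "B * M" _ _ B])
    fix f
    show "interp A0 AL \<theta> p c f \<le> ennreal (B * M) * interp A0 A1 \<theta> p g f"
    proof (cases "f \<in> sum_space A0 A1")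
      case True
      show ?thesis unfolding eq[OF True]
        using B(1) by (intro le_ennreal_mult_trans[OF B(2)[OF True] M(2)]) simp
    qed (use B M in \<open>simp add: interp_outside ennreal_mult_top\<close>)
    show "interp A0 A1 \<theta> p g f \<le> ennreal B * interp A0 AL \<theta> p c f"
    proof (cases "f \<in> sum_space A0 A1")
      case True
      show ?thesis unfolding eq[OF True] by (rule B(3)[OF True])
    qed (use B in \<open>simp add: interp_outside ennreal_mult_top\<close>)
  qed (use B M in auto)
qed

lemma K_tail_antimono: "s \<le> t \<Longrightarrow> K_tail t f \<le> K_tail s f"
  unfolding K_tail_def by (intro Lambda_mono mult_left_mono) (auto simp: indicator_def)

lemma borel_imp_measurable_Ioi:
  "F \<in> borel_measurable borel \<Longrightarrow> F \<in> borel_measurable (lebesgue_on {0<..})"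
  for F :: "real \<Rightarrow> ennreal"
  by (intro measurable_restrict_space1 measurable_completion) simp

text \<open>
  The quasi-triangle inequality needs measurable summands; the weights are therefore replaced by
  their dyadic versions before it is applied.
\<close>
lemma haar_norm_split:
  assumes p: "0 < p" and c: "c \<in> SV"
  obtains C where "0 < C"
    "\<And>f. haar_norm p {0<..} (\<lambda>t. weight 1 c t * (K t f + ennreal (\<rho> t) * K_tail t f))
      \<le> ennreal C * (haar_norm p {0<..} (\<lambda>t. weight 1 c t * K t f) + haar_norm p {0<..} (\<lambda>t. weight 0 c t * K_tail t f))"
proof -
  obtain U where U: "0 < U" and tri: "\<And>S f g. S \<in> sets lebesgue \<Longrightarrow> S \<subseteq> {0<..} \<Longrightarrow>
      f \<in> borel_measurable (lebesgue_on {0<..}) \<Longrightarrow> g \<in> borel_measurable (lebesgue_on {0<..}) \<Longrightarrow>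
      haar_norm p S (\<lambda>u. f u + g u) \<le> ennreal U * (haar_norm p S f + haar_norm p S g)"
    using haar_norm_triangle[OF p] by blast
  obtain D1 where D1: "0 < D1" "moderate D1 (1 + 1) (weight 1 c)"
    by (rule weight_moderate[OF c zero_le_one zero_less_one]) (rule that)
  obtain D0 where D0: "0 < D0" "moderate D0 (0 + 1) (weight 0 c)"
    by (rule weight_moderate[OF c order_refl zero_less_one]) (rule that)
  define E where "E = max (D1 * 2 powr (1 + 1)) (D0 * 2 powr (0 + 1))"
  have E: "0 < E" using D0 D1 by (simp add: E_def less_max_iff_disj)
  define W1 where "W1 t = weight 1 c (dyadic t)" for t
  define W0 where "W0 t = weight 0 c (dyadic t)" for t
  have nn: "(0::real) \<le> 1 + 1" "(0::real) \<le> 0 + 1" by auto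
  note m1 = moderate_dyadic[OF D1(2) nn(1) D1(1), folded W1_def]
  note m0 = moderate_dyadic[OF D0(2) nn(2) D0(1), folded W0_def]
  have w: "ennreal (D1 * 2 powr (1 + 1)) * z \<le> ennreal E * z" "ennreal (D0 * 2 powr (0 + 1)) * z \<le> ennreal E * z" for z
    by (auto intro!: mult_right_mono ennreal_leI simp: E_def)
  have le: "weight 1 c t \<le> ennreal E * W1 t" "W1 t \<le> ennreal E * weight 1 c t"
    "weight 0 c t \<le> ennreal E * W0 t" "W0 t \<le> ennreal E * weight 0 c t" if t: "0 < t" for t
    using m1(3)[OF t] m1(4)[OF t] m0(3)[OF t] m0(4)[OF t] w by (blast intro: order_trans)+
  show thesis
  proof (rule that[of "E * U * E"])
    show "0 < E * U * E" using E U by simp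
    fix f
    have V01: "weight 1 c t * ennreal (\<rho> t) = weight 0 c t" if "0 < t" for t
      using rho_pos[OF that] by (simp add: weight_def ennreal_mult''[symmetric] powr_minus_divide)
    have "haar_norm p {0<..} (\<lambda>t. weight 1 c t * (K t f + ennreal (\<rho> t) * K_tail t f)) \<le> ennreal E * haar_norm p {0<..} (\<lambda>t. W1 t * K t f + W0 t * K_tail t f)"
    proof (intro haar_norm_le_cmult[OF p E] AE_I2 impI conjI)
      fix t :: real assume "t \<in> {0<..}"
      then have t: "0 < t" by simp
      have "weight 1 c t * (K t f + ennreal (\<rho> t) * K_tail t f) = weight 1 c t * K t f + weight 0 c t * K_tail t f"
        by (simp only: distrib_left mult.assoc[symmetric] V01[OF t])
      also have "\<dots> \<le> (ennreal E * W1 t) * K t f + (ennreal E * W0 t) * K_tail t f"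
        using le[OF t] by (intro add_mono mult_right_mono) auto
      also have "\<dots> = ennreal E * (W1 t * K t f + W0 t * K_tail t f)" by (simp only: distrib_left mult.assoc)
      finally show "weight 1 c t * (K t f + ennreal (\<rho> t) * K_tail t f) \<le> ennreal E * (W1 t * K t f + W0 t * K_tail t f)" .
    qed auto
    moreover have "haar_norm p {0<..} (\<lambda>t. W1 t * K t f + W0 t * K_tail t f)
        \<le> ennreal U * (haar_norm p {0<..} (\<lambda>t. W1 t * K t f) + haar_norm p {0<..} (\<lambda>t. W0 t * K_tail t f))"
      by (intro tri borel_measurable_times_ennreal borel_imp_measurable_Ioi m1(1) m0(1)
          borel_measurable_increasing Kfun_mono borel_measurable_decreasing K_tail_antimono) auto
    ultimately have 1: "haar_norm p {0<..} (\<lambda>t. weight 1 c t * (K t f + ennreal (\<rho> t) * K_tail t f))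
        \<le> ennreal (E * U) * (haar_norm p {0<..} (\<lambda>t. W1 t * K t f) + haar_norm p {0<..} (\<lambda>t. W0 t * K_tail t f))"
      using E by (intro le_ennreal_mult_trans) auto
    have a: "haar_norm p {0<..} (\<lambda>t. W1 t * K t f) \<le> ennreal E * haar_norm p {0<..} (\<lambda>t. weight 1 c t * K t f)"
    proof (intro haar_norm_le_cmult[OF p E] AE_I2 impI conjI)
      fix t :: real assume "t \<in> {0<..}"
      then show "W1 t * K t f \<le> ennreal E * (weight 1 c t * K t f)"
        using mult_right_mono[OF le(2), of t "K t f"] by (simp add: mult.assoc)
    qed auto
    have b: "haar_norm p {0<..} (\<lambda>t. W0 t * K_tail t f) \<le> ennreal E * haar_norm p {0<..} (\<lambda>t. weight 0 c t * K_tail t f)"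
    proof (intro haar_norm_le_cmult[OF p E] AE_I2 impI conjI)
      fix t :: real assume "t \<in> {0<..}"
      then show "W0 t * K_tail t f \<le> ennreal E * (weight 0 c t * K_tail t f)"
        using mult_right_mono[OF le(4), of t "K_tail t f"] by (simp add: mult.assoc)
    qed auto
    have "haar_norm p {0<..} (\<lambda>t. W1 t * K t f) + haar_norm p {0<..} (\<lambda>t. W0 t * K_tail t f)
      \<le> ennreal E * (haar_norm p {0<..} (\<lambda>t. weight 1 c t * K t f) + haar_norm p {0<..} (\<lambda>t. weight 0 c t * K_tail t f))"
      unfolding distrib_left by (rule add_mono[OF a b])
    from le_ennreal_mult_trans[OF 1 this]
    show "haar_norm p {0<..} (\<lambda>t. weight 1 c t * (K t f + ennreal (\<rho> t) * K_tail t f))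
      \<le> ennreal (E * U * E) * (haar_norm p {0<..} (\<lambda>t. weight 1 c t * K t f) + haar_norm p {0<..} (\<lambda>t. weight 0 c t * K_tail t f))"
      using E U by simp
  qed
qed

theorem reiteration_one:
  assumes p: "0 < p" and c: "c \<in> SV"
  shows "same_space (interp A0 AL 1 p c)
    (inter_norm (interp A0 A1 1 p (\<lambda>t. chi1 t * c (\<rho> t))) (interp_LR A0 A1 1 p (c \<circ> \<rho>) r b q a))"
    (is "same_space ?M (inter_norm ?N ?R)")
proof -
  obtain B where B: "0 < B"
    "\<And>f. f \<in> sum_space A0 A1 \<Longrightarrow> interp A0 AL 1 p c f
      \<le> ennreal B * haar_norm p {0<..} (\<lambda>t. weight 1 c t * (K t f + ennreal (\<rho> t) * K_tail t f))"
    "\<And>f. f \<in> sum_space A0 A1 \<Longrightarrow> haar_norm p {0<..} (\<lambda>t. weight 1 c t * K t f) \<le> ennreal B * interp A0 AL 1 p c f"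
    "\<And>f. f \<in> sum_space A0 A1 \<Longrightarrow>
      haar_norm p {0<..} (\<lambda>t. weight 1 c t * (ennreal (\<rho> t) * K_tail t f)) \<le> ennreal B * interp A0 AL 1 p c f"
    by (rule interp_AL_equiv[OF p c zero_le_one]) (rule that)
  obtain M where M: "0 < M"
    "\<And>f. haar_norm p {0<..} (\<lambda>t. weight 1 c t * (K t f + ennreal (\<rho> t) * K_tail t f))
      \<le> ennreal M * (haar_norm p {0<..} (\<lambda>t. weight 1 c t * K t f) + haar_norm p {0<..} (\<lambda>t. weight 0 c t * K_tail t f))"
    by (rule haar_norm_split[OF p c]) (rule that)
  have g: "t powr - 1 * (chi1 t * c (\<rho> t)) = \<rho> t powr - 1 * c (\<rho> t)" if "0 < t" for t
    using that rho_pos[OF that] chi_pos[OF that] by (simp add: powr_minus_divide rho_def)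
  have N: "?N f = haar_norm p {0<..} (\<lambda>t. weight 1 c t * K t f)" if "f \<in> sum_space A0 A1" for f
    by (rule interp_weight_eq[OF p that g])
  have V01: "weight 1 c t * (ennreal (\<rho> t) * z) = weight 0 c t * z" if "0 < t" for t z
  proof -
    have "weight 1 c t * ennreal (\<rho> t) = weight 0 c t"
      using rho_pos[OF that] by (simp add: weight_def ennreal_mult''[symmetric] powr_minus_divide)
    then show ?thesis by (simp only: mult.assoc[symmetric])
  qed
  have R: "?R f = haar_norm p {0<..} (\<lambda>t. weight 0 c t * K_tail t f)" if "f \<in> sum_space A0 A1" for f
    by (rule interp_LR_eq[OF p that])
  have R': "haar_norm p {0<..} (\<lambda>t. weight 1 c t * (ennreal (\<rho> t) * K_tail t f)) = haar_norm p {0<..} (\<lambda>t. weight 0 c t * K_tail t f)" for f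
    by (intro haar_norm_cong[OF p]) (simp add: V01)
  show ?thesis
  proof (rule same_spaceI[of "B * M * 2" _ _ B])
    fix f
    show "?M f \<le> ennreal (B * M * 2) * inter_norm ?N ?R f"
    proof (cases "f \<in> sum_space A0 A1")
      case True
      have "?N f + ?R f \<le> ennreal 2 * inter_norm ?N ?R f"
        unfolding inter_norm_def by (simp add: mult_2 add_mono)
      note sum_le = this
      have "?M f \<le> ennreal (B * M) * (?N f + ?R f)"
        unfolding N[OF True] R[OF True] using B(1) by (intro le_ennreal_mult_trans[OF B(2)[OF True] M(2)]) simp
      from le_ennreal_mult_trans[OF this sum_le] show ?thesis using B(1) M(1) by simp
    qed (use B M in \<open>simp add: interp_outside inter_norm_def ennreal_mult_top\<close>)
    show "inter_norm ?N ?R f \<le> ennreal B * ?M f"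
    proof (cases "f \<in> sum_space A0 A1")
      case True
      show ?thesis unfolding inter_norm_def N[OF True] R[OF True]
        using B(3)[OF True] B(4)[OF True] unfolding R' by simp
    qed (use B in \<open>simp add: interp_outside ennreal_mult_top\<close>)
  qed (use B M in auto)
qed

end

theorem theorem25:
  fixes A0 A1 :: "'v::real_vector \<Rightarrow> ennreal"
    and q1 r1 r :: ennreal
    and a1 b1 a :: "real \<Rightarrow> real"
  assumes "quasi_Banach A0" and "quasi_Banach A1"
    and "compatible_couple A0 A1"
    and "carrier_of A0 \<inter> carrier_of A1 \<noteq> {0}"
    and "0 < q1" and "0 < r1"
    and "a1 \<in> SV" and "b1 \<in> SV"
    and "wnorm 0 r1 {1<..} b1 (\<lambda>_. 1) < \<infinity>"
    and "wnorm 0 r1 {0<..<1} b1 (\<lambda>s. wnorm 0 q1 {0<..<s} a1 (\<lambda>_. 1)) < \<infinity>"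
    and "0 < r" and "a \<in> SV"
  defines "\<chi>\<^sub>1 \<equiv> chi r1 b1 q1 a1"
    and "\<rho> \<equiv> rho r1 b1 q1 a1"
    and "AL \<equiv> interp_L A0 A1 1 r1 b1 q1 a1"
  shows "(\<forall>\<theta>. 0 < \<theta> \<and> \<theta> < 1 \<longrightarrow>
            same_space (interp A0 AL \<theta> r a)
              (interp A0 A1 \<theta> r (\<lambda>t. \<chi>\<^sub>1 t powr \<theta> * a (\<rho> t))))
       \<and> (wnorm 0 r {1<..} a (\<lambda>_. 1) < \<infinity> \<longrightarrow>
            same_space (interp A0 AL 0 r a) (interp A0 A1 0 r (a \<circ> \<rho>)))
       \<and> (wnorm 0 r {0<..<1} a (\<lambda>_. 1) < \<infinity> \<longrightarrow>
            same_space (interp A0 AL 1 r a)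
              (inter_norm (interp A0 A1 1 r (\<lambda>t. \<chi>\<^sub>1 t * a (\<rho> t)))
                          (interp_LR A0 A1 1 r (a \<circ> \<rho>) r1 b1 q1 a1)))"
proof -
  have P: "wnorm 0 q1 {0<..<s} a1 (\<lambda>_. 1) = haar_norm q1 {0<..<s} (\<lambda>u. ennreal (a1 u))" for s
    using assms(5) by (subst wnorm_eq_haar_norm) (auto intro!: haar_norm_cong)
  have "wnorm 0 r1 {1<..} b1 (\<lambda>_. 1) = haar_norm r1 {1<..} (\<lambda>u. ennreal (b1 u))"
    using assms(6) by (subst wnorm_eq_haar_norm) (auto intro!: haar_norm_cong)
  moreover have "wnorm 0 r1 {0<..<1} b1 (\<lambda>s. wnorm 0 q1 {0<..<s} a1 (\<lambda>_. 1))
      = haar_norm r1 {0<..<1} (\<lambda>s. ennreal (b1 s) * haar_norm q1 {0<..<s} (\<lambda>u. ennreal (a1 u)))"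
    unfolding P using assms(6) by (subst wnorm_eq_haar_norm) (auto intro!: haar_norm_cong)
  ultimately interpret L_couple q1 r1 a1 b1 A0 A1
    using assms by unfold_locales (auto simp: quasi_Banach_def)
  have g: "t powr - \<theta> * (\<chi>\<^sub>1 t powr \<theta> * a (\<rho> t)) = \<rho> t powr - \<theta> * a (\<rho> t)" if "0 < t" for t \<theta>
    using that chi_pos[OF that] unfolding \<chi>\<^sub>1_def \<rho>_def rho_def
    by (simp add: powr_divide powr_minus divide_simps)
  show ?thesis
  proof (intro conjI allI impI)
    fix \<theta> :: real assume "0 < \<theta> \<and> \<theta> < 1"
    then show "same_space (interp A0 AL \<theta> r a) (interp A0 A1 \<theta> r (\<lambda>t. \<chi>\<^sub>1 t powr \<theta> * a (\<rho> t)))"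
      unfolding AL_def using g assms(11,12) unfolding \<rho>_def by (intro reiteration_below_one) auto
  next
    show "same_space (interp A0 AL 0 r a) (interp A0 A1 0 r (a \<circ> \<rho>))"
      unfolding AL_def \<rho>_def using assms(11,12) by (intro reiteration_below_one) (auto simp: rho_nonzero)
  next
    show "same_space (interp A0 AL 1 r a)
      (inter_norm (interp A0 A1 1 r (\<lambda>t. \<chi>\<^sub>1 t * a (\<rho> t))) (interp_LR A0 A1 1 r (a \<circ> \<rho>) r1 b1 q1 a1))"
      unfolding AL_def \<rho>_def \<chi>\<^sub>1_def using assms(11,12) by (intro reiteration_one)
  qed
qed

end
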